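(* Let $\Lambda$ be a cyclic Nakayama algebra of infinite global dimension. Then $\varphi\dim\Lambda$ is an even number.
   Context: Cyclic Nakayama algebras. Let $k$ be a field and let $Q$ be the cyclic quiver with vertices $1,\dots,N$ ($N\ge 3$) and arrows $\alpha_i:i\to i+1$ for $1\le i<N$ and $\alpha_N:N\to 1$; indices are read modulo $N$, and paths are written right to left. A cyclic Nakayama algebra is $\Lambda=kQ/\langle REL\rangle$, where $REL$ is an irredundant system of $r\ge 1$ monomial relations $\alpha_{k_{2i}}\cdots\alpha_{k_{2i-1}+1}\alpha_{k_{2i-1}}=0$ ($1\le i\le r$) with $k_f\in\{1,\dots,N\}$ and $1\le k_1<k_3<\dots<k_{2r-1}\le N$. Irredundant means no relation is a consequence of the others. Each relation is a path of length at least $2$ (possibly winding several times around the cycle). All modules are finitely generated; they are identified with representations of $Q$ satisfying the relations. The $\varphi$-dimension. For an artin algebra $\Lambda$ let $K_0$ be the abelian group generated by symbols $[X]$, $X$ a finitely generated $\Lambda$-module, modulo $[C]=[A]+[B]$ if $C\cong A\oplus B$ and $[P]=0$ if $P$ is projective. Let $L:K_0\to K_0$ be the homomorphism with $L[M]=[\Omega M]$, where $\Omega M$ is the first syzygy of $M$ (kernel of a projective cover). For a module $M$ let $\langle \mathrm{add}\,M\rangle$ be the subgroup of $K_0$ generated by the classes of all indecomposable summands of $M$. Define $$\varphi(M)=\min\{t\ge 0\mid \operatorname{rank}(L^t\langle \mathrm{add}\,M\rangle)=\operatorname{rank}(L^{t+j}\langle \mathrm{add}\,M\rangle)\text{ for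 all } j\ge 1\},$$ and $\varphi\dim(\Lambda)=\sup\{\varphi(M)\mid M \text{ a finitely generated } \Lambda\text{-module}\}$. *)

theory Defs
  imports
    "Jordan_Normal_Form.Matrix"
    "HOL-Algebra.Free_Abelian_Groups"
    "HOL-Algebra.Coset"
    "HOL-Algebra.Generated_Groups"
    "HOL-Library.Extended_Nat"
begin

section \<open>Cyclic quivers with monomial relations\<close>

text \<open>
  The quiver has the vertices \<open>1, \<dots>, N\<close>, and the arrow number \<open>i\<close> goes from \<open>i\<close> to \<open>nxt N i\<close>.
  A path is encoded as the pair \<open>(s, l)\<close> of its starting vertex and its length: it is
  the product of the \<open>l\<close> consecutive arrows that begin with arrow \<open>s\<close>.  The length, rather than the
  last arrow, is recorded because a path may wind several times around the cycle.
\<close>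

type_synonym path = "nat \<times> nat"

definition nxt :: "nat \<Rightarrow> nat \<Rightarrow> nat" where
  "nxt N i = (if i = N then 1 else i + 1)"

text \<open>
  The relations \<open>p = 0\<close> that follow from \<open>{q = 0 | q \<in> S}\<close>: a vanishing path may be
  multiplied by an arrow, on the side of its start or of its end.  These are the paths that lie
  in the two-sided ideal of the path algebra generated by \<open>S\<close>.
\<close>

inductive consequence :: "nat \<Rightarrow> path set \<Rightarrow> path \<Rightarrow> bool" for N S where
  axiom: "p \<in> S \<Longrightarrow> consequence N S p"
| extend_end: "consequence N S (s, l) \<Longrightarrow> consequence N S (s, Suc l)"
| extend_start: "s \<in> {1..N} \<Longrightarrow> consequence N S (nxt N s, l) \<Longrightarrow> consequence N S (s, Suc l)"

definition irredundant :: "nat \<Rightarrow> path list \<Rightarrow> bool" where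
  "irredundant N REL \<longleftrightarrow> (\<forall>p\<in>set REL. \<not> consequence N (set REL - {p}) p)"

text \<open>
  The data \<open>(N, REL)\<close> of a cyclic Nakayama algebra.  The number of relations is \<open>length REL\<close>, and
  their starting vertices are strictly increasing.
\<close>

definition cyclic_nakayama :: "nat \<Rightarrow> path list \<Rightarrow> bool" where
  "cyclic_nakayama N REL \<longleftrightarrow>
     3 \<le> N \<and> 1 \<le> length REL \<and>
     (\<forall>(s, l)\<in>set REL. s \<in> {1..N} \<and> 2 \<le> l) \<and>
     sorted_wrt (<) (map fst REL) \<and>
     irredundant N REL"

section \<open>Modules as representations\<close>

text \<open>
  A finite-dimensional representation has the space \<open>k\<close> to the power \<open>dm V i\<close> at the vertex \<open>i\<close>, and
  \<open>mp V i\<close> is the matrix of the arrow \<open>i\<close>.  Every finite-dimensional representation is isomorphic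
  to one of this form.  Values at indices outside \<open>{1..N}\<close> are irrelevant.
\<close>

datatype 'k rep = Rep (dm: "nat \<Rightarrow> nat") (mp: "nat \<Rightarrow> 'k mat")

type_synonym 'k morphism = "nat \<Rightarrow> 'k mat"

primrec path_mat :: "nat \<Rightarrow> 'k::field rep \<Rightarrow> nat \<Rightarrow> nat \<Rightarrow> 'k mat" where
  "path_mat N V s 0 = 1\<^sub>m (dm V s)"
| "path_mat N V s (Suc l) = mp V ((nxt N ^^ l) s) * path_mat N V s l"

definition satisfies :: "nat \<Rightarrow> 'k::field rep \<Rightarrow> path \<Rightarrow> bool" where
  "satisfies N V p \<longleftrightarrow>
     (case p of (s, l) \<Rightarrow> path_mat N V s l = 0\<^sub>m (dm V ((nxt N ^^ l) s)) (dm V s))"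

definition modules :: "nat \<Rightarrow> path list \<Rightarrow> 'k::field rep set" where
  "modules N REL = {V. (\<forall>i\<in>{1..N}. mp V i \<in> carrier_mat (dm V (nxt N i)) (dm V i)) \<and>
                       (\<forall>p\<in>set REL. satisfies N V p)}"

definition rep_hom :: "nat \<Rightarrow> 'k::field rep \<Rightarrow> 'k rep \<Rightarrow> 'k morphism set" where
  "rep_hom N V W = {f. \<forall>i\<in>{1..N}. f i \<in> carrier_mat (dm W i) (dm V i) \<and>
                                   f (nxt N i) * mp V i = mp W i * f i}"

definition rep_iso :: "nat \<Rightarrow> 'k::field rep \<Rightarrow> 'k rep \<Rightarrow> bool" where
  "rep_iso N V W \<longleftrightarrow> (\<exists>f\<in>rep_hom N V W. \<exists>g\<in>rep_hom N W V.
     \<forall>i\<in>{1..N}. g i * f i = 1\<^sub>m (dm V i) \<and> f i * g i = 1\<^sub>m (dm W i))"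

definition comp_mor :: "'k::field morphism \<Rightarrow> 'k morphism \<Rightarrow> 'k morphism" where
  "comp_mor g f = (\<lambda>i. g i * f i)"

definition im_at :: "'k::field rep \<Rightarrow> 'k morphism \<Rightarrow> nat \<Rightarrow> 'k vec set" where
  "im_at V f i = {f i *\<^sub>v v | v. v \<in> carrier_vec (dm V i)}"

definition ker_at :: "'k::field rep \<Rightarrow> 'k rep \<Rightarrow> 'k morphism \<Rightarrow> nat \<Rightarrow> 'k vec set" where
  "ker_at V W f i = {v \<in> carrier_vec (dm V i). f i *\<^sub>v v = 0\<^sub>v (dm W i)}"

definition rep_epi :: "nat \<Rightarrow> 'k::field rep \<Rightarrow> 'k rep \<Rightarrow> 'k morphism \<Rightarrow> bool" where
  "rep_epi N V W f \<longleftrightarrow> f \<in> rep_hom N V W \<and> (\<forall>i\<in>{1..N}. im_at V f i = carrier_vec (dm W i))"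

definition rep_mono :: "nat \<Rightarrow> 'k::field rep \<Rightarrow> 'k rep \<Rightarrow> 'k morphism \<Rightarrow> bool" where
  "rep_mono N V W f \<longleftrightarrow> f \<in> rep_hom N V W \<and> (\<forall>i\<in>{1..N}. ker_at V W f i = {0\<^sub>v (dm V i)})"

definition exact_seq ::
    "nat \<Rightarrow> 'k::field rep \<Rightarrow> 'k rep \<Rightarrow> 'k rep \<Rightarrow> 'k morphism \<Rightarrow> 'k morphism \<Rightarrow> bool" where
  "exact_seq N U V W f g \<longleftrightarrow> f \<in> rep_hom N U V \<and> g \<in> rep_hom N V W \<and>
     (\<forall>i\<in>{1..N}. im_at U f i = ker_at V W g i)"

definition zero_rep :: "nat \<Rightarrow> 'k::field rep \<Rightarrow> bool" where
  "zero_rep N V \<longleftrightarrow> (\<forall>i\<in>{1..N}. dm V i = 0)"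

definition dsum :: "'k::field rep \<Rightarrow> 'k rep \<Rightarrow> 'k rep" where
  "dsum V W = Rep (\<lambda>i. dm V i + dm W i)
     (\<lambda>i. four_block_mat (mp V i) (0\<^sub>m (dim_row (mp V i)) (dim_col (mp W i)))
                          (0\<^sub>m (dim_row (mp W i)) (dim_col (mp V i))) (mp W i))"

definition indecomposable :: "nat \<Rightarrow> path list \<Rightarrow> 'k::field rep \<Rightarrow> bool" where
  "indecomposable N REL X \<longleftrightarrow> X \<in> modules N REL \<and> \<not> zero_rep N X \<and>
     (\<forall>A\<in>modules N REL. \<forall>B\<in>modules N REL.
        rep_iso N X (dsum A B) \<longrightarrow> zero_rep N A \<or> zero_rep N B)"

definition summand :: "nat \<Rightarrow> path list \<Rightarrow> 'k::field rep \<Rightarrow> 'k rep \<Rightarrow> bool" where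
  "summand N REL X M \<longleftrightarrow> X \<in> modules N REL \<and> (\<exists>Y\<in>modules N REL. rep_iso N M (dsum X Y))"

section \<open>Projectives, syzygies and the global dimension\<close>

definition projective :: "nat \<Rightarrow> path list \<Rightarrow> 'k::field rep \<Rightarrow> bool" where
  "projective N REL P \<longleftrightarrow> P \<in> modules N REL \<and>
     (\<forall>X\<in>modules N REL. \<forall>Y\<in>modules N REL. \<forall>g f.
        rep_epi N X Y g \<longrightarrow> f \<in> rep_hom N P Y \<longrightarrow>
        (\<exists>h\<in>rep_hom N P X. \<forall>i\<in>{1..N}. comp_mor g h i = f i))"

text \<open>A projective cover is an essential epimorphism from a projective module.\<close>

definition projective_cover ::
    "nat \<Rightarrow> path list \<Rightarrow> 'k::field rep \<Rightarrow> 'k rep \<Rightarrow> 'k morphism \<Rightarrow> bool" where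
  "projective_cover N REL P M p \<longleftrightarrow> projective N REL P \<and> rep_epi N P M p \<and>
     (\<forall>X\<in>modules N REL. \<forall>h\<in>rep_hom N X P. rep_epi N X M (comp_mor p h) \<longrightarrow> rep_epi N X P h)"

definition is_syzygy :: "nat \<Rightarrow> path list \<Rightarrow> 'k::field rep \<Rightarrow> 'k rep \<Rightarrow> bool" where
  "is_syzygy N REL M K \<longleftrightarrow> K \<in> modules N REL \<and>
     (\<exists>P p j. projective_cover N REL P M p \<and> rep_mono N K P j \<and> exact_seq N K P M j p)"

text \<open>
  A projective resolution of \<open>M\<close> of length at most \<open>n\<close>, with augmentation \<open>d 0 : P 0 \<rightarrow> M\<close> and
  differentials \<open>d (j + 1) : P (j + 1) \<rightarrow> P j\<close>.
\<close>

definition proj_resolution ::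
    "nat \<Rightarrow> path list \<Rightarrow> 'k::field rep \<Rightarrow> nat \<Rightarrow> (nat \<Rightarrow> 'k rep) \<Rightarrow> (nat \<Rightarrow> 'k morphism) \<Rightarrow> bool"
  where
  "proj_resolution N REL M n P d \<longleftrightarrow>
     (\<forall>j. projective N REL (P j)) \<and> (\<forall>j>n. zero_rep N (P j)) \<and>
     rep_epi N (P 0) M (d 0) \<and>
     exact_seq N (P 1) (P 0) M (d 1) (d 0) \<and>
     (\<forall>j. exact_seq N (P (j + 2)) (P (j + 1)) (P j) (d (j + 2)) (d (j + 1)))"

definition proj_dim :: "nat \<Rightarrow> path list \<Rightarrow> 'k::field rep \<Rightarrow> enat" where
  "proj_dim N REL M = Inf {enat n | n. \<exists>P d. proj_resolution N REL M n P d}"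

definition global_dim :: "'k::field itself \<Rightarrow> nat \<Rightarrow> path list \<Rightarrow> enat" where
  "global_dim _ N REL = (SUP M \<in> (modules N REL :: 'k rep set). proj_dim N REL M)"

section \<open>The group \<open>K\<^sub>0\<close> and the \<open>\<phi>\<close>-dimension\<close>

definition K0_relators :: "nat \<Rightarrow> path list \<Rightarrow> ('k::field rep \<Rightarrow>\<^sub>0 int) set" where
  "K0_relators N REL =
     {frag_of C - frag_of A - frag_of B | A B C.
        A \<in> modules N REL \<and> B \<in> modules N REL \<and> C \<in> modules N REL \<and> rep_iso N C (dsum A B)} \<union>
     {frag_of P | P. projective N REL P}"

definition K0_kernel :: "nat \<Rightarrow> path list \<Rightarrow> ('k::field rep \<Rightarrow>\<^sub>0 int) set" where
  "K0_kernel N REL = generate (free_Abelian_group (modules N REL)) (K0_relators N REL)"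

definition K0 :: "nat \<Rightarrow> path list \<Rightarrow> ('k::field rep \<Rightarrow>\<^sub>0 int) set monoid" where
  "K0 N REL = free_Abelian_group (modules N REL) Mod K0_kernel N REL"

definition K0_class :: "nat \<Rightarrow> path list \<Rightarrow> 'k::field rep \<Rightarrow> ('k rep \<Rightarrow>\<^sub>0 int) set" where
  "K0_class N REL M = K0_kernel N REL #>\<^bsub>free_Abelian_group (modules N REL)\<^esub> frag_of M"

text \<open>The operator \<open>L\<close>; extensionality only fixes its irrelevant values outside the group.\<close>

definition L_op ::
    "nat \<Rightarrow> path list \<Rightarrow> ('k::field rep \<Rightarrow>\<^sub>0 int) set \<Rightarrow> ('k rep \<Rightarrow>\<^sub>0 int) set" where
  "L_op N REL = (THE L. L \<in> hom (K0 N REL) (K0 N REL) \<and> L \<in> extensional (carrier (K0 N REL)) \<and>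
     (\<forall>M\<in>modules N REL. \<forall>K. is_syzygy N REL M K \<longrightarrow>
        L (K0_class N REL M) = K0_class N REL K))"

definition add_subgroup :: "nat \<Rightarrow> path list \<Rightarrow> 'k::field rep \<Rightarrow> ('k rep \<Rightarrow>\<^sub>0 int) set set" where
  "add_subgroup N REL M = generate (K0 N REL)
     {K0_class N REL X | X. indecomposable N REL X \<and> summand N REL X M}"

definition z_independent :: "('g, 'm) monoid_scheme \<Rightarrow> 'g set \<Rightarrow> bool" where
  "z_independent G B \<longleftrightarrow> finite B \<and> B \<subseteq> carrier G \<and>
     (\<forall>c :: 'g \<Rightarrow> int. finprod G (\<lambda>b. b [^]\<^bsub>G\<^esub> c b) B = \<one>\<^bsub>G\<^esub> \<longrightarrow> (\<forall>b\<in>B. c b = 0))"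

definition z_rank :: "('g, 'm) monoid_scheme \<Rightarrow> 'g set \<Rightarrow> enat" where
  "z_rank G H = Sup {enat (card B) | B. B \<subseteq> H \<and> z_independent G B}"

definition phi_fun :: "nat \<Rightarrow> path list \<Rightarrow> 'k::field rep \<Rightarrow> nat" where
  "phi_fun N REL M = (LEAST t. \<forall>j\<ge>1.
     z_rank (K0 N REL) ((L_op N REL ^^ t) ` add_subgroup N REL M) =
     z_rank (K0 N REL) ((L_op N REL ^^ (t + j)) ` add_subgroup N REL M))"

definition phi_dim :: "'k::field itself \<Rightarrow> nat \<Rightarrow> path list \<Rightarrow> enat" where
  "phi_dim _ N REL = (SUP M \<in> (modules N REL :: 'k rep set). enat (phi_fun N REL M))"

end

theory Submission
  imports Defs "Jordan_Normal_Form.Determinant"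
begin

text \<open>
  Every module is a direct sum of uniserial modules, and its multiplicities can be read off the ranks of the
  path matrices; hence \<open>K\<^sub>0\<close> is free on the classes of the nonprojective uniserials, and \<open>L\<close> maps each
  of these basis elements to a basis element or to \<open>0\<close>.  So \<open>\<phi>dim\<close> is the least \<open>d\<close> for which
  the decreasing chain of the sets of nonzero \<open>d\<close>-th syzygies of basis elements becomes stationary.

  Write a uniserial with top \<open>x\<close> as an interval \<open>[x, y)\<close> of integers modulo shifts by \<open>N\<close>, the projective
  with top \<open>x\<close> being \<open>[x, f x)\<close>.  Then \<open>\<Omega>[x, y) = [y, f x)\<close>, and as \<open>f\<close> is monotone, the \<open>2t\<close>-th and the
  \<open>(2t + 1)\<close>-st set of the chain consist of the \<open>[x, y)\<close> with \<open>x < y < f x\<close>, \<open>x \<in> f\<^sup>t \<int>\<close>, and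
  \<open>y \<in> f\<^sup>t \<int>\<close> or \<open>y \<in> f\<^bsup>t+1\<^esup> \<int>\<close>, respectively.  If the global dimension is infinite, an infinite syzygy
  orbit provides for each \<open>x\<close> some \<open>y \<in> f\<^bsup>t+1\<^esup> \<int>\<close> with \<open>x < y < f x\<close>.  If the chain is stationary from
  \<open>2t + 1\<close> on, this gives \<open>f\<^sup>t \<int> = f\<^bsup>t+1\<^esup> \<int>\<close>, so it is already stationary from \<open>2t\<close> on.
\<close>

section \<open>Matrices\<close>

text \<open>On vertices modulo \<open>N\<close> the order of interval endpoints is lost; this is why
  the combinatorics is lifted to the integers, where the Kupisch inequality becomes monotonicity of
  \<open>f\<close>. The parity stems from the two endpoints being advanced in turn: passing to an
  odd stage changes the set of right ends, passing to an even stage that of left ends. Infinite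
  global dimension enters only through one orbit of \<open>omega\<close> that never leaves
  \<open>Bas\<close>. On the module side, \<open>K0\<close> is given by generators and relations, so
  independence in it has to be detected by invariants. Ranks of path matrices are additive and
  invariant under isomorphism, and they replace the uniqueness part of the Krull-Schmidt theorem.
  Likewise, \<open>L_op\<close> is a definite description, so that syzygies must be shown to exist,
  to be unique up to isomorphism and to be compatible with direct sums. The resulting number depends
  only on the lengths of the projectives, not on the field.\<close>

lemma mult_assoc_dim:
  "dim_col A = dim_row B \<Longrightarrow> dim_col B = dim_row C \<Longrightarrow> A * B * C = A * (B * (C :: 'a::semiring_0 mat))"
  by (rule assoc_mult_mat[of _ "dim_row A" "dim_row B" _ "dim_row C" _ "dim_col C"]) auto

lemma mult_distrib_left_dim:
  "dim_col A = dim_row B \<Longrightarrow> dim_row B = dim_row C \<Longrightarrow> dim_col B = dim_col C \<Longrightarrow>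
    A * (B + C) = A * B + A * (C :: 'a::semiring_0 mat)"
  by (rule mult_add_distrib_mat[of _ "dim_row A" "dim_row B" _ "dim_col C"]) auto

lemma mult_distrib_right_dim:
  "dim_row A = dim_row B \<Longrightarrow> dim_col A = dim_col B \<Longrightarrow> dim_col A = dim_row C \<Longrightarrow>
    (A + B) * C = A * C + B * (C :: 'a::semiring_0 mat)"
  by (rule add_mult_distrib_mat[of _ "dim_row A" "dim_col A" _ _ "dim_col C"]) auto

lemma mult_minus_left_dim:
  "dim_row A = dim_row B \<Longrightarrow> dim_col A = dim_col B \<Longrightarrow> dim_col A = dim_row C \<Longrightarrow>
    (A - B) * C = A * C - B * (C :: 'a::ring mat)"
  by (rule minus_mult_distrib_mat[of _ "dim_row A" "dim_col A" _ _ "dim_col C"]) auto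

lemma mult_minus_right_dim:
  "dim_col A = dim_row B \<Longrightarrow> dim_row B = dim_row C \<Longrightarrow> dim_col B = dim_col C \<Longrightarrow>
    A * (B - C) = A * B - A * (C :: 'a::ring mat)"
  by (rule mult_minus_distrib_mat[of _ "dim_row A" "dim_row B" _ "dim_col C"]) auto

lemma one_mult_dim: "dim_row A = n \<Longrightarrow> 1\<^sub>m n * A = (A :: 'a::semiring_1 mat)"
  by (rule left_mult_one_mat) auto

lemma mult_one_dim: "dim_col A = n \<Longrightarrow> A * 1\<^sub>m n = (A :: 'a::semiring_1 mat)"
  by (rule right_mult_one_mat) auto

lemma zero_mult_dim: "dim_row A = n \<Longrightarrow> 0\<^sub>m m n * A = 0\<^sub>m m (dim_col (A :: 'a::semiring_0 mat))"
  by (rule left_mult_zero_mat[of _ n]) auto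

lemma mult_zero_dim: "dim_col A = n \<Longrightarrow> A * 0\<^sub>m n m = 0\<^sub>m (dim_row (A :: 'a::semiring_0 mat)) m"
  by (rule right_mult_zero_mat[of _ _ n]) auto

lemma zero_add_dim: "dim_row A = n \<Longrightarrow> dim_col A = m \<Longrightarrow> 0\<^sub>m n m + A = (A :: 'a::monoid_add mat)"
  by (rule left_add_zero_mat) auto

lemma add_zero_dim: "dim_row A = n \<Longrightarrow> dim_col A = m \<Longrightarrow> A + 0\<^sub>m n m = (A :: 'a::monoid_add mat)"
  by (rule right_add_zero_mat) auto

lemma minus_self_dim: "dim_row A = n \<Longrightarrow> dim_col A = m \<Longrightarrow> A - A = (0\<^sub>m n m :: 'a::group_add mat)"
  by (rule eq_matI) auto

lemma minus_zero_dim: "dim_row A = n \<Longrightarrow> dim_col A = m \<Longrightarrow> A - 0\<^sub>m n m = (A :: 'a::group_add mat)"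
  by (rule eq_matI) auto

text \<open>The premises are equations between dimensions, which simplification can solve; premises
  of the form \<open>A \<in> carrier_mat n m\<close> would contain numbers that the term to be
  rewritten does not determine.\<close>

lemmas mat_algebra = mult_assoc_dim mult_distrib_left_dim mult_distrib_right_dim
  mult_minus_left_dim mult_minus_right_dim one_mult_dim mult_one_dim zero_mult_dim mult_zero_dim
  zero_add_dim add_zero_dim minus_self_dim minus_zero_dim

lemma carrier_dims: "A \<in> carrier_mat n m \<longleftrightarrow> dim_row A = n \<and> dim_col A = m"
  by auto

lemma mult_unit_vec_eq_col: "j < dim_col A \<Longrightarrow> A *\<^sub>v unit_vec (dim_col A) j = col (A :: 'a::semiring_1 mat) j"
  by (rule eq_vecI) (auto simp: row_def)

lemma eq_mat_by_vec:
  assumes "dim_row A = dim_row B" "dim_col A = dim_col (B :: 'a::semiring_1 mat)"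
    and "\<And>v. v \<in> carrier_vec (dim_col A) \<Longrightarrow> A *\<^sub>v v = B *\<^sub>v v"
  shows "A = B"
proof (rule mat_col_eqI)
  fix i assume i: "i < dim_col B"
  have "A *\<^sub>v unit_vec (dim_col A) i = B *\<^sub>v unit_vec (dim_col A) i" by (rule assms(3)) simp
  then show "col A i = col B i"
    using i assms(2) mult_unit_vec_eq_col[of i A] mult_unit_vec_eq_col[of i B] by simp
qed (use assms in auto)

text \<open>The columns of \<open>Y\<close> are preimages of the columns of \<open>Z\<close>. This
  turns inclusions between images into matrix equations, the form in which surjectivity and
  exactness are used.\<close>

lemma factor_through_columns:
  assumes "\<And>v. v \<in> carrier_vec (dim_col Z) \<Longrightarrow> \<exists>w\<in>carrier_vec (dim_col F). F *\<^sub>v w = Z *\<^sub>v v"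
    and "dim_row F = dim_row Z"
  shows "\<exists>Y\<in>carrier_mat (dim_col F) (dim_col Z). F * Y = (Z :: 'a::semiring_1 mat)"
proof -
  define n where "n = dim_col Z"
  have "\<forall>j. \<exists>w\<in>carrier_vec (dim_col F). F *\<^sub>v w = Z *\<^sub>v unit_vec n j"
    using assms(1) by (simp add: n_def)
  then obtain w where w: "\<And>j. w j \<in> carrier_vec (dim_col F)" "\<And>j. F *\<^sub>v w j = Z *\<^sub>v unit_vec n j"
    by metis
  define Y where "Y = mat_of_cols (dim_col F) (map w [0..<n])"
  have Y: "Y \<in> carrier_mat (dim_col F) n" by (auto simp: Y_def)
  have "F * Y = Z"
  proof (rule mat_col_eqI)
    fix i assume i: "i < dim_col Z"
    have "col (F * Y) i = F *\<^sub>v col Y i"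
      using col_mult2[of F "dim_row F" "dim_col F" Y n i] Y i by (simp add: n_def)
    also have "col Y i = w i" unfolding Y_def using i w by (subst col_mat_of_cols) (auto simp: n_def)
    finally show "col (F * Y) i = col Z i" using i w by (simp add: n_def mult_unit_vec_eq_col)
  qed (use Y assms in \<open>auto simp: n_def\<close>)
  then show ?thesis using Y by (auto simp: n_def)
qed

section \<open>Rank factorizations over a field\<close>

text \<open>If \<open>m < n\<close>, padding \<open>A\<close> with zero columns and \<open>B\<close>
  with zero rows gives square matrices with product 1. Then the product in the other order is 1 as
  well, although the padded \<open>B\<close> has a zero row.\<close>

lemma one_mat_factor_le:
  fixes A :: "'a::field mat"
  assumes A: "A \<in> carrier_mat n m" and B: "B \<in> carrier_mat m n" and AB: "A * B = 1\<^sub>m n"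
  shows "n \<le> m"
proof (rule ccontr)
  assume "\<not> n \<le> m"
  then have lt: "m < n" by simp
  define A' where "A' = four_block_mat A (0\<^sub>m n (n - m)) (0\<^sub>m 0 m) (0\<^sub>m 0 (n - m))"
  define B' where "B' = four_block_mat B (0\<^sub>m m 0) (0\<^sub>m (n - m) n) (0\<^sub>m (n - m) 0)"
  have A': "A' \<in> carrier_mat n n" and B': "B' \<in> carrier_mat n n"
    using A B lt by (auto simp: A'_def B'_def)
  have "A' * B' = four_block_mat (A * B + 0\<^sub>m n (n - m) * 0\<^sub>m (n - m) n)
      (A * 0\<^sub>m m 0 + 0\<^sub>m n (n - m) * 0\<^sub>m (n - m) 0) (0\<^sub>m 0 m * B + 0\<^sub>m 0 (n - m) * 0\<^sub>m (n - m) n)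
      (0\<^sub>m 0 m * 0\<^sub>m m 0 + 0\<^sub>m 0 (n - m) * 0\<^sub>m (n - m) 0)"
    unfolding A'_def B'_def using A B by (intro mult_four_block_mat) auto
  also have "\<dots> = 1\<^sub>m n" using AB A B by (intro eq_matI) (auto simp: mat_algebra)
  finally have one: "B' * A' = 1\<^sub>m n" using mat_mult_left_right_inverse[OF A' B'] by simp
  have "row B' (n - 1) = 0\<^sub>v n"
    using A B lt by (intro eq_vecI) (auto simp: B'_def row_def)
  then have "(B' * A') $$ (n - 1, n - 1) = 0"
    using A' B' lt scalar_prod_left_zero[OF col_carrier_vec[OF _ A', of "n - 1"]] by simp
  then show False using one lt by simp
qed

lemma row_of_mult:
  assumes "A \<in> carrier_mat n m" "B \<in> carrier_mat m k" "i < n" "j < k"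
  shows "(mat 1 n (\<lambda>(_, a). if a = i then 1 else 0) * (A * B)) $$ (0, j) = (A * B :: 'a::semiring_1 mat) $$ (i, j)"
proof -
  have "(mat 1 n (\<lambda>(_, a). if a = i then 1 else 0) * (A * B)) $$ (0, j)
     = (\<Sum>a = 0..<n. (if a = i then 1 else 0) * (A * B) $$ (a, j))"
    using assms by (simp add: scalar_prod_def)
  also have "\<dots> = (\<Sum>a = 0..<n. if a = i then (A * B) $$ (a, j) else 0)"
    by (rule sum.cong) auto
  also have "\<dots> = (A * B) $$ (i, j)" using assms by simp
  finally show ?thesis .
qed

text \<open>A pair \<open>X, Y\<close> with \<open>X A Y = 1\<^sub>m d\<close> and \<open>d\<close> maximal yields the factorization
  \<open>A = (A Y) (X A)\<close>: a nonzero entry of \<open>A - A Y X A\<close> would allow one to enlarge \<open>X\<close> and \<open>Y\<close>.\<close>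

lemma full_rank_factorization:
  fixes A :: "'a::field mat"
  shows "\<exists>d. \<exists>X\<in>carrier_mat d (dim_row A). \<exists>Y\<in>carrier_mat (dim_col A) d.
    X * A * Y = 1\<^sub>m d \<and> A * Y * (X * A) = A"
proof -
  define n m where "n = dim_row A" and "m = dim_col A"
  have A: "A \<in> carrier_mat n m" by (auto simp: n_def m_def)
  define Q where "Q d \<longleftrightarrow> (\<exists>X\<in>carrier_mat d n. \<exists>Y\<in>carrier_mat m d. X * A * Y = 1\<^sub>m d)" for d
  have Q0: "Q 0" unfolding Q_def
    by (rule bexI[of _ "0\<^sub>m 0 n"], rule bexI[of _ "0\<^sub>m m 0"]) (auto intro!: eq_matI simp: A)
  have bound: "d \<le> n" if "Q d" for d
  proof -
    from that obtain X Y where X: "X \<in> carrier_mat d n" and Y: "Y \<in> carrier_mat m d"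
      and XY: "X * A * Y = 1\<^sub>m d" unfolding Q_def by blast
    have "X * (A * Y) = 1\<^sub>m d" using XY X Y A by (simp add: mat_algebra)
    then show ?thesis using X Y A by (intro one_mat_factor_le[of X d n "A * Y"]) auto
  qed
  obtain d where Qd: "Q d" and max: "\<And>e. Q e \<Longrightarrow> e \<le> d"
    using Q0 bound GreatestI_ex_nat[of Q n] Greatest_le_nat[of Q _ n] by metis
  from Qd obtain X Y where X: "X \<in> carrier_mat d n" and Y: "Y \<in> carrier_mat m d"
    and XY: "X * A * Y = 1\<^sub>m d" unfolding Q_def by blast
  note dims = X[unfolded carrier_dims] Y[unfolded carrier_dims] A[unfolded carrier_dims]
  have XY': "X * (A * Y) = 1\<^sub>m d" using XY dims by (simp add: mat_algebra)
  define D where "D = A - A * Y * (X * A)"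
  have D: "D \<in> carrier_mat n m" using dims by (auto simp: D_def)
  have D0: "D = 0\<^sub>m n m"
  proof (rule ccontr)
    assume "D \<noteq> 0\<^sub>m n m"
    then obtain a b where ab: "a < n" "b < m" "D $$ (a, b) \<noteq> 0"
      using D eq_matI[of D "0\<^sub>m n m"] by fastforce
    \<comment> \<open>The unit row at \<open>a\<close> and the unit column at \<open>b\<close>,
      scaled so that \<open>x0 * (D * y0)\<close> is 1. Their corrections \<open>x\<close> and
      \<open>y\<close> make \<open>x * A * Y\<close> and \<open>X * A * y\<close> vanish, so that
      the enlarged product becomes block diagonal.\<close>
    define x0 where "x0 = mat 1 n (\<lambda>(_ :: nat, i). if i = a then 1 else (0 :: 'a))"
    define y0 where "y0 = mat m 1 (\<lambda>(i, _ :: nat). if i = b then inverse (D $$ (a, b)) else 0)"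
    have d0: "dim_row x0 = 1" "dim_col x0 = n" "dim_row y0 = m" "dim_col y0 = 1"
      by (auto simp: x0_def y0_def)
    define x where "x = x0 * (1\<^sub>m n - A * Y * X)"
    define y where "y = (1\<^sub>m m - Y * (X * A)) * y0"
    have xA: "x * A = x0 * D"
      using dims d0 by (simp add: x_def D_def mat_algebra)
    have Ay: "A * y = D * y0"
      using dims d0 by (simp add: y_def D_def mat_algebra)
    have DY: "D * Y = 0\<^sub>m n d" and XD: "X * D = 0\<^sub>m d m"
    proof -
      have "D * Y = A * Y - A * Y * (X * (A * Y))" using dims by (simp add: D_def mat_algebra)
      also have "\<dots> = 0\<^sub>m n d" unfolding XY' using dims by (simp add: mat_algebra)
      finally show "D * Y = 0\<^sub>m n d" .
      have "X * D = X * A - X * (A * Y) * (X * A)" using dims by (simp add: D_def mat_algebra)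
      also have "\<dots> = 0\<^sub>m d m" unfolding XY' using dims by (simp add: mat_algebra)
      finally show "X * D = 0\<^sub>m d m" .
    qed
    have xAY: "x * A * Y = 0\<^sub>m 1 d" unfolding xA using dims d0 D DY by (simp add: mat_algebra)
    have XAy: "X * A * y = 0\<^sub>m d 1"
    proof -
      have "X * A * y = X * (A * y)" using dims d0 by (simp add: y_def mat_algebra)
      also have "\<dots> = X * D * y0" unfolding Ay using dims d0 D by (simp add: mat_algebra)
      finally show ?thesis using XD dims d0 by (simp add: mat_algebra)
    qed
    have xAy: "x * A * y = 1\<^sub>m 1"
    proof -
      have "x * A * y = x0 * (D * y - 0\<^sub>m n 1)" unfolding xA
        using dims d0 D by (simp add: y_def mat_algebra)
      also have "D * y = D * y0 - D * Y * (X * A) * y0"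
        using dims d0 D by (simp add: y_def mat_algebra)
      also have "\<dots> = D * y0" unfolding DY using dims d0 D by (simp add: mat_algebra)
      also have "x0 * (D * y0 - 0\<^sub>m n 1) = x0 * (D * y0)" using d0 D by (simp add: mat_algebra)
      also have "\<dots> = 1\<^sub>m 1"
      proof (rule eq_matI)
        fix i j assume "i < dim_row (1\<^sub>m 1 :: 'a mat)" "j < dim_col (1\<^sub>m 1 :: 'a mat)"
        then have ij: "i = 0" "j = 0" by auto
        have "(x0 * (D * y0)) $$ (0, 0) = (D * y0) $$ (a, 0)"
          unfolding x0_def by (rule row_of_mult[OF D, of y0 1]) (use ab d0 in auto)
        also have "\<dots> = (\<Sum>i = 0..<m. D $$ (a, i) * (if i = b then inverse (D $$ (a, b)) else 0))"
          using D d0 ab by (simp add: scalar_prod_def y0_def)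
        also have "\<dots> = (\<Sum>i = 0..<m. if i = b then D $$ (a, b) * inverse (D $$ (a, b)) else 0)"
          by (rule sum.cong) auto
        also have "\<dots> = 1" using ab by simp
        finally show "(x0 * (D * y0)) $$ (i, j) = 1\<^sub>m 1 $$ (i, j)" using ij by simp
      qed (use d0 in auto)
      finally show ?thesis .
    qed
    have dx: "dim_row x = 1" "dim_col x = n" "dim_row y = m" "dim_col y = 1"
      using d0 dims by (auto simp: x_def y_def)
    define X' where "X' = four_block_mat X (0\<^sub>m d 0) x (0\<^sub>m 1 0)"
    define Y' where "Y' = four_block_mat Y y (0\<^sub>m 0 d) (0\<^sub>m 0 1)"
    \<comment> \<open>\<open>A\<close> is rewritten with empty blocks so that the block
      multiplication rule applies to the enlarged factors.\<close>
    define A' where "A' = four_block_mat A (0\<^sub>m n 0) (0\<^sub>m 0 m) (0\<^sub>m 0 0)"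
    have A'A: "A' = A" using A by (intro eq_matI) (auto simp: A'_def)
    have "X' * A' = four_block_mat (X * A + 0\<^sub>m d 0 * 0\<^sub>m 0 m) (X * 0\<^sub>m n 0 + 0\<^sub>m d 0 * 0\<^sub>m 0 0)
       (x * A + 0\<^sub>m 1 0 * 0\<^sub>m 0 m) (x * 0\<^sub>m n 0 + 0\<^sub>m 1 0 * 0\<^sub>m 0 0)"
      unfolding X'_def A'_def by (intro mult_four_block_mat) (use dims dx in auto)
    also have "\<dots> = four_block_mat (X * A) (0\<^sub>m d 0) (x * A) (0\<^sub>m 1 0)"
      using dims dx by (simp add: mat_algebra)
    finally have "X' * A * Y' = four_block_mat (X * A) (0\<^sub>m d 0) (x * A) (0\<^sub>m 1 0) * Y'"
      by (simp add: A'A)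
    also have "\<dots> = four_block_mat (X * A * Y + 0\<^sub>m d 0 * 0\<^sub>m 0 d) (X * A * y + 0\<^sub>m d 0 * 0\<^sub>m 0 1)
       (x * A * Y + 0\<^sub>m 1 0 * 0\<^sub>m 0 d) (x * A * y + 0\<^sub>m 1 0 * 0\<^sub>m 0 1)"
      unfolding Y'_def by (intro mult_four_block_mat) (use dims dx in auto)
    also have "\<dots> = 1\<^sub>m (Suc d)" unfolding XY xAY XAy xAy by (simp add: mat_algebra)
    finally have "Q (Suc d)" unfolding Q_def
      by (intro bexI[of _ X'] bexI[of _ Y']) (use dims dx in \<open>auto simp: X'_def Y'_def\<close>)
    from max[OF this] show False by simp
  qed
  have "A * Y * (X * A) = A"
  proof (rule eq_matI)
    fix i j assume ij: "i < dim_row A" "j < dim_col A"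
    have "D $$ (i, j) = 0" using D0 ij dims by simp
    then show "(A * Y * (X * A)) $$ (i, j) = A $$ (i, j)" using ij dims by (simp add: D_def)
  qed (use dims in auto)
  then show ?thesis using X Y XY by (auto simp: n_def m_def)
qed

text \<open>By the rank factorization \<open>A = A * (Y * X * A)\<close>, applying
  \<open>Y * X * A\<close> changes a vector only by an element of the kernel; so
  \<open>Y * X\<close> is a left inverse.\<close>

lemma left_inverse_of_injective:
  fixes A :: "'a::field mat"
  assumes "{v \<in> carrier_vec (dim_col A). A *\<^sub>v v = 0\<^sub>v (dim_row A)} = {0\<^sub>v (dim_col A)}"
  shows "\<exists>B\<in>carrier_mat (dim_col A) (dim_row A). B * A = 1\<^sub>m (dim_col A)"
proof -
  obtain d X Y where X: "X \<in> carrier_mat d (dim_row A)" and Y: "Y \<in> carrier_mat (dim_col A) d"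
    and "A * Y * (X * A) = A"
    using full_rank_factorization[of A] by blast
  note dims = X[unfolded carrier_dims] Y[unfolded carrier_dims]
  have AYXA: "A * (Y * X * A) = A" using \<open>A * Y * (X * A) = A\<close> dims by (simp add: mat_algebra)
  have "Y * X * A = 1\<^sub>m (dim_col A)"
  proof (rule eq_mat_by_vec)
    fix v :: "'a vec" assume "v \<in> carrier_vec (dim_col (Y * X * A))"
    then have v: "v \<in> carrier_vec (dim_col A)" by simp
    define w where "w = (Y * X * A) *\<^sub>v v"
    have w: "w \<in> carrier_vec (dim_col A)" by (rule carrier_vecI) (use dims in \<open>simp add: w_def\<close>)
    have "A *\<^sub>v w = (A * (Y * X * A)) *\<^sub>v v"
      unfolding w_def by (rule assoc_mult_mat_vec[symmetric, of _ "dim_row A" "dim_col A" _ "dim_col A"])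
        (use dims v in auto)
    then have "A *\<^sub>v (w - v) = 0\<^sub>v (dim_row A)"
      using mult_minus_distrib_mat_vec[of A "dim_row A" "dim_col A" w v] w v
        minus_cancel_vec[of "A *\<^sub>v v" "dim_row A"] mult_mat_vec_carrier[of A "dim_row A" "dim_col A" v]
      by (simp add: AYXA)
    then have "w - v \<in> {0\<^sub>v (dim_col A)}" using w v by (subst assms[symmetric]) simp
    then have "w - v = 0\<^sub>v (dim_col A)" by simp
    then have "\<And>i. i < dim_col A \<Longrightarrow> w $ i - v $ i = 0"
      using w v by (metis carrier_vecD index_minus_vec(1) index_zero_vec(1))
    then have "w = v" using w v by (intro eq_vecI) auto
    then show "(Y * X * A) *\<^sub>v v = 1\<^sub>m (dim_col A) *\<^sub>v v" using v by (simp add: w_def)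
  qed (use dims in auto)
  then show ?thesis using dims by (intro bexI[of _ "Y * X"]) auto
qed

text \<open>For the rank factorization \<open>E = (E * Y) * (X * E)\<close>, idempotence turns the
  product in the other order, \<open>X * E * E * Y\<close>, into \<open>X * E * Y\<close>, which is
  1.\<close>

lemma idempotent_factorization:
  fixes E :: "'a::field mat"
  assumes E: "E \<in> carrier_mat n n" and idem: "E * E = E"
  shows "\<exists>r. \<exists>B\<in>carrier_mat n r. \<exists>C\<in>carrier_mat r n. B * C = E \<and> C * B = 1\<^sub>m r"
proof -
  obtain r X Y where X: "X \<in> carrier_mat r n" and Y: "Y \<in> carrier_mat n r"
    and 1: "X * E * Y = 1\<^sub>m r" and 2: "E * Y * (X * E) = E"
    using full_rank_factorization[of E] E by auto
  note dims = X[unfolded carrier_dims] Y[unfolded carrier_dims] E[unfolded carrier_dims]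
  have "X * E * (E * Y) = X * (E * E) * Y" using dims by (simp add: mat_algebra)
  also have "\<dots> = 1\<^sub>m r" unfolding idem by (rule 1)
  finally have "X * E * (E * Y) = 1\<^sub>m r" .
  then show ?thesis using 2 dims
    by (intro exI[of _ r] bexI[of _ "E * Y"] bexI[of _ "X * E"]) auto
qed

subsection \<open>The rank as an isomorphism-invariant, additive quantity\<close>

text \<open>The first equation bounds the rank from below and the second from above. In this form
  the rank is transported along isomorphisms and added up over direct sums by matrix algebra, with
  no reference to subspaces.\<close>

definition has_rank :: "'a::field mat \<Rightarrow> nat \<Rightarrow> bool" where
  "has_rank A d \<longleftrightarrow> (\<exists>X\<in>carrier_mat d (dim_row A). \<exists>Y\<in>carrier_mat (dim_col A) d.
     \<exists>B\<in>carrier_mat (dim_row A) d. \<exists>C\<in>carrier_mat d (dim_col A).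
     X * A * Y = 1\<^sub>m d \<and> B * C = A)"

lemma has_rankI:
  assumes "dim_row X = d" "dim_col X = dim_row A" "dim_row Y = dim_col A" "dim_col Y = d"
    "dim_row B = dim_row A" "dim_col B = d" "dim_row C = d" "dim_col C = dim_col A"
    "X * A * Y = 1\<^sub>m d" "B * C = A"
  shows "has_rank A d"
  unfolding has_rank_def
  by (rule bexI[of _ X], rule bexI[of _ Y], rule bexI[of _ B], rule bexI[of _ C], intro conjI)
    (use assms in \<open>auto intro: carrier_matI\<close>)

lemma has_rankE:
  assumes "has_rank A d"
  obtains X Y B C where "dim_row X = d" "dim_col X = dim_row A" "dim_row Y = dim_col A" "dim_col Y = d"
    "dim_row B = dim_row A" "dim_col B = d" "dim_row C = d" "dim_col C = dim_col A"
    "X * A * Y = 1\<^sub>m d" "B * C = A"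
proof -
  from assms obtain X Y B C where "X \<in> carrier_mat d (dim_row A)" "Y \<in> carrier_mat (dim_col A) d"
    "B \<in> carrier_mat (dim_row A) d" "C \<in> carrier_mat d (dim_col A)"
    and 1: "X * A * Y = 1\<^sub>m d" "B * C = A"
    unfolding has_rank_def by blast
  then show thesis by (intro that[of X Y B C, OF _ _ _ _ _ _ _ _ 1]) auto
qed

lemma has_rank_exists: "\<exists>d. has_rank A d"
proof -
  obtain d X Y where 1: "X \<in> carrier_mat d (dim_row A)" "Y \<in> carrier_mat (dim_col A) d"
    "X * A * Y = 1\<^sub>m d" "A * Y * (X * A) = A"
    using full_rank_factorization[of A] by blast
  have "has_rank A d"
    by (rule has_rankI[where X = X and Y = Y and B = "A * Y" and C = "X * A"])
      (use 1(1,2) in \<open>simp_all add: 1(3,4)\<close>)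
  then show ?thesis ..
qed

lemma has_rank_unique:
  assumes "has_rank A d" "has_rank A e" shows "d = e"
proof -
  have le: "d \<le> e" if d: "has_rank A d" and e: "has_rank A e" for d e
  proof -
    from d obtain X Y where 1: "dim_row X = d" "dim_col X = dim_row A" "dim_row Y = dim_col A" "dim_col Y = d"
      "X * A * Y = 1\<^sub>m d" by (elim has_rankE)
    from e obtain B C where 2: "dim_row B = dim_row A" "dim_col B = e" "dim_row C = e" "dim_col C = dim_col A"
      "B * C = A" by (elim has_rankE)
    have "X * B * (C * Y) = X * (B * C) * Y" using 1(1-4) 2(1-4) by (simp add: mat_algebra)
    also have "\<dots> = 1\<^sub>m d" by (simp only: 1 2)
    finally show ?thesis
      by (intro one_mat_factor_le[of "X * B" d e "C * Y"] carrier_matI) (simp_all add: 1(1-4) 2(1-4))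
  qed
  show ?thesis using le[OF assms] le[OF assms(2,1)] by simp
qed

definition rk :: "'a::field mat \<Rightarrow> nat" where
  "rk A = (THE d. has_rank A d)"

lemma has_rank_rk: "has_rank A (rk A)"
  unfolding rk_def using has_rank_exists[of A] has_rank_unique[of A] by (metis theI)

lemma rk_eqI: "has_rank A d \<Longrightarrow> rk A = d"
  using has_rank_unique has_rank_rk by blast

lemma rk_mult_iso:
  assumes "G' * G = 1\<^sub>m (dim_row A)" "F * F' = 1\<^sub>m (dim_col A)"
    and dims: "dim_col G = dim_row A" "dim_row F = dim_col A" "dim_col G' = dim_row G" "dim_col F = dim_row F'"
  shows "rk (G * A * F) = rk A"
proof (rule rk_eqI)
  obtain X Y B C where 1: "dim_row X = rk A" "dim_col X = dim_row A" "dim_row Y = dim_col A" "dim_col Y = rk A"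
    "dim_row B = dim_row A" "dim_col B = rk A" "dim_row C = rk A" "dim_col C = dim_col A"
    and 2: "X * A * Y = 1\<^sub>m (rk A)" "B * C = A"
    using has_rank_rk[of A] by (elim has_rankE)
  have dims': "dim_row G' = dim_row A" "dim_col F' = dim_col A"
    using arg_cong[OF assms(1), of dim_row] arg_cong[OF assms(2), of dim_col] by auto
  have "X * G' * (G * A * F) * (F' * Y) = X * ((G' * G) * A * (F * F')) * Y"
    using 1 dims dims' by (simp add: mat_algebra)
  also have "\<dots> = X * A * Y" unfolding assms(1,2) using 1 by (simp add: mat_algebra)
  finally have 3: "X * G' * (G * A * F) * (F' * Y) = 1\<^sub>m (rk A)" by (simp only: 2)
  have "G * B * (C * F) = G * (B * C) * F" using 1 dims by (simp add: mat_algebra)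
  then have 4: "G * B * (C * F) = G * A * F" by (simp only: 2)
  show "has_rank (G * A * F) (rk A)"
    by (rule has_rankI[OF _ _ _ _ _ _ _ _ 3 4]) (simp_all add: 1 dims dims')
qed

subsection \<open>Block diagonal matrices\<close>

definition diag :: "'a::zero mat \<Rightarrow> 'a mat \<Rightarrow> 'a mat" where
  "diag A B = four_block_mat A (0\<^sub>m (dim_row A) (dim_col B)) (0\<^sub>m (dim_row B) (dim_col A)) B"

lemma dim_diag [simp]:
  "dim_row (diag A B) = dim_row A + dim_row B" "dim_col (diag A B) = dim_col A + dim_col B"
  by (simp_all add: diag_def)

lemma diag_mult:
  assumes "dim_col A = dim_row C" "dim_col B = dim_row D"
  shows "diag A B * diag C D = diag (A * C) (B * (D :: 'a::semiring_0 mat))"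
proof -
  have "diag A B * diag C D = four_block_mat (A * C + 0\<^sub>m (dim_row A) (dim_col B) * 0\<^sub>m (dim_row D) (dim_col C))
     (A * 0\<^sub>m (dim_row C) (dim_col D) + 0\<^sub>m (dim_row A) (dim_col B) * D)
     (0\<^sub>m (dim_row B) (dim_col A) * C + B * 0\<^sub>m (dim_row D) (dim_col C))
     (0\<^sub>m (dim_row B) (dim_col A) * 0\<^sub>m (dim_row C) (dim_col D) + B * D)"
    unfolding diag_def by (intro mult_four_block_mat) (use assms in auto)
  also have "\<dots> = diag (A * C) (B * D)" using assms by (simp add: diag_def mat_algebra)
  finally show ?thesis .
qed

lemma diag_add:
  assumes "dim_row A = dim_row C" "dim_row B = dim_row D" "dim_col A = dim_col C" "dim_col B = dim_col D"
  shows "diag A B + diag C D = diag (A + C) (B + (D :: 'a::monoid_add mat))"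
  using assms by (intro eq_matI) (auto simp: diag_def)

lemma diag_one: "diag (1\<^sub>m n) (1\<^sub>m m) = 1\<^sub>m (n + m)"
  by (simp add: diag_def)

lemma diag_zero: "diag (0\<^sub>m n m) (0\<^sub>m n' m') = 0\<^sub>m (n + n') (m + m')"
  by (simp add: diag_def)

lemma rk_diag: "rk (diag A B) = rk A + rk B"
proof (rule rk_eqI)
  obtain X Y Z W where 1: "dim_row X = rk A" "dim_col X = dim_row A" "dim_row Y = dim_col A" "dim_col Y = rk A"
    "dim_row Z = dim_row A" "dim_col Z = rk A" "dim_row W = rk A" "dim_col W = dim_col A"
    and 2: "X * A * Y = 1\<^sub>m (rk A)" "Z * W = A"
    using has_rank_rk[of A] by (elim has_rankE)
  obtain X' Y' Z' W' where 3: "dim_row X' = rk B" "dim_col X' = dim_row B" "dim_row Y' = dim_col B" "dim_col Y' = rk B"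
    "dim_row Z' = dim_row B" "dim_col Z' = rk B" "dim_row W' = rk B" "dim_col W' = dim_col B"
    and 4: "X' * B * Y' = 1\<^sub>m (rk B)" "Z' * W' = B"
    using has_rank_rk[of B] by (elim has_rankE)
  have "diag X X' * diag A B * diag Y Y' = diag (X * A * Y) (X' * B * Y')"
    by (simp add: diag_mult 1 3)
  then have 5: "diag X X' * diag A B * diag Y Y' = 1\<^sub>m (rk A + rk B)" by (simp add: 2 4 diag_one)
  have 6: "diag Z Z' * diag W W' = diag A B" by (simp add: diag_mult 1 2 3 4)
  show "has_rank (diag A B) (rk A + rk B)"
    by (rule has_rankI[OF _ _ _ _ _ _ _ _ 5 6]) (simp_all add: 1 3)
qed

section \<open>Injections and projections of a direct sum of two spaces\<close>

definition inl :: "nat \<Rightarrow> nat \<Rightarrow> 'a::{zero,one} mat" where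
  "inl n m = mat (n + m) n (\<lambda>(i, j). if i = j then 1 else 0)"

definition inr :: "nat \<Rightarrow> nat \<Rightarrow> 'a::{zero,one} mat" where
  "inr n m = mat (n + m) m (\<lambda>(i, j). if i = n + j then 1 else 0)"

definition prl :: "nat \<Rightarrow> nat \<Rightarrow> 'a::{zero,one} mat" where
  "prl n m = mat n (n + m) (\<lambda>(i, j). if i = j then 1 else 0)"

definition prr :: "nat \<Rightarrow> nat \<Rightarrow> 'a::{zero,one} mat" where
  "prr n m = mat m (n + m) (\<lambda>(i, j). if j = n + i then 1 else 0)"

lemma dim_inl_inr_prl_prr [simp]:
  "dim_row (inl n m) = n + m" "dim_col (inl n m) = n" "dim_row (inr n m) = n + m" "dim_col (inr n m) = m"
  "dim_row (prl n m) = n" "dim_col (prl n m) = n + m" "dim_row (prr n m) = m" "dim_col (prr n m) = n + m"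
  by (simp_all add: inl_def inr_def prl_def prr_def)

lemma sum_if_mult_left:
  fixes n :: nat
  shows
  "(\<Sum>k = 0..<n. (if k = a then 1 else 0) * g k) = (if a < n then g a else (0::'a::semiring_1))"
proof -
  have "(\<Sum>k = 0..<n. (if k = a then 1 else 0) * g k) = (\<Sum>k = 0..<n. if k = a then g k else 0)"
    by (rule sum.cong) auto
  then show ?thesis by (simp)
qed

lemma sum_if_mult_right:
  fixes n :: nat
  shows
  "(\<Sum>k = 0..<n. g k * (if k = a then 1 else 0)) = (if a < n then g a else (0::'a::semiring_1))"
proof -
  have "(\<Sum>k = 0..<n. g k * (if k = a then 1 else 0)) = (\<Sum>k = 0..<n. if k = a then g k else 0)"
    by (rule sum.cong) auto
  then show ?thesis by (simp)
qed

lemma prl_mult: "dim_row A = n + m \<Longrightarrow> prl n m * A = mat n (dim_col A) (\<lambda>(i, j). (A :: 'a::semiring_1 mat) $$ (i, j))"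
proof (rule eq_matI, goal_cases)
  case (1 i j)
  then have "(prl n m * A) $$ (i, j) = (\<Sum>k = 0..<n + m. (if k = i then 1 else 0) * A $$ (k, j))"
    by (auto simp: prl_def scalar_prod_def intro!: sum.cong)
  then show ?case using 1 by (simp only: sum_if_mult_left) simp
qed auto

lemma prr_mult: "dim_row A = n + m \<Longrightarrow> prr n m * A = mat m (dim_col A) (\<lambda>(i, j). (A :: 'a::semiring_1 mat) $$ (n + i, j))"
proof (rule eq_matI, goal_cases)
  case (1 i j)
  then have "(prr n m * A) $$ (i, j) = (\<Sum>k = 0..<n + m. (if k = n + i then 1 else 0) * A $$ (k, j))"
    by (auto simp: prr_def scalar_prod_def intro!: sum.cong)
  then show ?case using 1 by (simp only: sum_if_mult_left) simp
qed auto

lemma mult_inl: "dim_col A = n + m \<Longrightarrow> A * inl n m = mat (dim_row A) n (\<lambda>(i, j). (A :: 'a::semiring_1 mat) $$ (i, j))"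
proof (rule eq_matI, goal_cases)
  case (1 i j)
  then have "(A * inl n m) $$ (i, j) = (\<Sum>k = 0..<n + m. A $$ (i, k) * (if k = j then 1 else 0))"
    by (auto simp: inl_def scalar_prod_def intro!: sum.cong)
  then show ?case using 1 by (simp only: sum_if_mult_right) simp
qed auto

lemma mult_inr: "dim_col A = n + m \<Longrightarrow> A * inr n m = mat (dim_row A) m (\<lambda>(i, j). (A :: 'a::semiring_1 mat) $$ (i, n + j))"
proof (rule eq_matI, goal_cases)
  case (1 i j)
  then have "(A * inr n m) $$ (i, j) = (\<Sum>k = 0..<n + m. A $$ (i, k) * (if k = n + j then 1 else 0))"
    by (auto simp: inr_def scalar_prod_def intro!: sum.cong)
  then show ?case using 1 by (simp only: sum_if_mult_right) simp
qed auto

lemma biproduct: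
  "prl n m * inl n m = (1\<^sub>m n :: 'a::semiring_1 mat)" "prr n m * inr n m = (1\<^sub>m m :: 'a mat)"
  "prl n m * inr n m = (0\<^sub>m n m :: 'a mat)" "prr n m * inl n m = (0\<^sub>m m n :: 'a mat)"
  by (rule eq_matI; simp add: prl_mult prr_mult; auto simp: inl_def inr_def)+

lemma inl_prl_add_inr_prr:
  "inl n m * prl n m + inr n m * prr n m = (1\<^sub>m (n + m) :: 'a::semiring_1 mat)"
proof -
  have 1: "(inl n m * prl n m :: 'a mat) = diag (1\<^sub>m n) (0\<^sub>m m m)"
  proof (rule eq_matI, goal_cases)
    case (1 i j)
    have "(inl n m * prl n m :: 'a mat) $$ (i, j)
        = (\<Sum>k = 0..<n. (if k = i then 1 else 0) * (if k = j then 1 else 0))"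
      using 1 by (auto simp: inl_def prl_def scalar_prod_def intro!: sum.cong)
    then show ?case using 1 by (simp only: sum_if_mult_left) (auto simp: diag_def)
  qed auto
  have 2: "(inr n m * prr n m :: 'a mat) = diag (0\<^sub>m n n) (1\<^sub>m m)"
  proof (rule eq_matI, goal_cases)
    case (1 i j)
    have "(inr n m * prr n m :: 'a mat) $$ (i, j)
        = (\<Sum>k = 0..<m. (if i = n + k then 1 else 0) * (if j = n + k then 1 else 0))"
      using 1 by (auto simp: inr_def prr_def scalar_prod_def intro!: sum.cong)
    also have "\<dots> = (\<Sum>k = 0..<m. if k = i - n then (if i \<ge> n \<and> j = i then 1 else 0) else 0)"
      by (rule sum.cong) auto
    also have "\<dots> = diag (0\<^sub>m n n) (1\<^sub>m m) $$ (i, j)" using 1 by (auto simp: diag_def)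
    finally show ?case .
  qed auto
  show ?thesis unfolding 1 2 by (simp add: diag_add diag_one zero_add_dim add_zero_dim)
qed

lemma diag_inl: "dim_col A = n \<Longrightarrow> dim_col B = m \<Longrightarrow>
    diag A B * inl n m = inl (dim_row A) (dim_row B) * (A :: 'a::semiring_1 mat)"
proof (rule eq_matI, goal_cases)
  case (1 i j)
  have "(inl (dim_row A) (dim_row B) * A) $$ (i, j) =
      (\<Sum>k = 0..<dim_row A. (if k = i then 1 else 0) * A $$ (k, j))"
    using 1 by (auto simp: inl_def scalar_prod_def intro!: sum.cong)
  also have "\<dots> = (diag A B * inl n m) $$ (i, j)"
    using 1 by (simp only: sum_if_mult_left) (simp add: mult_inl, auto simp: diag_def)
  finally show ?case by simp
qed auto

lemma diag_inr: "dim_col A = n \<Longrightarrow> dim_col B = m \<Longrightarrow>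
    diag A B * inr n m = inr (dim_row A) (dim_row B) * (B :: 'a::semiring_1 mat)"
proof (rule eq_matI, goal_cases)
  case (1 i j)
  have "(inr (dim_row A) (dim_row B) * B) $$ (i, j) =
      (\<Sum>k = 0..<dim_row B. (if i = dim_row A + k then 1 else 0) * B $$ (k, j))"
    using 1 by (auto simp: inr_def scalar_prod_def intro!: sum.cong)
  also have "\<dots> = (\<Sum>k = 0..<dim_row B. if k = i - dim_row A then (if i \<ge> dim_row A then B $$ (k, j) else 0) else 0)"
    by (rule sum.cong) auto
  also have "\<dots> = (diag A B * inr n m) $$ (i, j)"
    using 1 by (simp add: mult_inr, auto simp: diag_def)
  finally show ?case by simp
qed auto

lemma prl_diag: "dim_row A = n \<Longrightarrow> dim_row B = m \<Longrightarrow>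
    prl n m * diag A B = (A :: 'a::semiring_1 mat) * prl (dim_col A) (dim_col B)"
proof (rule eq_matI, goal_cases)
  case (1 i j)
  have "(A * prl (dim_col A) (dim_col B)) $$ (i, j) =
      (\<Sum>k = 0..<dim_col A. A $$ (i, k) * (if k = j then 1 else 0))"
    using 1 by (auto simp: prl_def scalar_prod_def intro!: sum.cong)
  also have "\<dots> = (prl n m * diag A B) $$ (i, j)"
    using 1 by (simp only: sum_if_mult_right) (simp add: prl_mult, auto simp: diag_def)
  finally show ?case by simp
qed auto

lemma prr_diag: "dim_row A = n \<Longrightarrow> dim_row B = m \<Longrightarrow>
    prr n m * diag A B = (B :: 'a::semiring_1 mat) * prr (dim_col A) (dim_col B)"
proof (rule eq_matI, goal_cases)
  case (1 i j)
  have "(B * prr (dim_col A) (dim_col B)) $$ (i, j) =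
      (\<Sum>k = 0..<dim_col B. B $$ (i, k) * (if j = dim_col A + k then 1 else 0))"
    using 1 by (auto simp: prr_def scalar_prod_def intro!: sum.cong)
  also have "\<dots> = (\<Sum>k = 0..<dim_col B. if k = j - dim_col A then (if j \<ge> dim_col A then B $$ (i, k) else 0) else 0)"
    by (rule sum.cong) auto
  also have "\<dots> = (prr n m * diag A B) $$ (i, j)"
    using 1 by (simp add: prr_mult, auto simp: diag_def)
  finally show ?case by simp
qed auto

subsection \<open>Matrices of partial maps between bases\<close>

text \<open>\<open>rel_mat h ys xs\<close> maps the basis vector of \<open>x\<close> to that of \<open>h x\<close>, or to \<open>0\<close> if \<open>h x\<close> is not in \<open>ys\<close>.\<close>

definition rel_mat :: "('b \<Rightarrow> 'b) \<Rightarrow> 'b list \<Rightarrow> 'b list \<Rightarrow> 'a::{zero,one} mat" where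
  "rel_mat h ys xs = mat (length ys) (length xs) (\<lambda>(r, c). if ys ! r = h (xs ! c) then 1 else 0)"

lemma dim_rel_mat [simp]:
  "dim_row (rel_mat h ys xs) = length ys" "dim_col (rel_mat h ys xs) = length xs"
  by (simp_all add: rel_mat_def)

text \<open>Distinctness of \<open>ys\<close> leaves at most one nonzero term in each entry. The
  disjunction is the price of truncation: a basis vector dropped by the first factor must be dropped
  by the composite, too.\<close>

lemma rel_mat_mult:
  assumes "distinct ys" and "\<And>x. x \<in> set xs \<Longrightarrow> h x \<in> set ys \<or> g (h x) \<notin> set zs"
    and "\<And>x. x \<in> set xs \<Longrightarrow> k x = g (h x)"
  shows "rel_mat g zs ys * rel_mat h ys xs = (rel_mat k zs xs :: 'a::semiring_1 mat)"
proof (rule eq_matI)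
  fix r c assume "r < dim_row (rel_mat k zs xs :: 'a mat)" "c < dim_col (rel_mat k zs xs :: 'a mat)"
  then have r: "r < length zs" and c: "c < length xs" by auto
  then have x: "xs ! c \<in> set xs" and z: "zs ! r \<in> set zs" by auto
  have "(rel_mat g zs ys * rel_mat h ys xs :: 'a mat) $$ (r, c) =
     (\<Sum>i = 0..<length ys. (if zs ! r = g (ys ! i) then 1 else 0) * (if ys ! i = h (xs ! c) then 1 else 0))"
    using r c by (auto simp: rel_mat_def scalar_prod_def intro!: sum.cong)
  also have "\<dots> = (if zs ! r = g (h (xs ! c)) then 1 else 0)"
  proof (cases "h (xs ! c) \<in> set ys")
    case True
    then obtain i0 where i0: "i0 < length ys" "ys ! i0 = h (xs ! c)" by (auto simp: in_set_conv_nth)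
    have "(\<Sum>i = 0..<length ys. (if zs ! r = g (ys ! i) then 1 else 0) * (if ys ! i = h (xs ! c) then 1 else (0::'a)))
       = (\<Sum>i = 0..<length ys. (if zs ! r = g (ys ! i) then 1 else 0) * (if i = i0 then 1 else 0))"
    proof (rule sum.cong)
      fix i assume "i \<in> {0..<length ys}"
      then have "ys ! i = h (xs ! c) \<longleftrightarrow> i = i0"
        using nth_eq_iff_index_eq[OF assms(1) _ i0(1), of i] unfolding i0(2) by simp
      then show "(if zs ! r = g (ys ! i) then 1 else 0) * (if ys ! i = h (xs ! c) then 1 else (0::'a))
        = (if zs ! r = g (ys ! i) then 1 else 0) * (if i = i0 then 1 else 0)" by simp
    qed simp
    then show ?thesis using i0 by (simp only: sum_if_mult_right) simp
  next
    case False
    then have "zs ! r \<noteq> g (h (xs ! c))" using assms(2)[OF x] z by auto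
    moreover have "ys ! i \<noteq> h (xs ! c)" if "i < length ys" for i using False that nth_mem by metis
    ultimately show ?thesis by (auto intro!: sum.neutral)
  qed
  also have "\<dots> = rel_mat k zs xs $$ (r, c)" using r c assms(3)[OF x] by (simp add: rel_mat_def)
  finally show "(rel_mat g zs ys * rel_mat h ys xs :: 'a mat) $$ (r, c) = rel_mat k zs xs $$ (r, c)" .
qed auto

lemma rel_mat_id: "distinct xs \<Longrightarrow> (\<And>x. x \<in> set xs \<Longrightarrow> h x = x) \<Longrightarrow> rel_mat h xs xs = 1\<^sub>m (length xs)"
  by (rule eq_matI) (auto simp: rel_mat_def nth_eq_iff_index_eq)

lemma rel_mat_zero: "(\<And>x. x \<in> set xs \<Longrightarrow> h x \<notin> set ys) \<Longrightarrow> rel_mat h ys xs = 0\<^sub>m (length ys) (length xs)"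
  unfolding rel_mat_def by (rule eq_matI) (auto, metis nth_mem)

text \<open>The matrix factors through the sublist \<open>zs\<close> of surviving basis vectors; on
  \<open>zs\<close> the partial map is inverted by \<open>k\<close>, so the identity of size
  \<open>length zs\<close> factors through the matrix.\<close>

lemma rk_rel_mat:
  assumes "distinct xs" "distinct ys" "inj_on h (set xs)"
  shows "rk (rel_mat h ys xs :: 'a::field mat) = card {x \<in> set xs. h x \<in> set ys}"
proof (rule rk_eqI)
  define zs where "zs = filter (\<lambda>x. h x \<in> set ys) xs"
  define k where "k = inv_into (set xs) h"
  have k: "x \<in> set xs \<Longrightarrow> k (h x) = x" for x using assms(3) by (simp add: k_def)
  have z: "distinct zs" "set zs = {x \<in> set xs. h x \<in> set ys}" using assms by (auto simp: zs_def)
  then have len: "length zs = card {x \<in> set xs. h x \<in> set ys}" using distinct_card by metis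
  have 1: "rel_mat h ys zs * rel_mat id zs xs = (rel_mat h ys xs :: 'a mat)"
    by (rule rel_mat_mult) (use z in auto)
  have 2: "rel_mat h ys xs * rel_mat id xs zs = (rel_mat h ys zs :: 'a mat)"
    by (rule rel_mat_mult) (use z assms in auto)
  have 3: "rel_mat k zs ys * rel_mat h ys zs = (rel_mat (\<lambda>x. k (h x)) zs zs :: 'a mat)"
    by (rule rel_mat_mult) (use z assms in auto)
  have 4: "rel_mat (\<lambda>x. k (h x)) zs zs = (1\<^sub>m (length zs) :: 'a mat)"
    by (rule rel_mat_id) (use z k in auto)
  have "rel_mat k zs ys * rel_mat h ys xs * rel_mat id xs zs = (1\<^sub>m (length zs) :: 'a mat)"
    using 2 3 4 by (simp add: mat_algebra)
  then have 5: "rel_mat k zs ys * rel_mat h ys xs * rel_mat id xs zs = (1\<^sub>m (card {x \<in> set xs. h x \<in> set ys}) :: 'a mat)"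
    by (simp only: len)
  show "has_rank (rel_mat h ys xs :: 'a mat) (card {x \<in> set xs. h x \<in> set ys})"
    by (rule has_rankI[OF _ _ _ _ _ _ _ _ 5 1]) (simp_all add: len)
qed

section \<open>The combinatorics of syzygies\<close>

lemma nxt_in: "i \<in> {1..N} \<Longrightarrow> nxt N i \<in> {1..N}"
  by (auto simp: nxt_def)

lemma funpow_nxt_in: "i \<in> {1..N} \<Longrightarrow> (nxt N ^^ p) i \<in> {1..N}"
  by (induction p) (use nxt_in in auto)

lemma nxt_inj: "i \<in> {1..N} \<Longrightarrow> j \<in> {1..N} \<Longrightarrow> nxt N i = nxt N j \<Longrightarrow> i = j"
  by (cases "i = N"; cases "j = N") (auto simp: nxt_def)

text \<open>The covering map from the integers to the vertices of the cycle; subtracting and adding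
  1 moves the residues from \<open>0, ..., N - 1\<close> to \<open>1, ..., N\<close>.\<close>

definition vert :: "nat \<Rightarrow> int \<Rightarrow> nat" where
  "vert N i = nat ((i - 1) mod int N) + 1"

lemma vert_in: "1 \<le> N \<Longrightarrow> vert N i \<in> {1..N}"
  by (auto simp: vert_def nat_le_iff Suc_le_eq nat_less_iff)

lemma vert_self: "s \<in> {1..N} \<Longrightarrow> vert N (int s) = s"
proof -
  assume s: "s \<in> {1..N}"
  then have "(int s - 1) mod int N = int s - 1" by (intro mod_pos_pos_trivial) auto
  moreover have "nat (int s - 1) + 1 = s" using s by auto
  ultimately show ?thesis by (simp add: vert_def)
qed

lemma vert_add_mult: "vert N (i + int N * k) = vert N i"
proof -
  have "(i + int N * k - 1) mod int N = (i - 1 + int N * k) mod int N" by (simp add: algebra_simps)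
  then show ?thesis by (simp add: vert_def)
qed

lemma vert_eqD: "1 \<le> N \<Longrightarrow> vert N i = vert N j \<Longrightarrow> \<exists>k. j = i + int N * k"
proof -
  assume N: "1 \<le> N" and v: "vert N i = vert N j"
  have "(i - 1) mod int N = (j - 1) mod int N"
    using v N by (simp add: vert_def eq_nat_nat_iff)
  then have "int N dvd (j - 1) - (i - 1)" by (metis mod_eq_dvd_iff)
  then obtain k where "(j - 1) - (i - 1) = int N * k" by (elim dvdE)
  then have "j = i + int N * k" by simp
  then show ?thesis ..
qed

lemma nxt_vert: "1 \<le> N \<Longrightarrow> nxt N (vert N i) = vert N (i + 1)"
proof -
  assume N: "1 \<le> N"
  have "vert N i = vert N (int (vert N i))" using vert_self[OF vert_in[OF N]] by simp
  then obtain k where k: "i = int (vert N i) + int N * k" using vert_eqD[OF N] by metis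
  define s where "s = vert N i"
  have s: "s \<in> {1..N}" unfolding s_def by (rule vert_in[OF N])
  have "vert N (i + 1) = vert N (int s + 1)"
    using vert_add_mult[of N "int s + 1" k] k unfolding s_def by (simp add: algebra_simps)
  also have "\<dots> = nxt N s"
  proof (cases "s = N")
    case True
    then have "int s + 1 = int 1 + int N * 1" by simp
    then have "vert N (int s + 1) = vert N (int 1)" using vert_add_mult by metis
    then show ?thesis using True N vert_self[of 1 N] by (simp add: nxt_def)
  next
    case False
    then have "vert N (int (s + 1)) = s + 1" using s by (intro vert_self) auto
    then show ?thesis using False by (simp add: nxt_def add.commute)
  qed
  finally show ?thesis by (simp add: s_def)
qed

lemma funpow_nxt_vert: "1 \<le> N \<Longrightarrow> (nxt N ^^ p) (vert N i) = vert N (i + int p)"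
  by (induction p) (auto simp: nxt_vert algebra_simps)

text \<open>\<open>c\<close> is a Kupisch series: \<open>c s\<close> is the length of the
  indecomposable projective with top \<open>s\<close>. The inequality holds because the radical of
  this projective, of length \<open>c s - 1\<close>, is a quotient of the projective with top
  \<open>nxt N s\<close>.\<close>

locale kupisch =
  fixes N :: nat and c :: "nat \<Rightarrow> nat"
  assumes N: "1 \<le> N"
    and c_pos: "s \<in> {1..N} \<Longrightarrow> 1 \<le> c s"
    and c_step: "s \<in> {1..N} \<Longrightarrow> c s \<le> Suc (c (nxt N s))"
begin

text \<open>Length 0 encodes the zero module. It needs its own case because the general formula
  would return \<open>(s, c s)\<close>, a projective.\<close>

fun omega :: "nat \<times> nat \<Rightarrow> nat \<times> nat" where
  "omega (s, l) = (if l = 0 then (s, 0) else ((nxt N ^^ l) s, c s - l))"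

definition Bas :: "(nat \<times> nat) set" where
  "Bas = {(s, l). s \<in> {1..N} \<and> 1 \<le> l \<and> l < c s}"

text \<open>Intersecting with \<open>Bas\<close> discards the syzygies that are zero or projective,
  that is, those whose class vanishes.\<close>

primrec stage :: "(nat \<times> nat) set \<Rightarrow> nat \<Rightarrow> (nat \<times> nat) set" where
  "stage S 0 = S"
| "stage S (Suc n) = omega ` stage S n \<inter> Bas"

lemma finite_Bas: "finite Bas"
proof (rule finite_subset)
  show "Bas \<subseteq> (SIGMA s : {1..N}. {..<c s})" by (auto simp: Bas_def)
qed auto

lemma stage_subset: "S \<subseteq> Bas \<Longrightarrow> stage S n \<subseteq> Bas"
  by (cases n) auto

lemma stage_mono: "S \<subseteq> T \<Longrightarrow> stage S n \<subseteq> stage T n"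
  by (induction n) auto

lemma stage_Bas_antimono: "stage Bas (Suc n) \<subseteq> stage Bas n"
  by (induction n) auto

lemma stage_stage: "stage S (n + m) = stage (stage S n) m"
  by (induction m) auto

text \<open>Each stage is a function of the previous one, so the chain is constant from its first
  repetition on.\<close>

definition depth :: nat where
  "depth = (LEAST d. stage Bas d = stage Bas (Suc d))"

lemma stage_depth: "stage Bas depth = stage Bas (Suc depth)"
proof -
  have "\<exists>d. stage Bas d = stage Bas (Suc d)"
  proof (rule ccontr)
    assume "\<not> ?thesis"
    then have "stage Bas (Suc d) \<subset> stage Bas d" for d using stage_Bas_antimono[of d] by blast
    then have less: "card (stage Bas (Suc d)) < card (stage Bas d)" for d
      using psubset_card_mono finite_subset[OF stage_subset[OF subset_refl] finite_Bas] by metis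
    have "card (stage Bas d) + d \<le> card Bas" for d
      by (induction d) (use less in \<open>auto simp: Suc_le_eq intro: order.strict_trans2\<close>, meson add_less_mono1 le_trans less less_eq_Suc_le nat_less_le order.strict_trans2)
    from this[of "Suc (card Bas)"] show False by simp
  qed
  then show ?thesis unfolding depth_def by (rule LeastI_ex)
qed

lemma depth_le:
  assumes "card (stage Bas t) = card (stage Bas (Suc t))" shows "depth \<le> t"
proof -
  have "finite (stage Bas t)" by (rule finite_subset[OF stage_subset finite_Bas]) simp
  then have "stage Bas t = stage Bas (Suc t)"
    using card_subset_eq[OF _ stage_Bas_antimono[of t]] assms by simp
  then show ?thesis unfolding depth_def by (rule Least_le)
qed

text \<open>On the final set \<open>D\<close> the map \<open>omega\<close> is onto, hence a
  permutation, since \<open>D\<close> is finite. A smaller start \<open>S\<close> reaches a subset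
  of \<open>D\<close> at time \<open>depth\<close>, and from then on no elements are lost or merged.
  This bounds \<phi> of every module by \<open>depth\<close>.\<close>

lemma card_stage_stable:
  assumes "S \<subseteq> Bas"
  shows "card (stage S (depth + j)) = card (stage S depth)"
proof -
  define D where "D = stage Bas depth"
  have fin: "finite D" unfolding D_def by (rule finite_subset[OF stage_subset finite_Bas]) simp
  have DB: "D \<subseteq> Bas" unfolding D_def by (rule stage_subset) simp
  have "D = omega ` D \<inter> Bas" unfolding D_def using stage_depth by simp
  then have "D \<subseteq> omega ` D" by blast
  then have eq: "omega ` D = D" using fin by (metis card_image_le card_seteq finite_imageI)
  then have inj: "inj_on omega D" using fin by (simp add: eq_card_imp_inj_on)
  have "card (stage T j) = card T \<and> stage T j \<subseteq> D" if "T \<subseteq> D" for T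
  proof (induction j)
    case (Suc j)
    have "omega ` stage T j \<subseteq> D" using Suc eq by blast
    then have "stage T (Suc j) = omega ` stage T j" using DB by auto
    moreover have "card (omega ` stage T j) = card (stage T j)"
      using Suc inj by (meson card_image inj_on_subset)
    ultimately show ?case using Suc eq by auto
  qed (use that in auto)
  moreover have "stage S depth \<subseteq> D" unfolding D_def by (rule stage_mono[OF assms])
  ultimately show ?thesis by (simp add: stage_stage)
qed

text \<open>Modules are lifted to intervals \<open>[x, y)\<close> of integers: \<open>proj_int (x, y)\<close> has top \<open>x\<close> and length
  \<open>y - x\<close>, and the projective with top \<open>x\<close> is \<open>[x, f x)\<close>.  Then the syzygy of \<open>[x, y)\<close> is \<open>[y, f x)\<close>.\<close>

definition f :: "int \<Rightarrow> int" where
  "f x = x + int (c (vert N x))"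

definition proj_int :: "int \<times> int \<Rightarrow> nat \<times> nat" where
  "proj_int = (\<lambda>(x, y). (vert N x, nat (y - x)))"

definition intervals :: "int set \<Rightarrow> int set \<Rightarrow> (int \<times> int) set" where
  "intervals A B = {(x, y). x \<in> A \<and> y \<in> B \<and> x < y \<and> y < f x}"

definition shift_closed :: "int set \<Rightarrow> bool" where
  "shift_closed A \<longleftrightarrow> (\<forall>x k. x \<in> A \<longrightarrow> x + int N * k \<in> A)"

lemma f_shift: "f (x + int N * k) = f x + int N * k"
  by (simp add: f_def vert_add_mult)

text \<open>For neighbouring integers this is \<open>c_step\<close>: passing to the next vertex
  shortens the projective by at most one.\<close>

lemma f_mono: "x \<le> y \<Longrightarrow> f x \<le> f y"
proof (induction y rule: int_ge_induct)
  case (step y)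
  have "f y \<le> f (y + 1)"
    using c_step[OF vert_in[OF N], of y] by (simp add: f_def nxt_vert[OF N])
  with step show ?case by simp
qed simp

lemma proj_int_in_Bas: "x \<le> y \<Longrightarrow> proj_int (x, y) \<in> Bas \<longleftrightarrow> x < y \<and> y < f x"
  using vert_in[OF N, of x] by (auto simp: proj_int_def Bas_def f_def)

lemma omega_proj_int: "x < y \<Longrightarrow> y \<le> f x \<Longrightarrow> omega (proj_int (x, y)) = proj_int (y, f x)"
  by (simp add: proj_int_def funpow_nxt_vert[OF N] f_def)

lemma proj_int_eqD:
  assumes "proj_int (x, y) = proj_int (x', y')" "x \<le> y" "x' \<le> y'"
  shows "\<exists>k. x' = x + int N * k \<and> y' = y + int N * k"
proof -
  obtain k where "x' = x + int N * k" using assms vert_eqD[OF N] by (auto simp: proj_int_def)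
  moreover have "y' - x' = y - x" using assms by (simp add: proj_int_def eq_nat_nat_iff)
  ultimately show ?thesis by (intro exI[of _ k]) simp
qed

lemma Bas_eq: "Bas = proj_int ` intervals UNIV UNIV"
proof (intro equalityI subsetI)
  fix p assume "p \<in> Bas"
  then obtain s l where p: "p = (s, l)" "s \<in> {1..N}" "1 \<le> l" "l < c s" by (auto simp: Bas_def)
  have "p = proj_int (int s, int s + int l)" using p vert_self[of s N] by (simp add: proj_int_def)
  moreover have "(int s, int s + int l) \<in> intervals UNIV UNIV"
    using p vert_self[of s N] by (simp add: intervals_def f_def)
  ultimately show "p \<in> proj_int ` intervals UNIV UNIV" by blast
qed (auto simp: intervals_def proj_int_in_Bas)

text \<open>Since \<open>[x, y)\<close> goes to \<open>[y, f x)\<close>, the right ends become left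
  ends, and the old left ends are advanced by \<open>f\<close>. Conversely, a nonprojective
  \<open>[y, f x)\<close> comes from an interval: \<open>y \<le> x\<close> would give
  \<open>f y \<le> f x\<close> by monotonicity.\<close>

lemma omega_intervals: "omega ` proj_int ` intervals A B \<inter> Bas = proj_int ` intervals B (f ` A)"
proof (intro equalityI subsetI)
  fix p assume p: "p \<in> omega ` proj_int ` intervals A B \<inter> Bas"
  then obtain x y where xy: "x \<in> A" "y \<in> B" "x < y" "y < f x" and "p = omega (proj_int (x, y))"
    by (auto simp: intervals_def)
  then have p': "p = proj_int (y, f x)" by (simp add: omega_proj_int)
  then have "f x < f y" using p xy proj_int_in_Bas[of y "f x"] by simp
  then have "(y, f x) \<in> intervals B (f ` A)" using xy by (simp add: intervals_def)
  then show "p \<in> proj_int ` intervals B (f ` A)" using p' by blast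
next
  fix p assume "p \<in> proj_int ` intervals B (f ` A)"
  then obtain x y where xy: "y \<in> B" "x \<in> A" "y < f x" "f x < f y" and p: "p = proj_int (y, f x)"
    by (auto simp: intervals_def)
  have "x < y" using xy f_mono[of y x] by linarith
  then have "p = omega (proj_int (x, y))" using xy p by (simp add: omega_proj_int)
  moreover have "(x, y) \<in> intervals A B" using xy \<open>x < y\<close> by (simp add: intervals_def)
  ultimately show "p \<in> omega ` proj_int ` intervals A B \<inter> Bas"
    using xy p proj_int_in_Bas[of y "f x"] by auto
qed

lemma stage_intervals:
  "stage Bas n = proj_int ` intervals (range (f ^^ (n div 2))) (range (f ^^ (Suc n div 2)))"
proof (induction n)
  case 0 then show ?case by (simp add: Bas_eq)
next
  case (Suc n)
  have "f ` range (f ^^ (n div 2)) = range (f ^^ (Suc (Suc n) div 2))"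
    by (simp add: image_image comp_def)
  then show ?case using omega_intervals Suc by simp
qed

text \<open>\<open>proj_int\<close> determines the endpoints only up to a common shift, so
  membership of an endpoint in such a range must not depend on the representative.\<close>

lemma shift_closed_range: "shift_closed (range (f ^^ t))"
proof (induction t)
  case (Suc t)
  show ?case unfolding shift_closed_def
  proof (intro allI impI)
    fix x k assume "x \<in> range (f ^^ Suc t)"
    then obtain z where z: "x = f ((f ^^ t) z)" by auto
    have "(f ^^ t) z + int N * k \<in> range (f ^^ t)" using Suc by (simp add: shift_closed_def)
    then obtain w where "(f ^^ t) z + int N * k = (f ^^ t) w" by blast
    then have "x + int N * k = (f ^^ Suc t) w" using z f_shift by (metis comp_apply funpow.simps(2))
    then show "x + int N * k \<in> range (f ^^ Suc t)" by blast
  qed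
qed (simp add: shift_closed_def)

text \<open>An infinite syzygy orbit unrolls to a strictly increasing sequence \<open>w\<close> with
  \<open>w (n + 2) = f (w n)\<close>.  Every \<open>y\<close> lies in some gap \<open>[w n, w (n + 1))\<close>, up to a shift, whence
  \<open>y < w (n + 1) < w (n + 2) \<le> f y\<close>.\<close>

lemma interlacing_sequence:
  assumes "x \<in> Bas" "\<And>n. (omega ^^ n) x \<in> Bas"
  shows "\<exists>w. strict_mono w \<and> (\<forall>n. w (Suc (Suc n)) = f (w n))"
proof -
  from assms(1) obtain a b where ab: "x = proj_int (a, b)" "a < b" "b < f a"
    unfolding Bas_eq intervals_def by auto
  \<comment> \<open>The even terms run through the \<open>f\<close>-orbit of \<open>a\<close> and
    the odd terms through that of \<open>b\<close>, which builds in the recursion.\<close>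
  define w where "w n = (f ^^ (n div 2)) (if even n then a else b)" for n
  have rec: "w (Suc (Suc n)) = f (w n)" for n by (simp add: w_def)
  have inv: "w n < w (Suc n) \<and> w (Suc n) < f (w n) \<and> (omega ^^ n) x = proj_int (w n, w (Suc n))" for n
  proof (induction n)
    case 0 then show ?case using ab by (simp add: w_def)
  next
    case (Suc n)
    have om: "(omega ^^ Suc n) x = proj_int (w (Suc n), w (Suc (Suc n)))"
      using Suc by (simp add: rec omega_proj_int)
    then have "proj_int (w (Suc n), w (Suc (Suc n))) \<in> Bas" using assms(2) by metis
    then show ?case using Suc om proj_int_in_Bas[of "w (Suc n)" "w (Suc (Suc n))"] by (simp add: rec)
  qed
  then have "strict_mono w" by (simp add: strict_mono_Suc_iff)
  then show ?thesis using rec by blast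
qed

lemma gap_point:
  assumes w: "strict_mono w" "\<And>n. w (Suc (Suc n)) = f (w n)"
  shows "\<exists>z\<in>range (f ^^ t). y < z \<and> z < f y"
proof -
  have ge: "w n \<ge> w 0 + int n" for n
  proof (induction n)
    case (Suc n) then show ?case using w(1)[THEN strict_monoD, of n "Suc n"] by simp
  qed simp
  \<comment> \<open>A shift by a multiple of \<open>N\<close> moves \<open>y\<close> to
    \<open>w (2 * t)\<close> or beyond. The first term \<open>w k\<close> above it then has
    \<open>k > 2 * t\<close> and is the value of \<open>f ^^ t\<close> at an earlier term.\<close>
  have "\<exists>m. w (2 * t) \<le> y + int N * m"
    by (rule exI[of _ "max 0 (w (2 * t) - y)"]) (use N mult_right_mono[of 1 "int N" "max 0 (w (2 * t) - y)"] in auto)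
  then obtain m where m: "w (2 * t) \<le> y + int N * m" ..
  define y' where "y' = y + int N * m"
  have "\<exists>n. y' < w n" by (rule exI[of _ "nat (y' - w 0 + 1)"]) (use ge[of "nat (y' - w 0 + 1)"] in linarith)
  define k where "k = (LEAST n. y' < w n)"
  have k: "y' < w k" unfolding k_def by (rule LeastI_ex) fact
  have "2 * t < k" using m k w(1) unfolding y'_def by (metis strict_mono_less_eq linorder_not_le order.strict_trans1 order_less_le)
  then obtain n where n: "k = Suc n" by (cases k) auto
  have "w n \<le> y'" using not_less_Least[of n "\<lambda>n. y' < w n"] n unfolding k_def by fastforce
  then have "w (Suc k) \<le> f y'" using w(2)[of n] f_mono[of "w n" y'] n by simp
  then have lt: "w k < f y'" using w(1)[THEN strict_monoD, of k "Suc k"] by simp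
  have iter: "w (2 * i + j) = (f ^^ i) (w j)" for i j
    by (induction i) (auto simp: w(2))
  have "w k = (f ^^ t) (w (k - 2 * t))" using iter[of t "k - 2 * t"] \<open>2 * t < k\<close> by simp
  then have "w k \<in> range (f ^^ t)" by simp
  then have "w k + int N * (- m) \<in> range (f ^^ t)" using shift_closed_range[of t] unfolding shift_closed_def by blast
  moreover have "y < w k + int N * (- m)" using k by (simp add: y'_def)
  moreover have "w k + int N * (- m) < f y" using lt f_shift[of y m] by (simp add: y'_def)
  ultimately show ?thesis by blast
qed

lemma even_depth:
  assumes "x \<in> Bas" "\<And>n. (omega ^^ n) x \<in> Bas"
  shows "even depth"
proof (rule ccontr)
  assume "odd depth"
  then obtain t where t: "depth = Suc (2 * t)" by (auto elim: oddE)
  obtain w where w: "strict_mono w" "\<And>n. w (Suc (Suc n)) = f (w n)"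
    using interlacing_sequence[OF assms] by blast
  let ?E = "\<lambda>t. range (f ^^ t)"
  have sub: "?E t \<subseteq> ?E (Suc t)"
  proof
    fix y assume y: "y \<in> ?E t"
    obtain z where z: "z \<in> ?E (Suc t)" "y < z" "z < f y" using gap_point[OF w] by blast
    \<comment> \<open>The left end is known to lie in \<open>?E t\<close> only, the right end in
      \<open>?E (Suc t)\<close>. The next stage requires left ends in \<open>?E (Suc t)\<close> as
      well, so stationarity carries \<open>y\<close> there, up to a shift.\<close>
    have "proj_int (y, z) \<in> stage Bas (Suc (2 * t))"
      unfolding stage_intervals using y z by (intro imageI) (simp add: intervals_def)
    also have "\<dots> = stage Bas (Suc (Suc (2 * t)))" using stage_depth t by simp
    finally have "proj_int (y, z) \<in> proj_int ` intervals (?E (Suc t)) (?E (Suc t))"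
      unfolding stage_intervals by simp
    then obtain y' z' where y': "proj_int (y, z) = proj_int (y', z')" "y' \<in> ?E (Suc t)" "y' < z'"
      by (auto simp: intervals_def)
    then obtain k where "y = y' + int N * k" using z proj_int_eqD[of y' z' y z] by auto
    then show "y \<in> ?E (Suc t)" using y'(2) shift_closed_range[of "Suc t"] unfolding shift_closed_def by blast
  qed
  moreover have "?E (Suc t) \<subseteq> ?E t" by (auto simp: funpow_swap1)
  ultimately have "?E t = ?E (Suc t)" by (rule equalityI)
  then have "stage Bas (2 * t) = stage Bas (Suc (2 * t))"
    unfolding stage_intervals by (simp del: funpow.simps)
  then have "depth \<le> 2 * t" unfolding depth_def by (rule Least_le)
  then show False using t by simp
qed

end

section \<open>Representations\<close>

text \<open>Without these rules \<open>i \<in> {1..N}\<close> stays as it is and discharges side conditions of rewrite rules.\<close>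

declare atLeastAtMost_iff [simp del] One_nat_def [simp del]

declare nxt_in [simp] funpow_nxt_in [simp]

text \<open>Representations of the quiver without relations: morphisms, paths and direct sums do not
  involve \<open>REL\<close>.\<close>

definition is_rep :: "nat \<Rightarrow> 'k::field rep \<Rightarrow> bool" where
  "is_rep N V \<longleftrightarrow> (\<forall>i\<in>{1..N}. dim_row (mp V i) = dm V (nxt N i) \<and> dim_col (mp V i) = dm V i)"

lemma is_repD:
  "is_rep N V \<Longrightarrow> i \<in> {1..N} \<Longrightarrow> dim_row (mp V i) = dm V (nxt N i)"
  "is_rep N V \<Longrightarrow> i \<in> {1..N} \<Longrightarrow> dim_col (mp V i) = dm V i"
  by (auto simp: is_rep_def)

lemma modules_is_rep: "V \<in> modules N REL \<Longrightarrow> is_rep N V"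
  unfolding modules_def is_rep_def by (metis (no_types, lifting) carrier_matD mem_Collect_eq)

lemma modulesI:
  assumes "is_rep N V"
    and "\<And>s l. (s, l) \<in> set REL \<Longrightarrow> path_mat N V s l = 0\<^sub>m (dm V ((nxt N ^^ l) s)) (dm V s)"
  shows "V \<in> modules N REL"
  using assms unfolding modules_def is_rep_def satisfies_def by (auto intro!: carrier_matI)

lemma modules_path:
  "V \<in> modules N REL \<Longrightarrow> (s, l) \<in> set REL \<Longrightarrow> path_mat N V s l = 0\<^sub>m (dm V ((nxt N ^^ l) s)) (dm V s)"
  unfolding modules_def satisfies_def by auto

lemma rep_homI:
  assumes "\<And>i. i \<in> {1..N} \<Longrightarrow> dim_row (f i) = dm W i" "\<And>i. i \<in> {1..N} \<Longrightarrow> dim_col (f i) = dm V i"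
    "\<And>i. i \<in> {1..N} \<Longrightarrow> f (nxt N i) * mp V i = mp W i * f i"
  shows "f \<in> rep_hom N V W"
  using assms unfolding rep_hom_def by (auto intro!: carrier_matI)

lemma rep_homD:
  assumes "f \<in> rep_hom N V W" "i \<in> {1..N}"
  shows "dim_row (f i) = dm W i" "dim_col (f i) = dm V i" "f (nxt N i) * mp V i = mp W i * f i"
proof -
  have "f i \<in> carrier_mat (dm W i) (dm V i) \<and> f (nxt N i) * mp V i = mp W i * f i"
    using assms unfolding rep_hom_def by blast
  then show "dim_row (f i) = dm W i" "dim_col (f i) = dm V i" "f (nxt N i) * mp V i = mp W i * f i"
    by auto
qed

lemma rep_hom_id: "is_rep N V \<Longrightarrow> (\<lambda>i. 1\<^sub>m (dm V i)) \<in> rep_hom N V V"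
  by (rule rep_homI) (auto simp: mat_algebra is_repD)

lemma rep_hom_comp:
  assumes "is_rep N U" "is_rep N V" "is_rep N W" and f: "f \<in> rep_hom N U V" and g: "g \<in> rep_hom N V W"
  shows "(\<lambda>i. g i * f i) \<in> rep_hom N U W"
proof (rule rep_homI)
  fix i assume i: "i \<in> {1..N}"
  note d = rep_homD(1,2)[OF f] rep_homD(1,2)[OF g] is_repD[OF assms(1)] is_repD[OF assms(2)] is_repD[OF assms(3)]
  have "g (nxt N i) * f (nxt N i) * mp U i = g (nxt N i) * mp V i * f i"
    using i rep_homD(3)[OF f i] by (simp add: mat_algebra d)
  also have "\<dots> = mp W i * (g i * f i)" using i rep_homD(3)[OF g i] by (simp add: mat_algebra d)
  finally show "g (nxt N i) * f (nxt N i) * mp U i = mp W i * (g i * f i)" .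
qed (use rep_homD[OF f] rep_homD[OF g] in auto)

lemma inverse_hom:
  assumes V: "is_rep N V" and W: "is_rep N W" and f: "f \<in> rep_hom N V W"
    and g: "\<And>i. i \<in> {1..N} \<Longrightarrow> g i \<in> carrier_mat (dm V i) (dm W i)"
    and gf: "\<And>i. i \<in> {1..N} \<Longrightarrow> g i * f i = 1\<^sub>m (dm V i)"
    and fg: "\<And>i. i \<in> {1..N} \<Longrightarrow> f i * g i = 1\<^sub>m (dm W i)"
  shows "g \<in> rep_hom N W V"
proof (rule rep_homI)
  have dg: "dim_row (g i) = dm V i" "dim_col (g i) = dm W i" if "i \<in> {1..N}" for i using g[OF that] by auto
  note d = rep_homD(1,2)[OF f] is_repD[OF V] is_repD[OF W] dg
  fix i assume i: "i \<in> {1..N}"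
  then show "dim_row (g i) = dm V i" "dim_col (g i) = dm W i" by (simp_all add: dg)
  have "g (nxt N i) * mp W i = g (nxt N i) * (mp W i * f i) * g i"
    using i by (simp add: d fg mat_algebra)
  also have "\<dots> = g (nxt N i) * f (nxt N i) * mp V i * g i"
    unfolding rep_homD(3)[OF f i, symmetric] using i by (simp add: d mat_algebra)
  also have "\<dots> = mp V i * g i" using i by (simp add: d gf mat_algebra)
  finally show "g (nxt N i) * mp W i = mp V i * g i" .
qed

subsection \<open>Paths\<close>

lemma path_mat_dims:
  assumes "is_rep N V" "s \<in> {1..N}"
  shows "dim_row (path_mat N V s l) = dm V ((nxt N ^^ l) s)" "dim_col (path_mat N V s l) = dm V s"
proof -
  have "dim_row (path_mat N V s l) = dm V ((nxt N ^^ l) s) \<and> dim_col (path_mat N V s l) = dm V s"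
    by (induction l) (use assms in \<open>auto simp: is_repD\<close>)
  then show "dim_row (path_mat N V s l) = dm V ((nxt N ^^ l) s)" "dim_col (path_mat N V s l) = dm V s"
    by auto
qed

lemma path_mat_add:
  assumes "is_rep N V" "s \<in> {1..N}"
  shows "path_mat N V s (l + m) = path_mat N V ((nxt N ^^ l) s) m * path_mat N V s l"
proof (induction m)
  case 0
  then show ?case using assms by (simp add: path_mat_dims mat_algebra)
next
  case (Suc m)
  have "(nxt N ^^ (l + m)) s = (nxt N ^^ m) ((nxt N ^^ l) s)"
    by (metis add.commute comp_apply funpow_add)
  then show ?case using assms Suc by (simp add: path_mat_dims is_repD mat_algebra)
qed

lemma path_mat_Suc_start:
  assumes "is_rep N V" "s \<in> {1..N}"
  shows "path_mat N V s (Suc l) = path_mat N V (nxt N s) l * mp V s"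
  using path_mat_add[OF assms, of "Suc 0" l] assms by (simp add: mat_algebra is_repD)

lemma rep_hom_path:
  assumes V: "is_rep N V" and W: "is_rep N W" and f: "f \<in> rep_hom N V W" and s: "s \<in> {1..N}"
  shows "f ((nxt N ^^ l) s) * path_mat N V s l = path_mat N W s l * f s"
proof (induction l)
  case 0
  then show ?case using s rep_homD[OF f s] by (simp add: mat_algebra)
next
  case (Suc l)
  let ?t = "(nxt N ^^ l) s"
  have t: "?t \<in> {1..N}" using s by simp
  note d = rep_homD(1,2)[OF f] is_repD[OF V] is_repD[OF W] path_mat_dims[OF V s] path_mat_dims[OF W s]
  have "f (nxt N ?t) * (mp V ?t * path_mat N V s l) = f (nxt N ?t) * mp V ?t * path_mat N V s l"
    using s by (simp add: d mat_algebra)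
  also have "\<dots> = mp W ?t * (f ?t * path_mat N V s l)"
    unfolding rep_homD(3)[OF f t] using s by (simp add: d mat_algebra)
  also have "\<dots> = mp W ?t * path_mat N W s l * f s"
    unfolding Suc using s by (simp add: d mat_algebra)
  finally show ?case by simp
qed

subsection \<open>Isomorphisms and direct sums\<close>

lemma rep_iso_refl: "is_rep N V \<Longrightarrow> rep_iso N V V"
  unfolding rep_iso_def
  by (intro bexI[of _ "\<lambda>i. 1\<^sub>m (dm V i)"] ballI) (auto simp: rep_hom_id)

lemma rep_iso_sym: "rep_iso N V W \<Longrightarrow> rep_iso N W V"
  unfolding rep_iso_def by blast

lemma rep_iso_trans:
  assumes r: "is_rep N U" "is_rep N V" "is_rep N W" and "rep_iso N U V" "rep_iso N V W"
  shows "rep_iso N U W"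
proof -
  obtain f g where f: "f \<in> rep_hom N U V" and g: "g \<in> rep_hom N V U"
    and fg: "\<And>i. i \<in> {1..N} \<Longrightarrow> g i * f i = 1\<^sub>m (dm U i) \<and> f i * g i = 1\<^sub>m (dm V i)"
    using assms unfolding rep_iso_def by blast
  obtain f' g' where f': "f' \<in> rep_hom N V W" and g': "g' \<in> rep_hom N W V"
    and fg': "\<And>i. i \<in> {1..N} \<Longrightarrow> g' i * f' i = 1\<^sub>m (dm V i) \<and> f' i * g' i = 1\<^sub>m (dm W i)"
    using assms unfolding rep_iso_def by blast
  note d = rep_homD(1,2)[OF f] rep_homD(1,2)[OF g] rep_homD(1,2)[OF f'] rep_homD(1,2)[OF g']
  show ?thesis unfolding rep_iso_def
  proof (rule bexI[of _ "\<lambda>i. f' i * f i"], rule bexI[of _ "\<lambda>i. g i * g' i"], rule ballI)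
    fix i assume i: "i \<in> {1..N}"
    have "g i * g' i * (f' i * f i) = g i * (g' i * f' i) * f i"
      using i by (simp add: d mat_algebra)
    also have "\<dots> = 1\<^sub>m (dm U i)" using i fg fg' by (simp add: d mat_algebra)
    finally have 1: "g i * g' i * (f' i * f i) = 1\<^sub>m (dm U i)" .
    have "f' i * f i * (g i * g' i) = f' i * (f i * g i) * g' i"
      using i by (simp add: d mat_algebra)
    also have "\<dots> = 1\<^sub>m (dm W i)" using i fg fg' by (simp add: d mat_algebra)
    finally show "g i * g' i * (f' i * f i) = 1\<^sub>m (dm U i) \<and> f' i * f i * (g i * g' i) = 1\<^sub>m (dm W i)"
      using 1 by simp
  qed (use rep_hom_comp r f f' g g' in blast)+
qed

lemma rep_iso_dm:
  assumes "rep_iso N V W" and i: "i \<in> {1..N}"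
  shows "dm V i = dm W i"
proof -
  obtain f g where f: "f \<in> rep_hom N V W" and g: "g \<in> rep_hom N W V"
    and fg: "g i * f i = 1\<^sub>m (dm V i)" "f i * g i = 1\<^sub>m (dm W i)"
    using assms unfolding rep_iso_def by blast
  note d = rep_homD(1,2)[OF f i] rep_homD(1,2)[OF g i]
  have "dm V i \<le> dm W i" by (rule one_mat_factor_le[OF _ _ fg(1)]) (auto intro: carrier_matI simp: d)
  moreover have "dm W i \<le> dm V i" by (rule one_mat_factor_le[OF _ _ fg(2)]) (auto intro: carrier_matI simp: d)
  ultimately show ?thesis by simp
qed

text \<open>An isomorphism multiplies the path matrix by invertible matrices on both sides. These
  ranks are the invariants from which multiplicities are computed.\<close>

lemma rep_iso_rk_path:
  assumes "rep_iso N V W" "is_rep N V" "is_rep N W" and s: "s \<in> {1..N}"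
  shows "rk (path_mat N V s l) = rk (path_mat N W s l)"
proof -
  obtain f g where f: "f \<in> rep_hom N V W" and g: "g \<in> rep_hom N W V"
    and fg: "\<And>i. i \<in> {1..N} \<Longrightarrow> g i * f i = 1\<^sub>m (dm V i) \<and> f i * g i = 1\<^sub>m (dm W i)"
    using assms unfolding rep_iso_def by blast
  let ?t = "(nxt N ^^ l) s"
  have t: "?t \<in> {1..N}" using s by simp
  note d = rep_homD(1,2)[OF f] rep_homD(1,2)[OF g] path_mat_dims[OF assms(2) s] path_mat_dims[OF assms(3) s]
  have "path_mat N W s l = path_mat N W s l * (f s * g s)" using fg[OF s] by (simp add: d mat_algebra)
  also have "\<dots> = path_mat N W s l * f s * g s" using s by (simp add: d mat_algebra)
  also have "\<dots> = f ?t * path_mat N V s l * g s" unfolding rep_hom_path[OF assms(2,3) f s] ..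
  also have "rk \<dots> = rk (path_mat N V s l)"
    by (rule rk_mult_iso[of "g ?t" _ _ _ "f s"]) (use fg[OF s] fg[OF t] s t in \<open>simp_all add: d\<close>)
  finally show ?thesis by simp
qed

lemma dsum_simps [simp]:
  "dm (dsum V W) i = dm V i + dm W i" "mp (dsum V W) i = diag (mp V i) (mp W i)"
  by (simp_all add: dsum_def diag_def)

lemma is_rep_dsum: "is_rep N V \<Longrightarrow> is_rep N W \<Longrightarrow> is_rep N (dsum V W)"
  by (simp add: is_rep_def)

lemma path_mat_dsum:
  assumes "is_rep N V" "is_rep N W" "s \<in> {1..N}"
  shows "path_mat N (dsum V W) s l = diag (path_mat N V s l) (path_mat N W s l)"
  by (induction l) (use assms in \<open>simp_all add: diag_one diag_mult path_mat_dims is_repD\<close>)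

lemma dsum_hom:
  assumes "is_rep N V" "is_rep N W"
  shows "(\<lambda>i. inl (dm V i) (dm W i)) \<in> rep_hom N V (dsum V W)"
    "(\<lambda>i. inr (dm V i) (dm W i)) \<in> rep_hom N W (dsum V W)"
    "(\<lambda>i. prl (dm V i) (dm W i)) \<in> rep_hom N (dsum V W) V"
    "(\<lambda>i. prr (dm V i) (dm W i)) \<in> rep_hom N (dsum V W) W"
  by (rule rep_homI; use assms in \<open>simp add: diag_inl diag_inr prl_diag prr_diag is_repD\<close>)+

lemma diag_hom:
  assumes "is_rep N V" "is_rep N W" "is_rep N V'" "is_rep N W'"
    and f: "f \<in> rep_hom N V V'" and g: "g \<in> rep_hom N W W'"
  shows "(\<lambda>i. diag (f i) (g i)) \<in> rep_hom N (dsum V W) (dsum V' W')"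
  by (rule rep_homI) (use assms(1-4) in \<open>simp_all add: diag_mult is_repD rep_homD[OF f] rep_homD[OF g]\<close>)

lemma rep_iso_dsum:
  assumes r: "is_rep N V" "is_rep N W" "is_rep N V'" "is_rep N W'"
    and "rep_iso N V V'" "rep_iso N W W'"
  shows "rep_iso N (dsum V W) (dsum V' W')"
proof -
  obtain f g where f: "f \<in> rep_hom N V V'" and g: "g \<in> rep_hom N V' V"
    and fg: "\<And>i. i \<in> {1..N} \<Longrightarrow> g i * f i = 1\<^sub>m (dm V i) \<and> f i * g i = 1\<^sub>m (dm V' i)"
    using assms unfolding rep_iso_def by blast
  obtain f' g' where f': "f' \<in> rep_hom N W W'" and g': "g' \<in> rep_hom N W' W"
    and fg': "\<And>i. i \<in> {1..N} \<Longrightarrow> g' i * f' i = 1\<^sub>m (dm W i) \<and> f' i * g' i = 1\<^sub>m (dm W' i)"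
    using assms unfolding rep_iso_def by blast
  note d = rep_homD(1,2)[OF f] rep_homD(1,2)[OF g] rep_homD(1,2)[OF f'] rep_homD(1,2)[OF g']
  show ?thesis unfolding rep_iso_def
    by (intro bexI[OF _ diag_hom[OF r f f']] bexI[OF _ diag_hom[OF r(3,4,1,2) g g']] ballI)
      (simp add: d diag_mult diag_one fg fg')
qed

definition null_rep :: "'k::field rep" where
  "null_rep = Rep (\<lambda>_. 0) (\<lambda>_. 0\<^sub>m 0 0)"

lemma null_rep_simps [simp]: "dm null_rep i = 0" "mp null_rep i = 0\<^sub>m 0 0"
  by (simp_all add: null_rep_def)

lemma is_rep_null: "is_rep N null_rep"
  by (simp add: is_rep_def)

lemma mat_eq_empty: "dim_row A = dim_row B \<Longrightarrow> dim_col A = dim_col B \<Longrightarrow> dim_row A = 0 \<or> dim_col A = 0 \<Longrightarrow> A = B"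
  by (rule eq_matI) auto

lemma zero_rep_modules:
  assumes "is_rep N V" "zero_rep N V" "\<forall>(s, l)\<in>set REL. s \<in> {1..N}"
  shows "V \<in> modules N REL"
  using assms by (intro modulesI mat_eq_empty) (auto simp: path_mat_dims zero_rep_def)

lemma modules_dsum:
  assumes "V \<in> modules N REL" "W \<in> modules N REL" "\<forall>(s, l)\<in>set REL. s \<in> {1..N}"
  shows "dsum V W \<in> modules N REL"
proof (rule modulesI)
  have r: "is_rep N V" "is_rep N W" using assms modules_is_rep by blast+
  then show "is_rep N (dsum V W)" by (rule is_rep_dsum)
  fix s l assume sl: "(s, l) \<in> set REL"
  then have "s \<in> {1..N}" using assms(3) by auto
  then show "path_mat N (dsum V W) s l = 0\<^sub>m (dm (dsum V W) ((nxt N ^^ l) s)) (dm (dsum V W) s)"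
    using modules_path[OF assms(1) sl] modules_path[OF assms(2) sl] r
    by (simp add: path_mat_dsum diag_zero)
qed

lemma zero_hom:
  assumes "is_rep N V" "is_rep N W"
  shows "(\<lambda>i. 0\<^sub>m (dm W i) (dm V i)) \<in> rep_hom N V W"
  using assms by (intro rep_homI) (auto simp: mat_algebra is_repD)

lemma rep_iso_zero:
  assumes "is_rep N V" "is_rep N W" "zero_rep N V" "zero_rep N W"
  shows "rep_iso N V W"
  unfolding rep_iso_def
  by (intro bexI[OF _ zero_hom[OF assms(1,2)]] bexI[OF _ zero_hom[OF assms(2,1)]] ballI)
    (use assms(3,4) in \<open>auto simp: zero_rep_def intro!: mat_eq_empty\<close>)

text \<open>The idempotents \<open>E = 1 - f g\<close> commute with the arrows, and the complement
  \<open>W\<close> is their image, realized at each vertex by a factorization \<open>E = B C\<close>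
  with \<open>C B = 1\<close>. As a retract of \<open>V\<close>, it inherits the relations.\<close>

lemma split_off_summand:
  assumes V: "V \<in> modules N REL" and U: "is_rep N U"
    and f: "f \<in> rep_hom N U V" and g: "g \<in> rep_hom N V U"
    and gf: "\<And>i. i \<in> {1..N} \<Longrightarrow> g i * f i = 1\<^sub>m (dm U i)"
    and REL: "\<forall>(s, l)\<in>set REL. s \<in> {1..N}"
  shows "\<exists>W\<in>modules N REL. rep_iso N V (dsum U W)"
proof -
  have rV: "is_rep N V" by (rule modules_is_rep[OF V])
  note d = rep_homD(1,2)[OF f] rep_homD(1,2)[OF g] is_repD[OF U] is_repD[OF rV]
  define E where "E i = 1\<^sub>m (dm V i) - f i * g i" for i
  have gfg: "f i * (g i * (f i * g i)) = f i * g i" if "i \<in> {1..N}" for i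
  proof -
    have "f i * (g i * (f i * g i)) = f i * (g i * f i * g i)" using that by (simp add: d mat_algebra)
    then show ?thesis using that by (simp add: gf d mat_algebra)
  qed
  have "\<exists>B C r. i \<in> {1..N} \<longrightarrow> B \<in> carrier_mat (dm V i) r \<and> C \<in> carrier_mat r (dm V i) \<and> B * C = E i \<and> C * B = 1\<^sub>m r" for i
  proof (cases "i \<in> {1..N}")
    case True
    have "E i * E i = E i - 0\<^sub>m (dm V i) (dm V i)"
      unfolding E_def using True by (simp add: d mat_algebra gfg)
    also have "\<dots> = E i" using True by (simp add: E_def d mat_algebra)
    finally have "\<exists>r. \<exists>B\<in>carrier_mat (dm V i) r. \<exists>C\<in>carrier_mat r (dm V i). B * C = E i \<and> C * B = 1\<^sub>m r"
      by (intro idempotent_factorization) (use True in \<open>auto simp: E_def d intro: carrier_matI\<close>)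
    then show ?thesis by blast
  qed auto
  then obtain B C r where BC: "\<And>i. i \<in> {1..N} \<Longrightarrow> B i \<in> carrier_mat (dm V i) (r i)"
    "\<And>i. i \<in> {1..N} \<Longrightarrow> C i \<in> carrier_mat (r i) (dm V i)"
    and bc: "\<And>i. i \<in> {1..N} \<Longrightarrow> B i * C i = E i" and cb: "\<And>i. i \<in> {1..N} \<Longrightarrow> C i * B i = 1\<^sub>m (r i)"
    by metis
  have dBC: "dim_row (B i) = dm V i" "dim_col (B i) = r i" "dim_row (C i) = r i" "dim_col (C i) = dm V i"
    if "i \<in> {1..N}" for i using BC[OF that] by auto
  define W where "W = Rep r (\<lambda>i. C (nxt N i) * mp V i * B i)"
  have Ws: "dm W i = r i" "mp W i = C (nxt N i) * mp V i * B i" for i by (simp_all add: W_def)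
  have W: "is_rep N W" by (simp add: is_rep_def Ws dBC)
  have EC: "C i * E i = C i" if "i \<in> {1..N}" for i
  proof -
    have "C i * E i = C i * B i * C i" unfolding bc[OF that, symmetric] using that by (simp add: dBC mat_algebra)
    then show ?thesis using that by (simp add: cb dBC mat_algebra)
  qed
  have EB: "E i * B i = B i" if "i \<in> {1..N}" for i
  proof -
    have "E i * B i = B i * (C i * B i)" unfolding bc[OF that, symmetric] using that by (simp add: dBC mat_algebra)
    then show ?thesis using that by (simp add: cb dBC mat_algebra)
  qed
  have Ef: "E i * f i = 0\<^sub>m (dm V i) (dm U i)" if "i \<in> {1..N}" for i
    using that unfolding E_def by (simp add: d mat_algebra gf)
  have gE: "g i * E i = 0\<^sub>m (dm U i) (dm V i)" if i: "i \<in> {1..N}" for i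
  proof -
    have "g i * (f i * g i) = g i * f i * g i" using i by (simp add: d mat_algebra)
    then show ?thesis using i unfolding E_def by (simp add: d mat_algebra gf)
  qed
  have dE: "dim_row (E i) = dm V i" "dim_col (E i) = dm V i" if "i \<in> {1..N}" for i
    using that by (simp_all add: E_def d)
  have Cf: "C i * f i = 0\<^sub>m (r i) (dm U i)" if i: "i \<in> {1..N}" for i
  proof -
    have "C i * f i = C i * (E i * f i)" using i EC[OF i] by (simp add: d dE dBC mat_algebra flip: mult_assoc_dim)
    then show ?thesis using i by (simp add: Ef dBC mat_algebra)
  qed
  have gB: "g i * B i = 0\<^sub>m (dm U i) (r i)" if i: "i \<in> {1..N}" for i
  proof -
    have "g i * B i = g i * E i * B i" using i EB[OF i] by (simp add: d dE dBC mat_algebra)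
    then show ?thesis using i by (simp add: gE dBC mat_algebra)
  qed
  have comm: "E (nxt N i) * mp V i = mp V i * E i" if i: "i \<in> {1..N}" for i
  proof -
    have "f (nxt N i) * (g (nxt N i) * mp V i) = f (nxt N i) * mp U i * g i"
      unfolding rep_homD(3)[OF g i] using i by (simp add: d mat_algebra)
    also have "\<dots> = mp V i * (f i * g i)" unfolding rep_homD(3)[OF f i] using i by (simp add: d mat_algebra)
    finally show ?thesis unfolding E_def using i by (simp add: d mat_algebra)
  qed
  have hC: "C \<in> rep_hom N V W"
  proof (rule rep_homI)
    fix i assume i: "i \<in> {1..N}"
    have "C (nxt N i) * mp V i = C (nxt N i) * (E (nxt N i) * mp V i)"
      using i EC[of "nxt N i"] by (simp add: d dE dBC flip: mult_assoc_dim)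
    also have "\<dots> = C (nxt N i) * mp V i * (B i * C i)" unfolding comm[OF i] bc[OF i]
      using i by (simp add: d dE dBC mat_algebra)
    also have "\<dots> = mp W i * C i" using i by (simp add: Ws d dBC mat_algebra)
    finally show "C (nxt N i) * mp V i = mp W i * C i" .
  qed (simp_all add: Ws dBC)
  have hB: "B \<in> rep_hom N W V"
  proof (rule rep_homI)
    fix i assume i: "i \<in> {1..N}"
    have "B (nxt N i) * mp W i = B (nxt N i) * C (nxt N i) * mp V i * B i"
      using i by (simp add: Ws d dBC mat_algebra)
    also have "\<dots> = E (nxt N i) * mp V i * B i" using i by (simp add: bc)
    also have "\<dots> = mp V i * (E i * B i)" unfolding comm[OF i] using i by (simp add: d dE dBC mat_algebra)
    finally show "B (nxt N i) * mp W i = mp V i * B i" using i by (simp add: EB)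
  qed (simp_all add: Ws dBC)
  have W': "W \<in> modules N REL"
  proof (rule modulesI[OF W])
    fix s l assume sl: "(s, l) \<in> set REL"
    then have s: "s \<in> {1..N}" using REL by auto
    note dp = path_mat_dims[OF W s] path_mat_dims[OF rV s]
    have "path_mat N W s l = path_mat N W s l * C s * B s"
      using s cb[OF s] by (simp add: dp dBC mat_algebra Ws)
    also have "\<dots> = 0\<^sub>m (dm W ((nxt N ^^ l) s)) (dm W s)"
      unfolding rep_hom_path[OF rV W hC s, symmetric] modules_path[OF V sl]
      using s by (simp add: dp dBC mat_algebra Ws)
    finally show "path_mat N W s l = 0\<^sub>m (dm W ((nxt N ^^ l) s)) (dm W s)" .
  qed
  \<comment> \<open>\<open>?F\<close> and \<open>?G\<close> are inverse to each other because
    \<open>g f = 1\<close>, \<open>C B = 1\<close>, \<open>C f = 0\<close>, \<open>g B = 0\<close>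
    and \<open>f g + B C = 1\<close>.\<close>
  let ?F = "\<lambda>i. inl (dm U i) (r i) * g i + inr (dm U i) (r i) * C i"
  let ?G = "\<lambda>i. f i * prl (dm U i) (r i) + B i * prr (dm U i) (r i)"
  have "rep_iso N V (dsum U W)" unfolding rep_iso_def
  proof (rule bexI[of _ ?F], rule bexI[of _ ?G], rule ballI)
    show "?F \<in> rep_hom N V (dsum U W)"
    proof (rule rep_homI)
      fix i assume i: "i \<in> {1..N}"
      let ?U = "dm U (nxt N i)" and ?W = "r (nxt N i)"
      have "?F (nxt N i) * mp V i = inl ?U ?W * (g (nxt N i) * mp V i) + inr ?U ?W * (C (nxt N i) * mp V i)"
        using i by (simp add: d dBC mat_algebra)
      also have "\<dots> = inl ?U ?W * mp U i * g i + inr ?U ?W * mp W i * C i"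
        unfolding rep_homD(3)[OF g i] rep_homD(3)[OF hC i] using i
        by (simp add: d dBC mat_algebra is_repD[OF W] Ws(1))
      also have "\<dots> = diag (mp U i) (mp W i) * inl (dm U i) (r i) * g i + diag (mp U i) (mp W i) * inr (dm U i) (r i) * C i"
        using i by (simp add: diag_inl diag_inr d is_repD[OF W] Ws(1))
      finally show "?F (nxt N i) * mp V i = mp (dsum U W) i * ?F i"
        using i by (simp add: d dBC mat_algebra is_repD[OF W] Ws(1))
    qed (simp_all add: Ws dBC d)
    show "?G \<in> rep_hom N (dsum U W) V"
    proof (rule rep_homI)
      fix i assume i: "i \<in> {1..N}"
      let ?U = "dm U (nxt N i)" and ?W = "r (nxt N i)"
      have "?G (nxt N i) * mp (dsum U W) i =
          f (nxt N i) * (prl ?U ?W * diag (mp U i) (mp W i)) + B (nxt N i) * (prr ?U ?W * diag (mp U i) (mp W i))"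
        using i by (simp add: d dBC mat_algebra is_repD[OF W] Ws(1))
      also have "\<dots> = (f (nxt N i) * mp U i) * prl (dm U i) (r i) + (B (nxt N i) * mp W i) * prr (dm U i) (r i)"
        using i by (simp add: prl_diag prr_diag d dBC mat_algebra is_repD[OF W] Ws(1))
      also have "\<dots> = mp V i * ?G i"
        unfolding rep_homD(3)[OF f i] rep_homD(3)[OF hB i] using i by (simp add: d dBC mat_algebra)
      finally show "?G (nxt N i) * mp (dsum U W) i = mp V i * ?G i" .
    qed (simp_all add: Ws dBC d)
    fix i assume i: "i \<in> {1..N}"
    let ?u = "dm U i" and ?w = "r i"
    have "?G i * ?F i = f i * (prl ?u ?w * inl ?u ?w) * g i + B i * (prr ?u ?w * inl ?u ?w) * g i
       + (f i * (prl ?u ?w * inr ?u ?w) * C i + B i * (prr ?u ?w * inr ?u ?w) * C i)"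
      using i by (simp add: d dBC mat_algebra)
    also have "\<dots> = f i * g i + B i * C i"
      unfolding biproduct using i by (simp add: d dBC mat_algebra)
    also have "\<dots> = 1\<^sub>m (dm V i)" unfolding bc[OF i] E_def using i d[OF i] by (intro eq_matI) auto
    finally have 1: "?G i * ?F i = 1\<^sub>m (dm V i)" .
    have "?F i * ?G i = inl ?u ?w * (g i * f i) * prl ?u ?w + inr ?u ?w * (C i * f i) * prl ?u ?w
       + (inl ?u ?w * (g i * B i) * prr ?u ?w + inr ?u ?w * (C i * B i) * prr ?u ?w)"
      using i by (simp add: d dBC mat_algebra)
    also have "\<dots> = inl ?u ?w * prl ?u ?w + inr ?u ?w * prr ?u ?w"
      using i by (simp add: gf gB Cf cb mat_algebra)
    finally show "?G i * ?F i = 1\<^sub>m (dm V i) \<and> ?F i * ?G i = 1\<^sub>m (dm (dsum U W) i)"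
      using 1 by (simp add: inl_prl_add_inr_prr Ws)
  qed
  then show ?thesis using W' by blast
qed

section \<open>Uniserial representations\<close>

text \<open>The basis vector number \<open>p < l\<close> of \<open>uni N s l\<close> lies at the vertex reached from \<open>s\<close> after \<open>p\<close> arrows;
  \<open>bas N s l i\<close> lists those at the vertex \<open>i\<close>.\<close>

definition bas :: "nat \<Rightarrow> nat \<Rightarrow> nat \<Rightarrow> nat \<Rightarrow> nat list" where
  "bas N s l i = filter (\<lambda>p. (nxt N ^^ p) s = i) [0..<l]"

definition uni :: "nat \<Rightarrow> nat \<Rightarrow> nat \<Rightarrow> 'k::field rep" where
  "uni N s l = Rep (\<lambda>i. length (bas N s l i)) (\<lambda>i. rel_mat Suc (bas N s l (nxt N i)) (bas N s l i))"

lemma distinct_bas [simp]: "distinct (bas N s l i)"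
  by (simp add: bas_def)

lemma sorted_bas: "sorted_wrt (<) (bas N s l i)"
  unfolding bas_def by (rule sorted_wrt_filter) simp

lemma in_bas [simp]: "p \<in> set (bas N s l i) \<longleftrightarrow> p < l \<and> (nxt N ^^ p) s = i"
  by (auto simp: bas_def)

lemma uni_simps [simp]:
  "dm (uni N s l) i = length (bas N s l i)"
  "mp (uni N s l) i = rel_mat Suc (bas N s l (nxt N i)) (bas N s l i)"
  by (simp_all add: uni_def)

lemma is_rep_uni: "is_rep N (uni N s l)"
  by (simp add: is_rep_def)

lemma funpow_nxt_add: "(nxt N ^^ (p + m)) s = (nxt N ^^ m) ((nxt N ^^ p) s)"
  by (metis add.commute comp_apply funpow_add)

lemma path_mat_uni:
  "path_mat N (uni N s l) s' m = rel_mat (\<lambda>p. p + m) (bas N s l ((nxt N ^^ m) s')) (bas N s l s')"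
proof (induction m)
  case 0
  show ?case by (simp add: rel_mat_id)
next
  case (Suc m)
  have "rel_mat Suc (bas N s l (nxt N ((nxt N ^^ m) s'))) (bas N s l ((nxt N ^^ m) s')) *
      rel_mat (\<lambda>p. p + m) (bas N s l ((nxt N ^^ m) s')) (bas N s l s')
      = (rel_mat (\<lambda>p. p + Suc m) (bas N s l (nxt N ((nxt N ^^ m) s'))) (bas N s l s') :: 'a mat)"
    by (rule rel_mat_mult) (auto simp: funpow_nxt_add)
  then show ?case using Suc by simp
qed

lemma rk_path_uni:
  "rk (path_mat N (uni N s l) s' m :: 'k::field mat) = card {p. p + m < l \<and> (nxt N ^^ p) s = s'}"
proof -
  have "rk (path_mat N (uni N s l) s' m :: 'k mat) =
     card {p \<in> set (bas N s l s'). p + m \<in> set (bas N s l ((nxt N ^^ m) s'))}"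
    unfolding path_mat_uni by (rule rk_rel_mat) auto
  also have "{p \<in> set (bas N s l s'). p + m \<in> set (bas N s l ((nxt N ^^ m) s'))} =
     {p. p + m < l \<and> (nxt N ^^ p) s = s'}"
    by (auto simp: funpow_nxt_add)
  finally show ?thesis .
qed

text \<open>Position 0 is the generator, and it comes first among the basis vectors at
  \<open>s\<close>; so column 0 of a morphism at \<open>s\<close> is the image of the
  generator.\<close>

lemma bas_0: "0 < l \<Longrightarrow> 0 < length (bas N s l s) \<and> bas N s l s ! 0 = 0"
proof -
  assume "0 < l"
  then have "[0..<l] = 0 # [Suc 0..<l]" by (simp add: upt_conv_Cons)
  then show ?thesis by (simp add: bas_def)
qed

lemma col_rel_mat:
  assumes "distinct ys" "c < length xs"
  shows "k < length ys \<Longrightarrow> ys ! k = h (xs ! c) \<Longrightarrow> col (rel_mat h ys xs :: 'a::{zero_neq_one} mat) c = unit_vec (length ys) k"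
    "h (xs ! c) \<notin> set ys \<Longrightarrow> col (rel_mat h ys xs :: 'a mat) c = 0\<^sub>v (length ys)"
proof -
  assume k: "k < length ys" "ys ! k = h (xs ! c)"
  show "col (rel_mat h ys xs :: 'a mat) c = unit_vec (length ys) k"
    using assms k(1) nth_eq_iff_index_eq[OF assms(1) _ k(1)]
    by (intro eq_vecI) (simp_all add: rel_mat_def unit_vec_def flip: k(2))
next
  assume "h (xs ! c) \<notin> set ys"
  then show "col (rel_mat h ys xs :: 'a mat) c = 0\<^sub>v (length ys)"
    using assms by (intro eq_vecI) (auto simp: rel_mat_def dest: nth_mem)
qed

lemma mult_vec_assoc_dim:
  "dim_col A = dim_row B \<Longrightarrow> v \<in> carrier_vec (dim_col B) \<Longrightarrow> (A * B) *\<^sub>v v = A *\<^sub>v (B *\<^sub>v (v :: 'a::semiring_0 vec))"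
  by (rule assoc_mult_mat_vec[of _ "dim_row A" "dim_row B" _ "dim_col B"]) auto

lemma mult_vec_carrier_dim: "dim_row A = n \<Longrightarrow> A *\<^sub>v v \<in> carrier_vec n"
  by (rule carrier_vecI) simp

subsection \<open>Morphisms out of a uniserial representation\<close>

text \<open>The morphism determined by the image \<open>v\<close> of the generator.\<close>

definition gen :: "nat \<Rightarrow> 'k::field rep \<Rightarrow> nat \<Rightarrow> nat \<Rightarrow> 'k vec \<Rightarrow> 'k morphism" where
  "gen N V s l v i = mat_of_cols (dm V i) (map (\<lambda>p. path_mat N V s p *\<^sub>v v) (bas N s l i))"

lemma gen_dims [simp]: "dim_row (gen N V s l v i) = dm V i" "dim_col (gen N V s l v i) = length (bas N s l i)"
  by (simp_all add: gen_def)

lemma col_gen: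
  assumes "is_rep N V" "s \<in> {1..N}" "c < length (bas N s l i)"
  shows "col (gen N V s l v i) c = path_mat N V s (bas N s l i ! c) *\<^sub>v v"
proof -
  have "bas N s l i ! c \<in> set (bas N s l i)" using assms(3) by (rule nth_mem)
  then have "(nxt N ^^ (bas N s l i ! c)) s = i" by simp
  then have "path_mat N V s (bas N s l i ! c) *\<^sub>v v \<in> carrier_vec (dm V i)"
    using path_mat_dims(1)[OF assms(1,2)] by (intro mult_vec_carrier_dim) simp
  then show ?thesis unfolding gen_def using assms(3) by (subst col_mat_of_cols) auto
qed

lemma col_mult_dim: "dim_col A = dim_row B \<Longrightarrow> j < dim_col B \<Longrightarrow> col (A * B) j = A *\<^sub>v col (B :: 'a::semiring_0 mat) j"
proof -
  assume 1: "dim_col A = dim_row B" and 2: "j < dim_col B"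
  have "A \<in> carrier_mat (dim_row A) (dim_row B)" by (rule carrier_matI[OF refl 1])
  then show "col (A * B) j = A *\<^sub>v col B j" by (rule col_mult2[OF _ carrier_matI[OF refl refl] 2])
qed

lemma mult_zero_vec: "dim_col A = n \<Longrightarrow> dim_row A = m \<Longrightarrow> A *\<^sub>v 0\<^sub>v n = 0\<^sub>v (m :: nat)"
  for A :: "'a::semiring_0 mat"
  by (rule eq_vecI) auto

lemma zero_mult_vec: "v \<in> carrier_vec n \<Longrightarrow> 0\<^sub>m m n *\<^sub>v v = (0\<^sub>v m :: 'a::semiring_0 vec)"
  by (rule eq_vecI) auto

lemma gen_hom:
  assumes V: "is_rep N V" and s: "s \<in> {1..N}" and v: "v \<in> carrier_vec (dm V s)"
    and zero: "path_mat N V s l *\<^sub>v v = 0\<^sub>v (dm V ((nxt N ^^ l) s))"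
  shows "gen N V s l v \<in> rep_hom N (uni N s l) V"
proof (rule rep_homI)
  fix i assume i: "i \<in> {1..N}"
  let ?b = "bas N s l i" and ?b' = "bas N s l (nxt N i)" and ?G = "gen N V s l v"
  show "?G (nxt N i) * mp (uni N s l) i = mp V i * ?G i"
  proof (rule mat_col_eqI)
    fix c assume "c < dim_col (mp V i * ?G i)"
    then have c: "c < length ?b" by simp
    define p where "p = ?b ! c"
    have "p \<in> set ?b" unfolding p_def using c by (rule nth_mem)
    then have p: "p < l" "(nxt N ^^ p) s = i" by auto
    have R: "col (mp V i * ?G i) c = path_mat N V s (Suc p) *\<^sub>v v"
    proof -
      have "col (mp V i * ?G i) c = mp V i *\<^sub>v (path_mat N V s p *\<^sub>v v)"
        using c i V s by (simp add: col_mult_dim is_repD col_gen p_def)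
      also have "\<dots> = path_mat N V s (Suc p) *\<^sub>v v"
        using p i V s v by (simp add: mult_vec_assoc_dim path_mat_dims is_repD)
      finally show ?thesis .
    qed
    have L: "col (?G (nxt N i) * mp (uni N s l) i) c = ?G (nxt N i) *\<^sub>v col (rel_mat Suc ?b' ?b) c"
      using c by (simp add: col_mult_dim)
    show "col (?G (nxt N i) * mp (uni N s l) i) c = col (mp V i * ?G i) c"
    proof (cases "Suc p < l")
      case True
      then have "Suc p \<in> set ?b'" using p by simp
      then obtain k where k: "k < length ?b'" "?b' ! k = Suc p" by (auto simp only: in_set_conv_nth)
      then have "col (rel_mat Suc ?b' ?b) c = (unit_vec (length ?b') k :: 'a vec)"
        by (intro col_rel_mat) (use c in \<open>simp_all add: p_def\<close>)
      then have "col (?G (nxt N i) * mp (uni N s l) i) c = col (?G (nxt N i)) k"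
        using mult_unit_vec_eq_col[of k "?G (nxt N i)"] k(1) by (simp add: L del: uni_simps)
      also have "\<dots> = path_mat N V s (Suc p) *\<^sub>v v" using col_gen[OF V s k(1)] k(2) by simp
      finally show ?thesis using R by simp
    next
      case False
      \<comment> \<open>The last basis vector is killed by the arrow; on the other side its image
        vanishes by the assumption on \<open>path_mat N V s l\<close>.\<close>
      then have "l = Suc p" using p by simp
      then have "col (rel_mat Suc ?b' ?b) c = (0\<^sub>v (length ?b') :: 'a vec)"
        by (intro col_rel_mat) (use c in \<open>simp_all add: p_def\<close>)
      then have "col (?G (nxt N i) * mp (uni N s l) i) c = 0\<^sub>v (dm V (nxt N i))"
        unfolding L by (simp add: mult_zero_vec)
      moreover have "(nxt N ^^ l) s = nxt N i" using p \<open>l = Suc p\<close> by simp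
      ultimately show ?thesis using zero R unfolding \<open>l = Suc p\<close> by (simp only:)
    qed
  qed (use i V in \<open>simp_all add: is_repD\<close>)
qed simp_all

text \<open>The \<open>p\<close>-th basis vector is the path of length \<open>p\<close> applied to
  the generator, and morphisms commute with paths.\<close>

lemma gen_unique:
  assumes V: "is_rep N V" and s: "s \<in> {1..N}" and f: "f \<in> rep_hom N (uni N s l) V" and l: "0 < l"
    and i: "i \<in> {1..N}"
  shows "f i = gen N V s l (col (f s) 0) i"
proof (rule mat_col_eqI)
  fix c assume "c < dim_col (gen N V s l (col (f s) 0) i)"
  then have c: "c < length (bas N s l i)" by simp
  define p where "p = bas N s l i ! c"
  have "p \<in> set (bas N s l i)" unfolding p_def using c by (rule nth_mem)
  then have p: "p < l" "(nxt N ^^ p) s = i" by auto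
  note d = rep_homD(1,2)[OF f] path_mat_dims[OF V s] path_mat_dims[OF is_rep_uni s]
  have b0: "0 < length (bas N s l s)" "bas N s l s ! 0 = 0" using bas_0[OF l] by auto
  have "col (path_mat N (uni N s l) s p :: 'a mat) 0 = unit_vec (length (bas N s l i)) c"
    unfolding path_mat_uni p(2) by (rule col_rel_mat) (use b0 c in \<open>simp_all add: p_def\<close>)
  then have "col (f i) c = f i *\<^sub>v col (path_mat N (uni N s l) s p) 0"
    using mult_unit_vec_eq_col[of c "f i"] c i by (simp add: d)
  also have "\<dots> = col (f i * path_mat N (uni N s l) s p) 0"
    using b0 i p by (intro col_mult_dim[symmetric]) (simp_all add: d)
  also have "\<dots> = path_mat N V s p *\<^sub>v col (f s) 0"
    using rep_hom_path[OF is_rep_uni V f s, of p] b0 s by (simp add: p col_mult_dim d)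
  finally show "col (f i) c = col (gen N V s l (col (f s) 0) i) c"
    using c by (simp add: col_gen[OF V s] p_def)
qed (use rep_homD[OF f i] in simp_all)

lemma gen_natural:
  assumes V: "is_rep N V" and W: "is_rep N W" and g: "g \<in> rep_hom N V W" and s: "s \<in> {1..N}"
    and v: "v \<in> carrier_vec (dm V s)" and i: "i \<in> {1..N}"
  shows "g i * gen N V s l v i = gen N W s l (g s *\<^sub>v v) i"
proof (rule mat_col_eqI)
  fix c assume "c < dim_col (gen N W s l (g s *\<^sub>v v) i)"
  then have c: "c < length (bas N s l i)" by simp
  define p where "p = bas N s l i ! c"
  have "p \<in> set (bas N s l i)" unfolding p_def using c by (rule nth_mem)
  then have p: "p < l" "(nxt N ^^ p) s = i" by auto
  note d = rep_homD(1,2)[OF g] path_mat_dims[OF V s] path_mat_dims[OF W s]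
  have "col (g i * gen N V s l v i) c = g i *\<^sub>v (path_mat N V s p *\<^sub>v v)"
    using c i by (simp add: col_mult_dim d col_gen[OF V s] p_def)
  also have "\<dots> = (g i * path_mat N V s p) *\<^sub>v v" using v i p by (simp add: mult_vec_assoc_dim d)
  also have "g i * path_mat N V s p = path_mat N W s p * g s"
    using rep_hom_path[OF V W g s, of p] p by simp
  also have "\<dots> *\<^sub>v v = path_mat N W s p *\<^sub>v (g s *\<^sub>v v)" using v s by (simp add: mult_vec_assoc_dim d)
  finally show "col (g i * gen N V s l v i) c = col (gen N W s l (g s *\<^sub>v v) i) c"
    using c by (simp add: col_gen[OF W s] p_def)
qed (use rep_homD[OF g i] in simp_all)

section \<open>Modules over a cyclic Nakayama algebra\<close>

locale nakayama =
  fixes N :: nat and REL :: "path list"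
  assumes cyc: "cyclic_nakayama N REL"
begin

lemma N_pos: "1 \<le> N"
  using cyc by (auto simp: cyclic_nakayama_def)

lemma REL_start: "\<forall>(s, l)\<in>set REL. s \<in> {1..N}"
  using cyc by (auto simp: cyclic_nakayama_def)

abbreviation cons :: "nat \<Rightarrow> nat \<Rightarrow> bool" where
  "cons s l \<equiv> consequence N (set REL) (s, l)"

lemma cons_pos: "cons s l \<Longrightarrow> s \<in> {1..N} \<and> 1 \<le> l"
proof (induction "(s, l)" arbitrary: s l rule: consequence.induct)
  case axiom
  then show ?case using cyc unfolding cyclic_nakayama_def by fastforce
qed auto

text \<open>Every vertex leads to the start of some relation after finitely many arrows, and
  prolonging a relation at its start keeps it zero. This makes \<open>kup\<close>
  meaningful.\<close>

lemma cons_exists: "s \<in> {1..N} \<Longrightarrow> \<exists>l. cons s l"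
proof -
  assume s: "s \<in> {1..N}"
  obtain s0 l0 where sl: "(s0, l0) \<in> set REL"
    using cyc unfolding cyclic_nakayama_def by (cases REL) auto
  have s0: "s0 \<in> {1..N}" using sl REL_start by auto
  have step: "s \<in> {1..N} \<Longrightarrow> (nxt N ^^ k) s = s0 \<Longrightarrow> cons s (l0 + k)" for k s
  proof (induction k arbitrary: s)
    case 0
    then show ?case using sl by (auto intro: consequence.axiom)
  next
    case (Suc k)
    then have "cons (nxt N s) (l0 + k)" by (simp add: funpow_swap1)
    then show ?case using Suc.prems by (auto intro: consequence.extend_start)
  qed
  \<comment> \<open>The number of arrows from \<open>s\<close> to \<open>s0\<close>, with a full
    turn added so that it cannot be negative.\<close>
  define k where "k = nat (int s0 - int s + int N)"
  have k: "int s + int k = int s0 + int N * 1" using s s0 by (auto simp: k_def atLeastAtMost_iff)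
  have "(nxt N ^^ k) s = (nxt N ^^ k) (vert N (int s))" using vert_self[OF s] by simp
  also have "\<dots> = vert N (int s0 + int N * 1)" unfolding funpow_nxt_vert[OF N_pos] k ..
  also have "\<dots> = s0" unfolding vert_add_mult by (rule vert_self[OF s0])
  finally show ?thesis using step[OF s] by blast
qed

text \<open>The length of the shortest vanishing path from \<open>s\<close>, which is the length of
  the projective with top \<open>s\<close>.\<close>

definition kup :: "nat \<Rightarrow> nat" where
  "kup s = (LEAST l. cons s l)"

lemma cons_iff: "s \<in> {1..N} \<Longrightarrow> cons s l \<longleftrightarrow> kup s \<le> l"
proof
  assume s: "s \<in> {1..N}"
  show "cons s l \<Longrightarrow> kup s \<le> l" unfolding kup_def by (rule Least_le)
  assume le: "kup s \<le> l"
  have 1: "cons s (kup s)" unfolding kup_def using cons_exists[OF s] by (rule LeastI_ex)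
  have "cons s (kup s + d)" for d by (induction d) (auto simp: 1 intro: consequence.extend_end)
  from this[of "l - kup s"] show "cons s l" using le by simp
qed

sublocale kupisch N kup
proof
  show "1 \<le> N" by (rule N_pos)
  fix s assume s: "s \<in> {1..N}"
  show "1 \<le> kup s" using cons_iff[OF s, of "kup s"] cons_pos by blast
  \<comment> \<open>Arrow \<open>s\<close> followed by the shortest vanishing path from the next
    vertex vanishes.\<close>
  show "kup s \<le> Suc (kup (nxt N s))"
    using cons_iff[of "nxt N s" "kup (nxt N s)"] s consequence.extend_start[OF s]
      cons_iff[OF s, of "Suc (kup (nxt N s))"] by simp
qed

lemma kup_funpow: "s \<in> {1..N} \<Longrightarrow> kup s \<le> p + kup ((nxt N ^^ p) s)"
proof (induction p)
  case (Suc p)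
  then show ?case using c_step[of "(nxt N ^^ p) s"] by simp
qed simp

lemma cons_path:
  assumes V: "V \<in> modules N REL" and "cons s l"
  shows "path_mat N V s l = 0\<^sub>m (dm V ((nxt N ^^ l) s)) (dm V s)"
  using assms(2)
proof (induction "(s, l)" arbitrary: s l rule: consequence.induct)
  case axiom
  then show ?case by (rule modules_path[OF V])
next
  case (extend_end s l)
  then have "s \<in> {1..N}" using cons_pos by blast
  then show ?case using extend_end(2) modules_is_rep[OF V] by (simp add: is_repD mat_algebra)
next
  case (extend_start s l)
  then show ?case using modules_is_rep[OF V]
    by (simp add: is_repD mat_algebra path_mat_Suc_start funpow_swap1 del: path_mat.simps)
qed

lemma path_zero:
  assumes V: "V \<in> modules N REL" and "s \<in> {1..N}" "kup s \<le> l"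
  shows "path_mat N V s l = 0\<^sub>m (dm V ((nxt N ^^ l) s)) (dm V s)"
  using cons_path[OF V] cons_iff assms by blast

text \<open>A relation of length \<open>l'\<close> met at position \<open>p\<close> of the module,
  at the vertex \<open>s'\<close>, satisfies
  \<open>l \<le> kup s \<le> p + kup s' \<le> p + l'\<close>, so it pushes every basis vector past
  the end.\<close>

lemma uni_modules:
  assumes s: "s \<in> {1..N}" and l: "l \<le> kup s"
  shows "uni N s l \<in> modules N REL"
proof (rule modulesI[OF is_rep_uni])
  fix s' l' assume sl: "(s', l') \<in> set REL"
  have "p + l' \<ge> l" if "(nxt N ^^ p) s = s'" for p
  proof -
    have "kup s' \<le> l'" using sl REL_start cons_iff[of s' l'] by (auto intro: consequence.axiom)
    then show ?thesis using kup_funpow[OF s, of p] that l by simp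
  qed
  then have "rel_mat (\<lambda>p. p + l') (bas N s l ((nxt N ^^ l') s')) (bas N s l s') =
     (0\<^sub>m (length (bas N s l ((nxt N ^^ l') s'))) (length (bas N s l s')) :: 'a mat)"
    by (intro rel_mat_zero) (auto simp: not_less)
  then show "path_mat N (uni N s l) s' l' =
     (0\<^sub>m (dm (uni N s l :: 'a rep) ((nxt N ^^ l') s')) (dm (uni N s l :: 'a rep) s') :: 'a mat)"
    by (simp add: path_mat_uni)
qed

text \<open>A longest nonzero path \<open>s \<rightarrow> t\<close> on \<open>V\<close> with \<open>l - 1\<close> arrows and nonzero entry \<open>(a, b)\<close> splits off a
  uniserial summand: the \<open>b\<close>-th basis vector at \<open>s\<close> generates it, the \<open>a\<close>-th coordinate at \<open>t\<close> gives a
  morphism back, and the composite is triangular with nonzero diagonal.\<close>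

lemma uniserial_summand:
  assumes V: "V \<in> modules N REL" and nz: "\<not> zero_rep N V"
  shows "\<exists>s l W. s \<in> {1..N} \<and> 1 \<le> l \<and> l \<le> kup s \<and> W \<in> modules N REL \<and> rep_iso N V (dsum (uni N s l) W)"
proof -
  have rV: "is_rep N V" by (rule modules_is_rep[OF V])
  define Q where "Q m \<longleftrightarrow> (\<exists>s\<in>{1..N}. path_mat N V s m \<noteq> 0\<^sub>m (dm V ((nxt N ^^ m) s)) (dm V s))" for m
  have "Q 0"
  proof -
    obtain i where i: "i \<in> {1..N}" "dm V i \<noteq> 0" using nz by (auto simp: zero_rep_def)
    have "(1\<^sub>m (dm V i) :: 'a mat) \<noteq> 0\<^sub>m (dm V i) (dm V i)"
    proof
      assume "(1\<^sub>m (dm V i) :: 'a mat) = 0\<^sub>m (dm V i) (dm V i)"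
      from arg_cong[OF this, of "\<lambda>A. A $$ (0, 0)"] i show False by simp
    qed
    then show ?thesis unfolding Q_def using i by (intro bexI[of _ i]) simp_all
  qed
  moreover have "m \<le> Max (kup ` {1..N})" if "Q m" for m
  proof -
    from that obtain s where s: "s \<in> {1..N}" "\<not> kup s \<le> m" unfolding Q_def using path_zero[OF V] by blast
    then have "kup s \<le> Max (kup ` {1..N})" by (intro Max_ge) auto
    then show ?thesis using s by linarith
  qed
  ultimately obtain m where Qm: "Q m" and max: "\<And>n. Q n \<Longrightarrow> n \<le> m"
    using GreatestI_ex_nat[of Q] Greatest_le_nat[of Q] by metis
  from Qm obtain s where s: "s \<in> {1..N}" and ne: "path_mat N V s m \<noteq> 0\<^sub>m (dm V ((nxt N ^^ m) s)) (dm V s)"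
    unfolding Q_def by blast
  define l t where "l = Suc m" and "t = (nxt N ^^ m) s"
  have l: "1 \<le> l" "l \<le> kup s" using path_zero[OF V s, of m] ne by (auto simp: l_def not_le)
  have t: "t \<in> {1..N}" using s by (simp add: t_def)
  have long: "path_mat N V i k = 0\<^sub>m (dm V ((nxt N ^^ k) i)) (dm V i)" if "i \<in> {1..N}" "l \<le> k" for i k
    using max[of k] that unfolding Q_def l_def by fastforce
  note dp = path_mat_dims[OF rV]
  obtain a b where a: "a < dm V t" and b: "b < dm V s" and ab: "path_mat N V s m $$ (a, b) \<noteq> 0"
    using ne eq_matI[of "path_mat N V s m" "0\<^sub>m (dm V t) (dm V s)"] dp[OF s] by (fastforce simp: t_def)
  define U where "U = (uni N s l :: 'a rep)"
  have U: "is_rep N U" by (simp add: U_def is_rep_uni)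
  define B where "B i = bas N s l i" for i
  have dU: "dm U i = length (B i)" "mp U i = rel_mat Suc (B (nxt N i)) (B i)" for i by (simp_all add: U_def B_def)
  define v where "v = (unit_vec (dm V s) b :: 'a vec)"
  define f where "f = gen N V s l v"
  have v: "v \<in> carrier_vec (dm V s)" by (simp add: v_def)
  have f: "f \<in> rep_hom N U V" unfolding f_def U_def
    by (rule gen_hom[OF rV s v]) (simp add: long s v zero_mult_vec)
  \<comment> \<open>A vector at \<open>i\<close> is transported along the \<open>m - p\<close>
    arrows that remain from position \<open>p\<close> to the end, and its coordinate
    \<open>a\<close> at \<open>t\<close> becomes the coefficient of the basis vector number
    \<open>p\<close>.\<close>
  define g where "g i = mat (length (B i)) (dm V i) (\<lambda>(r, c). path_mat N V i (m - B i ! r) $$ (a, c))" for i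
  have Bnth: "B i ! r < l \<and> (nxt N ^^ (B i ! r)) s = i" if "r < length (B i)" for i r
    using nth_mem[OF that] by (simp add: B_def)
  have Bend: "(nxt N ^^ (m - B i ! r)) i = t" if "r < length (B i)" for i r
  proof -
    have "B i ! r \<le> m" using Bnth[OF that] by (simp add: l_def)
    then have "t = (nxt N ^^ (m - B i ! r)) ((nxt N ^^ (B i ! r)) s)"
      unfolding t_def funpow_nxt_add[symmetric] by simp
    then show ?thesis using Bnth[OF that] by simp
  qed
  have g: "g \<in> rep_hom N V U"
  proof (rule rep_homI)
    fix i assume i: "i \<in> {1..N}"
    let ?j = "nxt N i"
    show "g ?j * mp V i = mp U i * g i"
    proof (rule eq_matI)
      fix r c assume "r < dim_row (mp U i * g i)" "c < dim_col (mp U i * g i)"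
      then have r: "r < length (B ?j)" and c: "c < dm V i" by (simp_all add: dU g_def)
      define p where "p = B ?j ! r"
      have p: "p < l" "(nxt N ^^ p) s = ?j" using Bnth[OF r] by (simp_all add: p_def)
      then have "p \<le> m" by (simp add: l_def)
      have pt: "(nxt N ^^ (m - p)) ?j = t" using Bend[OF r] by (simp add: p_def)
      have L: "(g ?j * mp V i) $$ (r, c) = path_mat N V i (Suc (m - p)) $$ (a, c)"
      proof -
        have "(g ?j * mp V i) $$ (r, c) = (path_mat N V ?j (m - p) * mp V i) $$ (a, c)"
          using r c i a pt by (simp add: g_def is_repD[OF rV] dp scalar_prod_def p_def[symmetric])
        then show ?thesis using path_mat_Suc_start[OF rV i] by simp
      qed
      have R: "(mp U i * g i) $$ (r, c) =
          (\<Sum>k = 0..<length (B i). (if p = Suc (B i ! k) then 1 else 0) * path_mat N V i (m - B i ! k) $$ (a, c))"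
        using r c by (simp add: dU g_def rel_mat_def scalar_prod_def p_def)
      show "(g ?j * mp V i) $$ (r, c) = (mp U i * g i) $$ (r, c)"
      proof (cases p)
        case 0
        \<comment> \<open>No arrow of the uniserial ends at the generator; correspondingly, the path
          involved on \<open>V\<close> has \<open>m + 1\<close> arrows and vanishes by the
          maximality of \<open>m\<close>.\<close>
        have "(g ?j * mp V i) $$ (r, c) = 0"
          using long[OF i, of "Suc m"] a c pt by (simp only: L) (simp add: 0 l_def t_def funpow_swap1)
        then show ?thesis unfolding R by (simp add: 0)
      next
        case (Suc q)
        have "nxt N ((nxt N ^^ q) s) = nxt N i" using p Suc by simp
        then have "(nxt N ^^ q) s = i" using nxt_inj[OF _ i] s by simp
        then have "q \<in> set (B i)" using p Suc by (simp add: B_def)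
        then obtain k0 where k0: "k0 < length (B i)" "B i ! k0 = q" by (auto simp: in_set_conv_nth)
        have "(mp U i * g i) $$ (r, c) =
            (\<Sum>k = 0..<length (B i). (if k = k0 then 1 else 0) * path_mat N V i (m - B i ! k) $$ (a, c))"
          unfolding R Suc
        proof (rule sum.cong)
          fix k assume "k \<in> {0..<length (B i)}"
          then have "q = B i ! k \<longleftrightarrow> k = k0"
            using k0 nth_eq_iff_index_eq[of "B i" k k0] by (auto simp: B_def atLeastLessThan_iff)
          then show "(if Suc q = Suc (B i ! k) then 1 else 0) * path_mat N V i (m - B i ! k) $$ (a, c) =
            (if k = k0 then 1 else 0) * path_mat N V i (m - B i ! k) $$ (a, c)" by simp
        qed simp
        also have "\<dots> = path_mat N V i (m - q) $$ (a, c)" using k0 by (simp only: sum_if_mult_left) simp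
        also have "m - q = Suc (m - p)" using Suc \<open>p \<le> m\<close> by simp
        finally show ?thesis using L by simp
      qed
    qed (use i in \<open>simp_all add: dU g_def is_repD[OF rV]\<close>)
  qed (simp_all add: dU g_def)
  note dfg = rep_homD(1,2)[OF f] rep_homD(1,2)[OF g]
  define T where "T i = g i * f i" for i
  have T: "T \<in> rep_hom N U U" unfolding T_def by (rule rep_hom_comp[OF U rV U f g])
  \<comment> \<open>The path has \<open>m\<close> arrows on the diagonal and more than
    \<open>m\<close> above it, where it vanishes by maximality; this is the source of
    triangularity.\<close>
  have Tent: "T i $$ (r, c) = path_mat N V s (B i ! c + (m - B i ! r)) $$ (a, b)"
    if i: "i \<in> {1..N}" and r: "r < length (B i)" and c: "c < length (B i)" for i r c
  proof -
    have ci: "(nxt N ^^ (B i ! c)) s = i" using Bnth[OF c] by simp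
    have "col (f i) c = path_mat N V s (B i ! c) *\<^sub>v v"
      unfolding f_def B_def by (rule col_gen[OF rV s]) (use c in \<open>simp add: B_def\<close>)
    also have "\<dots> = col (path_mat N V s (B i ! c)) b"
      using mult_unit_vec_eq_col[of b "path_mat N V s (B i ! c)"] b s by (simp add: v_def dp)
    finally have fc: "col (f i) c = col (path_mat N V s (B i ! c)) b" .
    have gr: "row (g i) r = row (path_mat N V i (m - B i ! r)) a"
      using r i a Bend[OF r] by (intro eq_vecI) (simp_all add: g_def dp)
    have "T i $$ (r, c) = row (g i) r \<bullet> col (f i) c"
      unfolding T_def using i r c dfg[OF i] by (simp add: dU)
    also have "\<dots> = (path_mat N V i (m - B i ! r) * path_mat N V s (B i ! c)) $$ (a, b)"
      unfolding fc gr using i s a b Bend[OF r] by (simp add: dp)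
    also have "\<dots> = path_mat N V s (B i ! c + (m - B i ! r)) $$ (a, b)"
      unfolding path_mat_add[OF rV s] ci ..
    finally show ?thesis .
  qed
  have Tinv: "\<exists>S\<in>carrier_mat (dm U i) (dm U i). S * T i = 1\<^sub>m (dm U i) \<and> T i * S = 1\<^sub>m (dm U i)"
    if i: "i \<in> {1..N}" for i
  proof -
    let ?n = "length (B i)"
    have Tc: "T i \<in> carrier_mat ?n ?n" using rep_homD(1,2)[OF T i] by (auto simp: dU)
    have sorted: "B i ! r < B i ! c" if "r < c" "c < ?n" for r c
      using sorted_bas[of N s l i] that by (simp add: B_def sorted_wrt_iff_nth_less)
    have up: "T i $$ (r, c) = 0" if "r < c" "c < ?n" for r c
    proof -
      have r: "r < ?n" using that by simp
      have ge: "l \<le> B i ! c + (m - B i ! r)" using sorted[OF that] Bnth[OF that(2)] by (simp add: l_def)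
      have "(nxt N ^^ (B i ! c + (m - B i ! r))) s = t"
        using Bnth[OF that(2)] Bend[OF r] by (simp add: funpow_nxt_add)
      then show ?thesis using Tent[OF i r that(2)] long[OF s ge] a b by simp
    qed
    have dg: "T i $$ (r, r) \<noteq> 0" if r: "r < ?n" for r
      using Tent[OF i r r] Bnth[OF r] ab by (simp add: l_def)
    have "det (T i) = prod_list (diag_mat (T i))" by (rule det_lower_triangular[OF up Tc]) auto
    also have "\<dots> \<noteq> 0" using dg Tc by (auto simp: prod_list_zero_iff diag_mat_def)
    finally have "T i \<in> Units (ring_mat TYPE('a) ?n ())" by (rule det_non_zero_imp_unit[OF Tc])
    then show ?thesis unfolding Units_def ring_mat_def by (auto simp: dU)
  qed
  then obtain S where S: "\<And>i. i \<in> {1..N} \<Longrightarrow> S i \<in> carrier_mat (dm U i) (dm U i)"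
    and ST: "\<And>i. i \<in> {1..N} \<Longrightarrow> S i * T i = 1\<^sub>m (dm U i)" "\<And>i. i \<in> {1..N} \<Longrightarrow> T i * S i = 1\<^sub>m (dm U i)"
    by metis
  have dS: "dim_row (S i) = dm U i" "dim_col (S i) = dm U i" if "i \<in> {1..N}" for i using S[OF that] by auto
  note d = dfg dS
  \<comment> \<open>\<open>S\<close> inverts \<open>T = g f\<close>, so \<open>S g\<close> is a left
    inverse of \<open>f\<close>, as required for splitting.\<close>
  have Shom: "S \<in> rep_hom N U U" by (rule inverse_hom[OF U U T S ST])
  have "\<exists>W\<in>modules N REL. rep_iso N V (dsum U W)"
  proof (rule split_off_summand[OF V U f rep_hom_comp[OF rV U U g Shom] _ REL_start])
    fix i assume i: "i \<in> {1..N}"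
    have "S i * g i * f i = S i * T i" unfolding T_def using i by (simp add: d mat_algebra)
    then show "S i * g i * f i = 1\<^sub>m (dm U i)" using ST i by simp
  qed
  then show ?thesis using s l U_def by blast
qed

section \<open>Decomposition of modules into uniserials\<close>

definition All :: "(nat \<times> nat) set" where
  "All = {(s, l). s \<in> {1..N} \<and> 1 \<le> l \<and> l \<le> kup s}"

lemma finite_All: "finite All"
proof (rule finite_subset)
  show "All \<subseteq> (SIGMA s : {1..N}. {..kup s})" by (auto simp: All_def)
qed auto

abbreviation un :: "nat \<times> nat \<Rightarrow> 'k::field rep" where
  "un x \<equiv> uni N (fst x) (snd x)"

lemma un_modules: "x \<in> All \<Longrightarrow> un x \<in> modules N REL"
  by (auto simp: All_def intro: uni_modules)

primrec dsl :: "(nat \<times> nat) list \<Rightarrow> 'k::field rep" where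
  "dsl [] = null_rep"
| "dsl (x # xs) = dsum (un x) (dsl xs)"

lemma null_rep_modules: "null_rep \<in> modules N REL"
  by (rule zero_rep_modules[OF is_rep_null _ REL_start]) (simp add: zero_rep_def)

lemma dsum_modules: "V \<in> modules N REL \<Longrightarrow> W \<in> modules N REL \<Longrightarrow> dsum V W \<in> modules N REL"
  by (rule modules_dsum[OF _ _ REL_start])

lemma dsl_modules: "set xs \<subseteq> All \<Longrightarrow> dsl xs \<in> modules N REL"
  by (induction xs) (auto simp: null_rep_modules dsum_modules un_modules)

lemma is_rep_dsl: "is_rep N (dsl xs)"
  by (induction xs) (auto simp: is_rep_null is_rep_dsum is_rep_uni)

text \<open>Induction on the total dimension, which drops because the uniserial that is split off
  has its generator at \<open>s\<close>.\<close>

theorem decomposition: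
  assumes "V \<in> modules N REL"
  shows "\<exists>xs. set xs \<subseteq> All \<and> rep_iso N V (dsl xs)"
  using assms
proof (induction "\<Sum>i\<in>{1..N}. dm V i" arbitrary: V rule: less_induct)
  case less
  show ?case
  proof (cases "zero_rep N V")
    case True
    then have "rep_iso N V (dsl [])"
      using less.prems by (auto intro!: rep_iso_zero simp: modules_is_rep is_rep_null zero_rep_def)
    then show ?thesis by (intro exI[of _ "[]"]) simp
  next
    case False
    then obtain s l W where sl: "s \<in> {1..N}" "1 \<le> l" "l \<le> kup s" and W: "W \<in> modules N REL"
      and iso: "rep_iso N V (dsum (uni N s l) W)"
      using uniserial_summand[OF less.prems] by blast
    have dm: "dm V i = length (bas N s l i) + dm W i" if "i \<in> {1..N}" for i
      using rep_iso_dm[OF iso that] by simp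
    have "(\<Sum>i\<in>{1..N}. dm W i) < (\<Sum>i\<in>{1..N}. dm V i)"
    proof (rule sum_strict_mono_ex1)
      show "\<exists>i\<in>{1..N}. dm W i < dm V i"
        using sl(1) dm[OF sl(1)] bas_0[of l N s] sl(2) by (intro bexI[of _ s]) auto
    qed (auto simp: dm)
    then obtain xs where xs: "set xs \<subseteq> All" "rep_iso N W (dsl xs)" using less.hyps W by blast
    have r: "is_rep N V" "is_rep N W" using less.prems W modules_is_rep by blast+
    have "rep_iso N (dsum (uni N s l) W) (dsum (uni N s l) (dsl xs))"
      using r xs(2) by (intro rep_iso_dsum rep_iso_refl) (auto simp: is_rep_uni is_rep_dsl)
    then have "rep_iso N V (dsl ((s, l) # xs))"
      using rep_iso_trans[OF r(1) _ _ iso] r by (simp add: is_rep_dsum is_rep_uni is_rep_dsl)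
    then show ?thesis using xs(1) sl by (intro exI[of _ "(s, l) # xs"]) (auto simp: All_def)
  qed
qed

end

subsection \<open>Multiplicities of uniserial summands\<close>

definition prv :: "nat \<Rightarrow> nat \<Rightarrow> nat" where
  "prv N s = (if s = 1 then N else s - 1)"

lemma prv_in: "s \<in> {1..N} \<Longrightarrow> prv N s \<in> {1..N}"
  by (auto simp: prv_def atLeastAtMost_iff)

lemma nxt_eq_iff: "s \<in> {1..N} \<Longrightarrow> i \<in> {1..N} \<Longrightarrow> nxt N i = s \<longleftrightarrow> i = prv N s"
  by (auto simp: prv_def nxt_def atLeastAtMost_iff)

text \<open>For a direct sum of uniserials, \<open>rk (path_mat N V s l) - rk (path_mat N V s (Suc l))\<close> counts the
  summands with the socle \<open>(nxt N ^^ l) s\<close> and length greater than \<open>l\<close>.\<close>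

definition mult :: "nat \<Rightarrow> 'k::field rep \<Rightarrow> nat \<times> nat \<Rightarrow> int" where
  "mult N V = (\<lambda>(s, l). int (rk (path_mat N V s (l - 1))) - int (rk (path_mat N V s l))
     - (int (rk (path_mat N V (prv N s) l)) - int (rk (path_mat N V (prv N s) (Suc l)))))"

lemma mult_dsum:
  assumes "is_rep N V" "is_rep N W" "fst x \<in> {1..N}"
  shows "mult N (dsum V W) x = mult N V x + mult N W x"
  using assms by (cases x) (simp add: mult_def path_mat_dsum rk_diag prv_in del: path_mat.simps)

lemma mult_iso:
  assumes "rep_iso N V W" "is_rep N V" "is_rep N W" "fst x \<in> {1..N}"
  shows "mult N V x = mult N W x"
  using assms by (cases x) (simp add: mult_def rep_iso_rk_path[OF assms(1-3)] prv_in del: path_mat.simps)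

lemma mult_null: "fst x \<in> {1..N} \<Longrightarrow> mult N null_rep x = 0"
proof -
  assume x: "fst x \<in> {1..N}"
  have "rk (path_mat N null_rep s l :: 'a mat) = 0" if "s \<in> {1..N}" for s l
  proof (rule rk_eqI)
    show "has_rank (path_mat N null_rep s l :: 'a mat) 0"
      by (rule has_rankI[where X = "0\<^sub>m 0 0" and Y = "0\<^sub>m 0 0" and B = "0\<^sub>m 0 0" and C = "0\<^sub>m 0 0"])
        (auto simp: path_mat_dims[OF is_rep_null that] intro!: mat_eq_empty)
  qed
  then show ?thesis using x by (cases x) (simp add: mult_def prv_in del: path_mat.simps)
qed

text \<open>The two sets differ at most in \<open>b - Suc m\<close>, the last position from which
  \<open>m\<close> steps stay below \<open>b\<close>.\<close>

lemma card_shorten: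
  "int (card {p. p + m < b \<and> P p}) - int (card {p. p + Suc m < b \<and> P p}) =
     of_bool (Suc m \<le> b \<and> P (b - Suc m))" for b :: nat
proof -
  have fin: "finite {p. p + Suc m < b \<and> P p}" by (rule finite_subset[of _ "{..b}"]) auto
  show ?thesis
  proof (cases "Suc m \<le> b \<and> P (b - Suc m)")
    case True
    then have "{p. p + m < b \<and> P p} = insert (b - Suc m) {p. p + Suc m < b \<and> P p}"
      by (auto simp: le_Suc_eq less_Suc_eq_le)
    then show ?thesis using True fin by auto
  next
    case False
    have "p + m < b \<longleftrightarrow> p + Suc m < b" if "P p" for p
    proof -
      have "b \<noteq> p + Suc m" using False that by auto
      then show ?thesis by auto
    qed
    then have "{p. p + m < b \<and> P p} = {p. p + Suc m < b \<and> P p}" by blast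
    then show ?thesis using False by simp
  qed
qed

text \<open>The two differences test for the right socle together with \<open>b \<ge> l\<close> and
  with \<open>b \<ge> l + 1\<close>, respectively. They cancel except for \<open>b = l\<close>,
  where the socle condition reads \<open>a = s\<close>.\<close>

lemma mult_uni:
  assumes "s \<in> {1..N}" "1 \<le> l" "a \<in> {1..N}"
  shows "mult N (uni N a b) (s, l) = of_bool ((a, b) = (s, l))"
proof -
  obtain m where l: "l = Suc m" using assms(2) by (cases l) auto
  have "mult N (uni N a b) (s, l) = of_bool (Suc m \<le> b \<and> (nxt N ^^ (b - Suc m)) a = s)
    - of_bool (Suc l \<le> b \<and> (nxt N ^^ (b - Suc l)) a = prv N s)"
    unfolding mult_def rk_path_uni split by (simp only: l diff_Suc_1 card_shorten)
  also have "\<dots> = of_bool ((a, b) = (s, l))"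
  proof (cases "Suc l \<le> b")
    case True
    then have "b - Suc m = Suc (b - Suc l)" by (simp add: l)
    then have "(nxt N ^^ (b - Suc m)) a = nxt N ((nxt N ^^ (b - Suc l)) a)" by simp
    then have "(nxt N ^^ (b - Suc m)) a = s \<longleftrightarrow> (nxt N ^^ (b - Suc l)) a = prv N s"
      using nxt_eq_iff[OF assms(1)] assms(3) by simp
    then show ?thesis using True by (auto simp: l)
  next
    case False
    then show ?thesis by (cases "b = l") (auto simp: l)
  qed
  finally show ?thesis .
qed

context nakayama begin

lemma mult_un: "x \<in> All \<Longrightarrow> y \<in> All \<Longrightarrow> mult N (un y) x = of_bool (x = y)"
  by (cases x; cases y) (auto simp: All_def mult_uni)

lemma mult_dsl: "set xs \<subseteq> All \<Longrightarrow> x \<in> All \<Longrightarrow> mult N (dsl xs) x = int (count_list xs x)"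
proof (induction xs)
  case Nil
  then show ?case by (auto simp: mult_null All_def)
next
  case (Cons y xs)
  moreover have "fst x \<in> {1..N}" using Cons.prems by (auto simp: All_def)
  ultimately show ?case by (simp add: mult_dsum is_rep_uni is_rep_dsl mult_un)
qed

lemma sum_mult:
  fixes V :: "'k::field rep"
  assumes xs: "set xs \<subseteq> All" "rep_iso N V (dsl xs)" "is_rep N V"
  shows "(\<Sum>x\<in>All. mult N V x) = int (length xs)"
proof -
  have "(\<Sum>x\<in>All. mult N V x) = (\<Sum>x\<in>All. int (count_list xs x))"
  proof (rule sum.cong)
    fix x assume x: "x \<in> All"
    then have "fst x \<in> {1..N}" by (auto simp: All_def)
    then have "mult N V x = mult N (dsl xs :: 'k rep) x" by (intro mult_iso xs is_rep_dsl)
    then show "mult N V x = int (count_list xs x)" by (simp add: mult_dsl xs x)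
  qed simp
  also have "\<dots> = int (\<Sum>x\<in>All. count_list xs x)" by simp
  also have "(\<Sum>x\<in>All. count_list xs x) = (\<Sum>x\<in>set xs. count_list xs x)"
    by (rule sum.mono_neutral_right) (use xs finite_All in \<open>auto simp: count_list_0_iff\<close>)
  finally show ?thesis by (simp add: sum_count_set)
qed

text \<open>Endomorphism rings are avoided: the sum of all multiplicities is additive and equals 1
  for a uniserial, so one of the two decompositions is empty.\<close>

lemma uni_indecomposable:
  assumes "x \<in> All"
  shows "indecomposable N REL (un x :: 'k::field rep)"
  unfolding indecomposable_def
proof (intro conjI ballI impI)
  show "un x \<in> modules N REL" by (rule un_modules[OF assms])
  show "\<not> zero_rep N (un x :: 'k rep)"
    using assms bas_0[of "snd x" N "fst x"] by (auto simp: zero_rep_def All_def)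
  fix A B :: "'k rep" assume A: "A \<in> modules N REL" and B: "B \<in> modules N REL" and iso: "rep_iso N (un x) (dsum A B)"
  obtain as where as: "set as \<subseteq> All" "rep_iso N A (dsl as)" using decomposition[OF A] by blast
  obtain bs where bs: "set bs \<subseteq> All" "rep_iso N B (dsl bs)" using decomposition[OF B] by blast
  have r: "is_rep N A" "is_rep N B" using A B modules_is_rep by blast+
  have "int (length as) + int (length bs) = (\<Sum>y\<in>All. mult N A y + mult N B y)"
    using sum_mult[OF as r(1)] sum_mult[OF bs r(2)] by (simp add: sum.distrib)
  also have "\<dots> = (\<Sum>y\<in>All. mult N (un x :: 'k rep) y)"
  proof (rule sum.cong)
    fix y assume "y \<in> All"
    then have "fst y \<in> {1..N}" by (auto simp: All_def)
    then show "mult N A y + mult N B y = mult N (un x :: 'k rep) y"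
      using mult_iso[OF iso is_rep_uni is_rep_dsum[OF r]] mult_dsum[OF r] by simp
  qed simp
  also have "\<dots> = 1" using assms finite_All by (simp add: mult_un)
  finally have "length as = 0 \<or> length bs = 0" by arith
  then have "as = [] \<or> bs = []" by simp
  moreover have "zero_rep N C" if "rep_iso N C (dsl [])" for C :: "'k rep"
    using rep_iso_dm[OF that] by (simp add: zero_rep_def)
  ultimately show "zero_rep N A \<or> zero_rep N B" using as(2) bs(2) by auto
qed

end

section \<open>Projective modules\<close>

lemma rep_epi_cong:
  assumes "\<And>i. i \<in> {1..N} \<Longrightarrow> f i = g i"
  shows "rep_epi N V W f \<longleftrightarrow> rep_epi N V W g"
  using assms unfolding rep_epi_def rep_hom_def im_at_def by auto

text \<open>Here and in the next lemmas, conditions on vectors are traded for one-sided inverse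
  matrices, with which later proofs can calculate.\<close>

lemma epi_right_inverse:
  assumes "rep_epi N V W f" "i \<in> {1..N}"
  shows "\<exists>R\<in>carrier_mat (dm V i) (dm W i). f i * R = 1\<^sub>m (dm W i)"
proof -
  have f: "f \<in> rep_hom N V W" and im: "im_at V f i = carrier_vec (dm W i)"
    using assms by (auto simp: rep_epi_def)
  note d = rep_homD(1,2)[OF f assms(2)]
  have "\<exists>Y\<in>carrier_mat (dim_col (f i)) (dim_col (1\<^sub>m (dm W i) :: 'a mat)). f i * Y = 1\<^sub>m (dm W i)"
  proof (rule factor_through_columns)
    fix v :: "'a vec" assume "v \<in> carrier_vec (dim_col (1\<^sub>m (dm W i) :: 'a mat))"
    then have v: "v \<in> im_at V f i" by (simp add: im)
    then obtain w where "w \<in> carrier_vec (dm V i)" "v = f i *\<^sub>v w" by (auto simp: im_at_def)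
    then show "\<exists>w\<in>carrier_vec (dim_col (f i)). f i *\<^sub>v w = 1\<^sub>m (dm W i) *\<^sub>v v"
      using v im by (auto simp: d)
  qed (simp add: d)
  then show ?thesis by (simp add: d)
qed

lemma rep_epiI:
  assumes f: "f \<in> rep_hom N V W"
    and "\<And>i. i \<in> {1..N} \<Longrightarrow> \<exists>R\<in>carrier_mat (dm V i) (dm W i). f i * R = 1\<^sub>m (dm W i)"
  shows "rep_epi N V W f"
  unfolding rep_epi_def
proof (intro conjI ballI f)
  fix i assume i: "i \<in> {1..N}"
  note d = rep_homD(1,2)[OF f i]
  obtain R where R: "R \<in> carrier_mat (dm V i) (dm W i)" "f i * R = 1\<^sub>m (dm W i)" using assms(2)[OF i] by blast
  show "im_at V f i = carrier_vec (dm W i)"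
  proof (intro equalityI subsetI)
    fix v assume "v \<in> im_at V f i"
    then show "v \<in> carrier_vec (dm W i)" by (auto simp: im_at_def d intro: mult_vec_carrier_dim)
  next
    fix v :: "'a vec" assume v: "v \<in> carrier_vec (dm W i)"
    have "v = (f i * R) *\<^sub>v v" using v by (simp add: R)
    also have "\<dots> = f i *\<^sub>v (R *\<^sub>v v)" by (rule mult_vec_assoc_dim) (use R v d in auto)
    finally show "v \<in> im_at V f i" using R(1) unfolding im_at_def by (auto intro!: exI[of _ "R *\<^sub>v v"] mult_vec_carrier_dim)
  qed
qed

lemma mono_left_inverse:
  assumes "rep_mono N V W f" "i \<in> {1..N}"
  shows "\<exists>R\<in>carrier_mat (dm V i) (dm W i). R * f i = 1\<^sub>m (dm V i)"
proof -
  have f: "f \<in> rep_hom N V W" and ker: "ker_at V W f i = {0\<^sub>v (dm V i)}"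
    using assms by (auto simp: rep_mono_def)
  note d = rep_homD(1,2)[OF f assms(2)]
  show ?thesis using left_inverse_of_injective[of "f i"] ker by (simp add: d ker_at_def)
qed

lemma rep_monoI:
  assumes f: "f \<in> rep_hom N V W"
    and "\<And>i. i \<in> {1..N} \<Longrightarrow> \<exists>R\<in>carrier_mat (dm V i) (dm W i). R * f i = 1\<^sub>m (dm V i)"
  shows "rep_mono N V W f"
  unfolding rep_mono_def
proof (intro conjI ballI f)
  fix i assume i: "i \<in> {1..N}"
  note d = rep_homD(1,2)[OF f i]
  obtain R where R: "R \<in> carrier_mat (dm V i) (dm W i)" "R * f i = 1\<^sub>m (dm V i)" using assms(2)[OF i] by blast
  show "ker_at V W f i = {0\<^sub>v (dm V i)}"
  proof (intro equalityI subsetI)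
    fix v assume "v \<in> ker_at V W f i"
    then have v: "v \<in> carrier_vec (dm V i)" "f i *\<^sub>v v = 0\<^sub>v (dm W i)" by (auto simp: ker_at_def)
    have "v = (R * f i) *\<^sub>v v" using v by (simp add: R)
    also have "\<dots> = R *\<^sub>v (f i *\<^sub>v v)" by (rule mult_vec_assoc_dim) (use R v d in auto)
    also have "\<dots> = 0\<^sub>v (dm V i)" unfolding v(2) by (rule mult_zero_vec) (use R in auto)
    finally show "v \<in> {0\<^sub>v (dm V i)}" by simp
  qed (auto simp: ker_at_def d intro!: mult_zero_vec)
qed

lemma zero_rep_projective:
  assumes "V \<in> modules N REL" "zero_rep N V"
  shows "projective N REL V"
  unfolding projective_def
proof (intro conjI ballI allI impI assms(1))
  fix X Y g f
  assume X: "X \<in> modules N REL" and Y: "Y \<in> modules N REL" and g: "rep_epi N X Y g" and f: "f \<in> rep_hom N V Y"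
  have g': "g \<in> rep_hom N X Y" using g by (simp add: rep_epi_def)
  show "\<exists>h\<in>rep_hom N V X. \<forall>i\<in>{1..N}. comp_mor g h i = f i"
  proof (intro bexI[OF _ zero_hom] ballI)
    fix i assume i: "i \<in> {1..N}"
    show "comp_mor g (\<lambda>i. 0\<^sub>m (dm X i) (dm V i)) i = f i" unfolding comp_mor_def
      by (rule mat_eq_empty) (use i assms(2) rep_homD[OF f i] rep_homD[OF g' i] in \<open>auto simp: zero_rep_def\<close>)
  qed (use assms X modules_is_rep in blast)+
qed

text \<open>A lift of \<open>u g\<close> along the epimorphism, restricted along \<open>f\<close>,
  is a lift of \<open>u g f = u\<close>.\<close>

lemma projective_retract:
  assumes P: "projective N REL P" and A: "A \<in> modules N REL"
    and f: "f \<in> rep_hom N A P" and g: "g \<in> rep_hom N P A"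
    and gf: "\<And>i. i \<in> {1..N} \<Longrightarrow> g i * f i = 1\<^sub>m (dm A i)"
  shows "projective N REL A"
  unfolding projective_def
proof (intro conjI ballI allI impI A)
  fix X Y e u
  assume X: "X \<in> modules N REL" and Y: "Y \<in> modules N REL" and e: "rep_epi N X Y e" and u: "u \<in> rep_hom N A Y"
  have P': "P \<in> modules N REL" using P by (simp add: projective_def)
  note r = modules_is_rep[OF P'] modules_is_rep[OF A] modules_is_rep[OF X] modules_is_rep[OF Y]
  have e': "e \<in> rep_hom N X Y" using e by (simp add: rep_epi_def)
  obtain h where h: "h \<in> rep_hom N P X" and eh: "\<And>i. i \<in> {1..N} \<Longrightarrow> e i * h i = u i * g i"
    using P X Y e rep_hom_comp[OF r(1,2,4) g u] unfolding projective_def comp_mor_def by blast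
  note d = rep_homD(1,2)[OF f] rep_homD(1,2)[OF g] rep_homD(1,2)[OF e'] rep_homD(1,2)[OF h] rep_homD(1,2)[OF u]
  show "\<exists>h\<in>rep_hom N A X. \<forall>i\<in>{1..N}. comp_mor e h i = u i"
  proof (intro bexI[OF _ rep_hom_comp[OF r(2,1,3) f h]] ballI)
    fix i assume i: "i \<in> {1..N}"
    have "e i * (h i * f i) = e i * h i * f i" using i by (simp add: d mat_algebra)
    also have "\<dots> = u i" unfolding eh[OF i] using i gf[OF i] by (simp add: d mat_algebra)
    finally show "comp_mor e (\<lambda>i. h i * f i) i = u i" by (simp add: comp_mor_def)
  qed
qed

lemma projective_iso:
  assumes "projective N REL P" "rep_iso N A P" "A \<in> modules N REL"
  shows "projective N REL A"
proof -
  obtain f g where "f \<in> rep_hom N A P" "g \<in> rep_hom N P A" "\<And>i. i \<in> {1..N} \<Longrightarrow> g i * f i = 1\<^sub>m (dm A i)"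
    using assms(2) unfolding rep_iso_def by blast
  then show ?thesis by (rule projective_retract[OF assms(1,3)])
qed

lemma projective_dsumD:
  assumes P: "projective N REL (dsum A B)" and A: "A \<in> modules N REL" and B: "B \<in> modules N REL"
  shows "projective N REL A" "projective N REL B"
proof -
  note h = dsum_hom[OF modules_is_rep[OF A] modules_is_rep[OF B]]
  show "projective N REL A" by (rule projective_retract[OF P A h(1,3)]) (rule biproduct)
  show "projective N REL B" by (rule projective_retract[OF P B h(2,4)]) (rule biproduct)
qed

lemma projective_dsum:
  assumes A: "projective N REL A" and B: "projective N REL B" and AB: "dsum A B \<in> modules N REL"
  shows "projective N REL (dsum A B)"
  unfolding projective_def
proof (intro conjI ballI allI impI AB)
  fix X Y e u
  assume X: "X \<in> modules N REL" and Y: "Y \<in> modules N REL" and e: "rep_epi N X Y e" and u: "u \<in> rep_hom N (dsum A B) Y"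
  have e': "e \<in> rep_hom N X Y" using e by (simp add: rep_epi_def)
  have rA: "is_rep N A" and rB: "is_rep N B" using A B modules_is_rep by (auto simp: projective_def)
  note r = modules_is_rep[OF X] modules_is_rep[OF Y] is_rep_dsum[OF rA rB]
  obtain h where h: "h \<in> rep_hom N A X" and eh: "\<And>i. i \<in> {1..N} \<Longrightarrow> e i * h i = u i * inl (dm A i) (dm B i)"
    using A X Y e rep_hom_comp[OF rA r(3,2) dsum_hom(1)[OF rA rB] u] unfolding projective_def comp_mor_def by blast
  obtain k where k: "k \<in> rep_hom N B X" and ek: "\<And>i. i \<in> {1..N} \<Longrightarrow> e i * k i = u i * inr (dm A i) (dm B i)"
    using B X Y e rep_hom_comp[OF rB r(3,2) dsum_hom(2)[OF rA rB] u] unfolding projective_def comp_mor_def by blast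
  note d = rep_homD(1,2)[OF h] rep_homD(1,2)[OF k] rep_homD(1,2)[OF e'] rep_homD(1,2)[OF u, simplified]
    is_repD[OF rA] is_repD[OF rB] is_repD[OF r(1)]
  let ?w = "\<lambda>i. h i * prl (dm A i) (dm B i) + k i * prr (dm A i) (dm B i)"
  show "\<exists>h\<in>rep_hom N (dsum A B) X. \<forall>i\<in>{1..N}. comp_mor e h i = u i"
  proof (rule bexI[of _ ?w], rule ballI)
    fix i assume i: "i \<in> {1..N}"
    have "e i * ?w i = e i * h i * prl (dm A i) (dm B i) + e i * k i * prr (dm A i) (dm B i)"
      using i by (simp add: d mat_algebra)
    also have "\<dots> = u i * (inl (dm A i) (dm B i) * prl (dm A i) (dm B i) + inr (dm A i) (dm B i) * prr (dm A i) (dm B i))"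
      unfolding eh[OF i] ek[OF i] using i by (simp add: d mat_algebra)
    also have "\<dots> = u i" unfolding inl_prl_add_inr_prr using i by (simp add: d mat_algebra)
    finally show "comp_mor e ?w i = u i" by (simp add: comp_mor_def)
  next
    show "?w \<in> rep_hom N (dsum A B) X"
    proof (rule rep_homI)
      fix i assume i: "i \<in> {1..N}"
      let ?a = "dm A (nxt N i)" and ?b = "dm B (nxt N i)"
      have "?w (nxt N i) * mp (dsum A B) i =
          h (nxt N i) * (prl ?a ?b * diag (mp A i) (mp B i)) + k (nxt N i) * (prr ?a ?b * diag (mp A i) (mp B i))"
        using i by (simp add: d mat_algebra)
      also have "\<dots> = (h (nxt N i) * mp A i) * prl (dm A i) (dm B i) + (k (nxt N i) * mp B i) * prr (dm A i) (dm B i)"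
        using i by (simp add: prl_diag prr_diag d mat_algebra)
      also have "\<dots> = mp X i * ?w i"
        unfolding rep_homD(3)[OF h i] rep_homD(3)[OF k i] using i by (simp add: d mat_algebra)
      finally show "?w (nxt N i) * mp (dsum A B) i = mp X i * ?w i" .
    qed (simp_all add: d)
  qed
qed

context nakayama begin

text \<open>A morphism out of the uniserial is given by the image of its generator. Any preimage of
  this image is a legitimate new value, since paths of length \<open>kup s\<close> from
  \<open>s\<close> vanish on every module.\<close>

lemma uni_projective:
  assumes s: "s \<in> {1..N}"
  shows "projective N REL (uni N s (kup s))"
  unfolding projective_def
proof (intro conjI ballI allI impI)
  show "uni N s (kup s) \<in> modules N REL" by (rule uni_modules[OF s]) simp
  fix X Y :: "'a rep" and g f
  assume X: "X \<in> modules N REL" and Y: "Y \<in> modules N REL" and g: "rep_epi N X Y g"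
    and f: "f \<in> rep_hom N (uni N s (kup s)) Y"
  note r = modules_is_rep[OF X] modules_is_rep[OF Y]
  have g': "g \<in> rep_hom N X Y" and im: "im_at X g s = carrier_vec (dm Y s)"
    using g s by (auto simp: rep_epi_def)
  have l: "0 < kup s" using c_pos[OF s] by simp
  have "col (f s) 0 \<in> im_at X g s" using rep_homD[OF f s] by (auto simp: im intro: carrier_vecI)
  then obtain v where v: "v \<in> carrier_vec (dm X s)" "col (f s) 0 = g s *\<^sub>v v" by (auto simp: im_at_def)
  show "\<exists>h\<in>rep_hom N (uni N s (kup s)) X. \<forall>i\<in>{1..N}. comp_mor g h i = f i"
  proof (intro bexI[of _ "gen N X s (kup s) v"] ballI)
    show "gen N X s (kup s) v \<in> rep_hom N (uni N s (kup s)) X"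
      by (rule gen_hom[OF r(1) s v(1)]) (simp add: path_zero[OF X s] zero_mult_vec v)
    fix i assume i: "i \<in> {1..N}"
    have "g i * gen N X s (kup s) v i = gen N Y s (kup s) (col (f s) 0) i"
      unfolding v(2) by (rule gen_natural[OF r g' s v(1) i])
    also have "\<dots> = f i" by (rule gen_unique[OF r(2) s f l i, symmetric])
    finally show "comp_mor g (gen N X s (kup s) v) i = f i" by (simp add: comp_mor_def)
  qed
qed


end

section \<open>Syzygies\<close>

lemma exact_mult_zero:
  assumes "exact_seq N U V W f g" "i \<in> {1..N}"
  shows "g i * f i = 0\<^sub>m (dm W i) (dm U i)"
proof (rule eq_mat_by_vec)
  have f: "f \<in> rep_hom N U V" and g: "g \<in> rep_hom N V W" and im: "im_at U f i = ker_at V W g i"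
    using assms by (auto simp: exact_seq_def)
  note d = rep_homD(1,2)[OF f assms(2)] rep_homD(1,2)[OF g assms(2)]
  show "dim_row (g i * f i) = dim_row (0\<^sub>m (dm W i) (dm U i))" "dim_col (g i * f i) = dim_col (0\<^sub>m (dm W i) (dm U i))"
    by (simp_all add: d)
  fix v :: "'a vec" assume "v \<in> carrier_vec (dim_col (g i * f i))"
  then have v: "v \<in> carrier_vec (dm U i)" by (simp add: d)
  then have "f i *\<^sub>v v \<in> ker_at V W g i" unfolding im[symmetric] by (auto simp: im_at_def)
  then show "(g i * f i) *\<^sub>v v = 0\<^sub>m (dm W i) (dm U i) *\<^sub>v v"
    using v by (simp add: mult_vec_assoc_dim d ker_at_def zero_mult_vec)
qed

lemma exact_factor:
  assumes "exact_seq N U V W f g" "i \<in> {1..N}" and Z: "dim_row Z = dm V i" "g i * Z = 0\<^sub>m (dm W i) (dim_col Z)"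
  shows "\<exists>Y\<in>carrier_mat (dm U i) (dim_col Z). f i * Y = Z"
proof -
  have f: "f \<in> rep_hom N U V" and g: "g \<in> rep_hom N V W" and im: "im_at U f i = ker_at V W g i"
    using assms by (auto simp: exact_seq_def)
  note d = rep_homD(1,2)[OF f assms(2)] rep_homD(1,2)[OF g assms(2)]
  have "\<exists>Y\<in>carrier_mat (dim_col (f i)) (dim_col Z). f i * Y = Z"
  proof (rule factor_through_columns)
    fix v :: "'a vec" assume v: "v \<in> carrier_vec (dim_col Z)"
    have "g i *\<^sub>v (Z *\<^sub>v v) = (g i * Z) *\<^sub>v v"
      by (rule mult_vec_assoc_dim[symmetric, OF _ v]) (simp add: d Z(1))
    also have "\<dots> = 0\<^sub>v (dm W i)" unfolding Z(2) using v by (rule zero_mult_vec)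
    finally have "Z *\<^sub>v v \<in> im_at U f i"
      unfolding im ker_at_def using mult_vec_carrier_dim[OF Z(1)] by simp
    then show "\<exists>w\<in>carrier_vec (dim_col (f i)). f i *\<^sub>v w = Z *\<^sub>v v" by (auto simp: im_at_def d)
  qed (simp add: d Z)
  then show ?thesis by (simp add: d)
qed

text \<open>Projectivity gives maps \<open>h\<close> and \<open>k\<close> between the two covers,
  and essentiality makes both surjective. Comparing dimensions shows that \<open>h\<close> is
  bijective at each vertex; it then restricts to the kernels.\<close>

lemma syzygy_unique:
  assumes "is_syzygy N REL M K" "is_syzygy N REL M K'" "M \<in> modules N REL"
  shows "rep_iso N K K'"
proof -
  obtain P p j where cov: "projective_cover N REL P M p" and j: "rep_mono N K P j" and ex: "exact_seq N K P M j p"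
    and K: "K \<in> modules N REL" using assms(1) unfolding is_syzygy_def by blast
  obtain P' p' j' where cov': "projective_cover N REL P' M p'" and j': "rep_mono N K' P' j'" and ex': "exact_seq N K' P' M j' p'"
    and K': "K' \<in> modules N REL" using assms(2) unfolding is_syzygy_def by blast
  have P: "P \<in> modules N REL" "P' \<in> modules N REL" using cov cov' by (auto simp: projective_cover_def projective_def)
  have epi: "rep_epi N P M p" "rep_epi N P' M p'" using cov cov' by (auto simp: projective_cover_def)
  then have hp: "p \<in> rep_hom N P M" "p' \<in> rep_hom N P' M" by (auto simp: rep_epi_def)
  have hj: "j \<in> rep_hom N K P" "j' \<in> rep_hom N K' P'" using j j' by (auto simp: rep_mono_def)
  obtain h where h: "h \<in> rep_hom N P P'" and ph: "\<And>i. i \<in> {1..N} \<Longrightarrow> comp_mor p' h i = p i"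
    using cov epi hp P assms(3) unfolding projective_cover_def projective_def by meson
  obtain k where k: "k \<in> rep_hom N P' P" and pk: "\<And>i. i \<in> {1..N} \<Longrightarrow> comp_mor p k i = p' i"
    using cov' epi hp P assms(3) unfolding projective_cover_def projective_def by meson
  have "rep_epi N P M (comp_mor p' h)" using epi(1) rep_epi_cong[of N "comp_mor p' h" p, OF ph] by simp
  then have eh: "rep_epi N P P' h" using cov' P h unfolding projective_cover_def by blast
  have "rep_epi N P' M (comp_mor p k)" using epi(2) rep_epi_cong[of N "comp_mor p k" p', OF pk] by simp
  then have ek: "rep_epi N P' P k" using cov P k unfolding projective_cover_def by blast
  have "\<exists>H. i \<in> {1..N} \<longrightarrow> H \<in> carrier_mat (dm P i) (dm P' i) \<and> h i * H = 1\<^sub>m (dm P' i) \<and> H * h i = 1\<^sub>m (dm P i)" for i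
  proof (cases "i \<in> {1..N}")
    case i: True
    obtain H where H: "H \<in> carrier_mat (dm P i) (dm P' i)" "h i * H = 1\<^sub>m (dm P' i)"
      using epi_right_inverse[OF eh i] by blast
    obtain H' where H': "H' \<in> carrier_mat (dm P' i) (dm P i)" "k i * H' = 1\<^sub>m (dm P i)"
      using epi_right_inverse[OF ek i] by blast
    have hc: "h i \<in> carrier_mat (dm P' i) (dm P i)" "k i \<in> carrier_mat (dm P i) (dm P' i)"
      using h k i by (auto simp: rep_hom_def)
    have eq: "dm P i = dm P' i"
      using one_mat_factor_le[OF hc(1) H] one_mat_factor_le[OF hc(2) H'] by simp
    have "H * h i = 1\<^sub>m (dm P' i)"
      using mat_mult_left_right_inverse[OF _ _ H(2)] H(1) hc(1) unfolding eq by blast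
    then show ?thesis using H by (auto simp: eq)
  qed simp
  then obtain H where H: "\<And>i. i \<in> {1..N} \<Longrightarrow> H i \<in> carrier_mat (dm P i) (dm P' i)"
    and hH: "\<And>i. i \<in> {1..N} \<Longrightarrow> h i * H i = 1\<^sub>m (dm P' i)" and Hh: "\<And>i. i \<in> {1..N} \<Longrightarrow> H i * h i = 1\<^sub>m (dm P i)"
    by metis
  have dH: "dim_row (H i) = dm P i" "dim_col (H i) = dm P' i" if "i \<in> {1..N}" for i using H[OF that] by auto
  note r = modules_is_rep[OF P(1)] modules_is_rep[OF P(2)] modules_is_rep[OF K] modules_is_rep[OF K'] modules_is_rep[OF assms(3)]
  note d = rep_homD(1,2)[OF hp(1)] rep_homD(1,2)[OF hp(2)] rep_homD(1,2)[OF hj(1)] rep_homD(1,2)[OF hj(2)]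
    rep_homD(1,2)[OF h] dH is_repD[OF r(1)] is_repD[OF r(2)] is_repD[OF r(3)] is_repD[OF r(4)]
  have ph': "p' i * h i = p i" if "i \<in> {1..N}" for i using ph[OF that] by (simp add: comp_mor_def)
  have pH: "p i * H i = p' i" if i: "i \<in> {1..N}" for i
  proof -
    have "p i * H i = p' i * (h i * H i)" unfolding ph'[OF i, symmetric] using i by (simp add: d mat_algebra)
    then show ?thesis using i by (simp add: hH d mat_algebra)
  qed
  have "\<exists>G. i \<in> {1..N} \<longrightarrow> G \<in> carrier_mat (dm K' i) (dm K i) \<and> j' i * G = h i * j i" for i
  proof (cases "i \<in> {1..N}")
    case i: True
    have "p' i * (h i * j i) = p' i * h i * j i" using i by (simp add: d mat_algebra)
    then have "p' i * (h i * j i) = 0\<^sub>m (dm M i) (dim_col (h i * j i))"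
      using i exact_mult_zero[OF ex i] by (simp add: ph' d)
    then show ?thesis using exact_factor[OF ex' i, of "h i * j i"] i by (auto simp: d)
  qed simp
  then obtain G where G: "\<And>i. i \<in> {1..N} \<Longrightarrow> G i \<in> carrier_mat (dm K' i) (dm K i)"
    and jG: "\<And>i. i \<in> {1..N} \<Longrightarrow> j' i * G i = h i * j i" by metis
  have "\<exists>G. i \<in> {1..N} \<longrightarrow> G \<in> carrier_mat (dm K i) (dm K' i) \<and> j i * G = H i * j' i" for i
  proof (cases "i \<in> {1..N}")
    case i: True
    have "p i * (H i * j' i) = p i * H i * j' i" using i by (simp add: d mat_algebra)
    then have "p i * (H i * j' i) = 0\<^sub>m (dm M i) (dim_col (H i * j' i))"
      using i exact_mult_zero[OF ex' i] by (simp add: pH d)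
    then show ?thesis using exact_factor[OF ex i, of "H i * j' i"] i by (auto simp: d)
  qed simp
  then obtain G' where G': "\<And>i. i \<in> {1..N} \<Longrightarrow> G' i \<in> carrier_mat (dm K i) (dm K' i)"
    and jG': "\<And>i. i \<in> {1..N} \<Longrightarrow> j i * G' i = H i * j' i" by metis
  have dG: "dim_row (G i) = dm K' i" "dim_col (G i) = dm K i" "dim_row (G' i) = dm K i" "dim_col (G' i) = dm K' i"
    if "i \<in> {1..N}" for i using G[OF that] G'[OF that] by auto
  note d = d dG
  have cancel: "A = B" if i: "i \<in> {1..N}" and "j i * A = j i * B" "dim_row A = dm K i" "dim_row B = dm K i" for i A B
  proof -
    obtain R where R: "R \<in> carrier_mat (dm K i) (dm P i)" "R * j i = 1\<^sub>m (dm K i)"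
      using mono_left_inverse[OF j i] by blast
    have "R * j i * A = R * j i * B" using that R(1) by (simp add: d mat_algebra)
    then show ?thesis using that by (simp add: R(2) mat_algebra)
  qed
  have cancel': "A = B" if i: "i \<in> {1..N}" and "j' i * A = j' i * B" "dim_row A = dm K' i" "dim_row B = dm K' i" for i A B
  proof -
    obtain R where R: "R \<in> carrier_mat (dm K' i) (dm P' i)" "R * j' i = 1\<^sub>m (dm K' i)"
      using mono_left_inverse[OF j' i] by blast
    have "R * j' i * A = R * j' i * B" using that R(1) by (simp add: d mat_algebra)
    then show ?thesis using that by (simp add: R(2) mat_algebra)
  qed
  have GG: "G' i * G i = 1\<^sub>m (dm K i)" if i: "i \<in> {1..N}" for i
  proof (rule cancel[OF i])
    have "j i * (G' i * G i) = j i * G' i * G i" using i by (simp add: d mat_algebra)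
    also have "\<dots> = H i * (j' i * G i)" unfolding jG'[OF i] using i by (simp add: d mat_algebra)
    also have "\<dots> = H i * h i * j i" unfolding jG[OF i] using i by (simp add: d mat_algebra)
    finally show "j i * (G' i * G i) = j i * 1\<^sub>m (dm K i)" using i by (simp add: Hh d mat_algebra)
  qed (use i in \<open>simp_all add: d\<close>)
  have GG': "G i * G' i = 1\<^sub>m (dm K' i)" if i: "i \<in> {1..N}" for i
  proof (rule cancel'[OF i])
    have "j' i * (G i * G' i) = j' i * G i * G' i" using i by (simp add: d mat_algebra)
    also have "\<dots> = h i * (j i * G' i)" unfolding jG[OF i] using i by (simp add: d mat_algebra)
    also have "\<dots> = h i * H i * j' i" unfolding jG'[OF i] using i by (simp add: d mat_algebra)
    finally show "j' i * (G i * G' i) = j' i * 1\<^sub>m (dm K' i)" using i by (simp add: hH d mat_algebra)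
  qed (use i in \<open>simp_all add: d\<close>)
  have hG: "G \<in> rep_hom N K K'"
  proof (rule rep_homI)
    fix i assume i: "i \<in> {1..N}"
    then have n: "nxt N i \<in> {1..N}" by simp
    show "G (nxt N i) * mp K i = mp K' i * G i"
    proof (rule cancel'[OF n])
      have "j' (nxt N i) * (G (nxt N i) * mp K i) = h (nxt N i) * (j (nxt N i) * mp K i)"
        using i jG[OF n] by (simp add: d flip: mult_assoc_dim)
      also have "\<dots> = h (nxt N i) * mp P i * j i" unfolding rep_homD(3)[OF hj(1) i] using i by (simp add: d mat_algebra)
      also have "\<dots> = mp P' i * (h i * j i)" unfolding rep_homD(3)[OF h i] using i by (simp add: d mat_algebra)
      also have "\<dots> = mp P' i * j' i * G i" unfolding jG[OF i, symmetric] using i by (simp add: d mat_algebra)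
      also have "\<dots> = j' (nxt N i) * (mp K' i * G i)"
        unfolding rep_homD(3)[OF hj(2) i, symmetric] using i by (simp add: d mat_algebra)
      finally show "j' (nxt N i) * (G (nxt N i) * mp K i) = j' (nxt N i) * (mp K' i * G i)" .
    qed (use i in \<open>simp_all add: d\<close>)
  qed (simp_all add: d)
  \<comment> \<open>\<open>H\<close> is treated as a family of matrices only; \<open>G'\<close> is a
    morphism because it is the vertexwise inverse of the morphism \<open>G\<close>.\<close>
  have hG': "G' \<in> rep_hom N K' K" by (rule inverse_hom[OF r(3,4) hG G' GG GG'])
  show ?thesis unfolding rep_iso_def
    by (rule bexI[OF _ hG], rule bexI[OF _ hG']) (simp add: GG GG')
qed

text \<open>Syzygies with all conditions expressed by matrix equations: at every vertex, \<open>S\<close> and \<open>T\<close> split the sequence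
  \<open>K \<rightarrow> P \<rightarrow> M\<close> of vector spaces, and \<open>Z\<close> says that the image of \<open>K\<close> lies in the radical of \<open>P\<close>.\<close>

definition syzygy_data :: "nat \<Rightarrow> path list \<Rightarrow> 'k::field rep \<Rightarrow> 'k rep \<Rightarrow> 'k rep \<Rightarrow> 'k morphism \<Rightarrow> 'k morphism \<Rightarrow>
    'k morphism \<Rightarrow> 'k morphism \<Rightarrow> 'k morphism \<Rightarrow> bool" where
  "syzygy_data N REL M K P p j S T Z \<longleftrightarrow> M \<in> modules N REL \<and> K \<in> modules N REL \<and>
     projective N REL P \<and> p \<in> rep_hom N P M \<and> j \<in> rep_hom N K P \<and>
     (\<forall>i\<in>{1..N}. S i \<in> carrier_mat (dm K i) (dm P i) \<and> T i \<in> carrier_mat (dm P i) (dm M i) \<and>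
       Z i \<in> carrier_mat (dm P i) (dm K (nxt N i)) \<and>
       S i * j i = 1\<^sub>m (dm K i) \<and> p i * T i = 1\<^sub>m (dm M i) \<and> p i * j i = 0\<^sub>m (dm M i) (dm K i) \<and>
       j i * S i + T i * p i = 1\<^sub>m (dm P i) \<and> mp P i * Z i = j (nxt N i))"

text \<open>Matrix equations pass to direct sums block by block, which is less evident for essential
  epimorphisms. Minimality of the cover is thus recorded by a witness instead of a statement about
  all modules.\<close>

definition split_syzygy :: "nat \<Rightarrow> path list \<Rightarrow> 'k::field rep \<Rightarrow> 'k rep \<Rightarrow> bool" where
  "split_syzygy N REL M K \<longleftrightarrow> (\<exists>P p j S T Z. syzygy_data N REL M K P p j S T Z)"

lemma split_syzygyI:
  assumes "M \<in> modules N REL" "K \<in> modules N REL" "projective N REL P" "p \<in> rep_hom N P M" "j \<in> rep_hom N K P"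
    and "\<And>i. i \<in> {1..N} \<Longrightarrow> S i \<in> carrier_mat (dm K i) (dm P i)"
    and "\<And>i. i \<in> {1..N} \<Longrightarrow> T i \<in> carrier_mat (dm P i) (dm M i)"
    and "\<And>i. i \<in> {1..N} \<Longrightarrow> Z i \<in> carrier_mat (dm P i) (dm K (nxt N i))"
    and "\<And>i. i \<in> {1..N} \<Longrightarrow> S i * j i = 1\<^sub>m (dm K i)"
    and "\<And>i. i \<in> {1..N} \<Longrightarrow> p i * T i = 1\<^sub>m (dm M i)"
    and "\<And>i. i \<in> {1..N} \<Longrightarrow> p i * j i = 0\<^sub>m (dm M i) (dm K i)"
    and "\<And>i. i \<in> {1..N} \<Longrightarrow> j i * S i + T i * p i = 1\<^sub>m (dm P i)"
    and "\<And>i. i \<in> {1..N} \<Longrightarrow> mp P i * Z i = j (nxt N i)"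
  shows "split_syzygy N REL M K"
proof -
  have "syzygy_data N REL M K P p j S T Z" unfolding syzygy_data_def by (intro conjI ballI assms)
  then show ?thesis unfolding split_syzygy_def by blast
qed

lemma syzygy_dataD:
  assumes "syzygy_data N REL M K P p j S T Z"
  shows "M \<in> modules N REL" "K \<in> modules N REL" "projective N REL P" "p \<in> rep_hom N P M" "j \<in> rep_hom N K P"
    "P \<in> modules N REL"
  using assms by (simp_all add: syzygy_data_def projective_def)

lemma syzygy_data_dims:
  assumes "syzygy_data N REL M K P p j S T Z" and i: "i \<in> {1..N}"
  shows "dim_row (S i) = dm K i" "dim_col (S i) = dm P i" "dim_row (T i) = dm P i" "dim_col (T i) = dm M i"
    "dim_row (Z i) = dm P i" "dim_col (Z i) = dm K (nxt N i)"
    "dim_row (p i) = dm M i" "dim_col (p i) = dm P i" "dim_row (j i) = dm P i" "dim_col (j i) = dm K i"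
    "S i \<in> carrier_mat (dm K i) (dm P i)" "T i \<in> carrier_mat (dm P i) (dm M i)"
    "Z i \<in> carrier_mat (dm P i) (dm K (nxt N i))"
proof -
  show "S i \<in> carrier_mat (dm K i) (dm P i)" "T i \<in> carrier_mat (dm P i) (dm M i)"
    "Z i \<in> carrier_mat (dm P i) (dm K (nxt N i))"
    using assms unfolding syzygy_data_def by blast+
  then show "dim_row (S i) = dm K i" "dim_col (S i) = dm P i" "dim_row (T i) = dm P i" "dim_col (T i) = dm M i"
    "dim_row (Z i) = dm P i" "dim_col (Z i) = dm K (nxt N i)" by auto
  show "dim_row (p i) = dm M i" "dim_col (p i) = dm P i" "dim_row (j i) = dm P i" "dim_col (j i) = dm K i"
    using rep_homD[OF syzygy_dataD(4)[OF assms(1)] i] rep_homD[OF syzygy_dataD(5)[OF assms(1)] i] by auto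
qed

lemma syzygy_data_eqs:
  assumes "syzygy_data N REL M K P p j S T Z" and i: "i \<in> {1..N}"
  shows "S i * j i = 1\<^sub>m (dm K i)" "p i * T i = 1\<^sub>m (dm M i)" "p i * j i = 0\<^sub>m (dm M i) (dm K i)"
    "j i * S i + T i * p i = 1\<^sub>m (dm P i)" "mp P i * Z i = j (nxt N i)"
  using assms unfolding syzygy_data_def by blast+

lemma split_syzygy_iso:
  assumes "split_syzygy N REL M K" and M': "M' \<in> modules N REL" and iso: "rep_iso N M M'"
  shows "split_syzygy N REL M' K"
proof -
  obtain P p j S T Z where D: "syzygy_data N REL M K P p j S T Z"
    using assms(1) unfolding split_syzygy_def by blast
  note 1 = syzygy_dataD[OF D] and 3 = syzygy_data_eqs[OF D]
  obtain f g where f: "f \<in> rep_hom N M M'" and g: "g \<in> rep_hom N M' M"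
    and gf: "\<And>i. i \<in> {1..N} \<Longrightarrow> g i * f i = 1\<^sub>m (dm M i)" and fg: "\<And>i. i \<in> {1..N} \<Longrightarrow> f i * g i = 1\<^sub>m (dm M' i)"
    using iso unfolding rep_iso_def by blast
  note d = rep_homD(1,2)[OF f] rep_homD(1,2)[OF g] syzygy_data_dims[OF D]
  have "f i * p i * (T i * g i) = 1\<^sub>m (dm M' i)" if i: "i \<in> {1..N}" for i
  proof -
    have "f i * p i * (T i * g i) = f i * (p i * T i) * g i" using i by (simp add: d mat_algebra)
    then show ?thesis using i by (simp add: 3 d fg mat_algebra)
  qed
  moreover have "T i * g i \<in> carrier_mat (dm P i) (dm M' i)" if "i \<in> {1..N}" for i
    using that by (intro carrier_matI) (simp_all add: d)
  moreover have "f i * p i * j i = 0\<^sub>m (dm M' i) (dm K i)" if i: "i \<in> {1..N}" for i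
    using i by (simp add: 3 d mat_algebra)
  moreover have "j i * S i + T i * g i * (f i * p i) = 1\<^sub>m (dm P i)" if i: "i \<in> {1..N}" for i
  proof -
    have "T i * g i * (f i * p i) = T i * (g i * f i) * p i" using i by (simp add: d mat_algebra)
    also have "\<dots> = T i * p i" using i by (simp add: d gf mat_algebra)
    finally show ?thesis using 3(4)[OF i] by simp
  qed
  ultimately show ?thesis
    by (intro split_syzygyI[OF M' 1(2,3) rep_hom_comp[OF modules_is_rep[OF 1(6)] modules_is_rep[OF 1(1)] modules_is_rep[OF M'] 1(4) f] 1(5),
        where S = S and T = "\<lambda>i. T i * g i" and Z = Z])
      (simp_all add: d 3)
qed

lemma split_syzygy_dsum:
  assumes "split_syzygy N REL M K" "split_syzygy N REL M' K'" and REL: "\<forall>(s, l)\<in>set REL. s \<in> {1..N}"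
  shows "split_syzygy N REL (dsum M M') (dsum K K')"
proof -
  obtain P p j S T Z where D: "syzygy_data N REL M K P p j S T Z"
    using assms(1) unfolding split_syzygy_def by blast
  note 1 = syzygy_dataD[OF D] and 3 = syzygy_data_eqs[OF D]
  obtain P' p' j' S' T' Z' where D': "syzygy_data N REL M' K' P' p' j' S' T' Z'"
    using assms(2) unfolding split_syzygy_def by blast
  note mods' = syzygy_dataD[OF D'] and eqs' = syzygy_data_eqs[OF D']
  note P = 1(6) mods'(6)
  note mr = modules_is_rep[OF P(1)] modules_is_rep[OF P(2)] modules_is_rep[OF 1(1)] modules_is_rep[OF mods'(1)]
    modules_is_rep[OF 1(2)] modules_is_rep[OF mods'(2)]
  note d = syzygy_data_dims[OF D] syzygy_data_dims[OF D'] is_repD[OF mr(1)] is_repD[OF mr(2)]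
  have "diag (S i) (S' i) \<in> carrier_mat (dm (dsum K K') i) (dm (dsum P P') i)"
    "diag (T i) (T' i) \<in> carrier_mat (dm (dsum P P') i) (dm (dsum M M') i)"
    "diag (Z i) (Z' i) \<in> carrier_mat (dm (dsum P P') i) (dm (dsum K K') (nxt N i))"
    if "i \<in> {1..N}" for i
    by (rule carrier_matI; use that in \<open>simp add: d\<close>)+
  then show ?thesis
    by (rule split_syzygyI[OF modules_dsum[OF 1(1) mods'(1) REL] modules_dsum[OF 1(2) mods'(2) REL]
          projective_dsum[OF 1(3) mods'(3) modules_dsum[OF P REL]] diag_hom[OF mr(1-4) 1(4) mods'(4)] diag_hom[OF mr(5,6,1,2) 1(5) mods'(5)],
          where S = "\<lambda>i. diag (S i) (S' i)" and T = "\<lambda>i. diag (T i) (T' i)" and Z = "\<lambda>i. diag (Z i) (Z' i)"])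
      (simp_all add: d diag_mult diag_add diag_one diag_zero 3 eqs')
qed

lemma split_syzygy_zero:
  assumes "M \<in> modules N REL" "K \<in> modules N REL" "zero_rep N M" "zero_rep N K"
  shows "split_syzygy N REL M K"
proof -
  note r = modules_is_rep[OF assms(1)] modules_is_rep[OF assms(2)]
  show ?thesis
    by (rule split_syzygyI[OF assms(1,2) zero_rep_projective[OF assms(1,3)] rep_hom_id[OF r(1)] zero_hom[OF r(2,1)],
          where S = "\<lambda>i. 0\<^sub>m 0 0" and T = "\<lambda>i. 0\<^sub>m 0 0" and Z = "\<lambda>i. 0\<^sub>m 0 0"])
      (use assms(3,4) r in \<open>auto simp: zero_rep_def is_repD intro!: carrier_matI mat_eq_empty\<close>)
qed

section \<open>Minimality of covers and the syzygies of uniserial modules\<close>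

context nakayama begin

lemma ends_at:
  assumes "t \<in> {1..N}"
  shows "\<exists>s\<in>{1..N}. (nxt N ^^ k) s = t"
  by (rule bexI[of _ "vert N (int t - int k)"])
    (simp_all add: funpow_nxt_vert[OF N_pos] vert_self[OF assms] vert_in[OF N_pos])

text \<open>Nakayama's lemma: modulo the radical every vector of \<open>P\<close> is in the image of \<open>h\<close>; iterating, the
  defect is moved along longer and longer paths, which eventually vanish.\<close>

lemma epi_modulo_radical:
  assumes P: "P \<in> modules N REL" and X: "X \<in> modules N REL" and h: "h \<in> rep_hom N X P"
    and rad: "\<And>i. i \<in> {1..N} \<Longrightarrow> \<exists>Y\<in>carrier_mat (dm X (nxt N i)) (dm P (nxt N i)).
       \<exists>W\<in>carrier_mat (dm P i) (dm P (nxt N i)). h (nxt N i) * Y + mp P i * W = 1\<^sub>m (dm P (nxt N i))"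
  shows "rep_epi N X P h"
proof (rule rep_epiI[OF h])
  fix t assume t: "t \<in> {1..N}"
  note rP = modules_is_rep[OF P] and rX = modules_is_rep[OF X]
  have iter: "\<exists>Y\<in>carrier_mat (dm X ((nxt N ^^ k) s)) (dm P ((nxt N ^^ k) s)).
     \<exists>W\<in>carrier_mat (dm P s) (dm P ((nxt N ^^ k) s)).
       h ((nxt N ^^ k) s) * Y + path_mat N P s k * W = 1\<^sub>m (dm P ((nxt N ^^ k) s))" if s: "s \<in> {1..N}" for s k
  proof (induction k)
    case 0
    show ?case
      by (rule bexI[of _ "0\<^sub>m (dm X s) (dm P s)"], rule bexI[of _ "1\<^sub>m (dm P s)"])
        (simp_all add: mat_algebra rep_homD(1,2)[OF h s])
  next
    case (Suc k)
    let ?i = "(nxt N ^^ k) s"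
    have i: "?i \<in> {1..N}" using s by simp
    obtain Y W where Y: "Y \<in> carrier_mat (dm X ?i) (dm P ?i)" and W: "W \<in> carrier_mat (dm P s) (dm P ?i)"
      and 1: "h ?i * Y + path_mat N P s k * W = 1\<^sub>m (dm P ?i)" using Suc by blast
    obtain Y' W' where Y': "Y' \<in> carrier_mat (dm X (nxt N ?i)) (dm P (nxt N ?i))"
      and W': "W' \<in> carrier_mat (dm P ?i) (dm P (nxt N ?i))"
      and 2: "h (nxt N ?i) * Y' + mp P ?i * W' = 1\<^sub>m (dm P (nxt N ?i))" using rad[OF i] by blast
    have d0: "dim_row Y = dm X ?i" "dim_col Y = dm P ?i" "dim_row W = dm P s" "dim_col W = dm P ?i"
      "dim_row Y' = dm X (nxt N ?i)" "dim_col Y' = dm P (nxt N ?i)" "dim_row W' = dm P ?i" "dim_col W' = dm P (nxt N ?i)"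
      using Y W Y' W' by auto
    note d = d0 rep_homD(1,2)[OF h] is_repD[OF rP] is_repD[OF rX] path_mat_dims[OF rP s]
    \<comment> \<open>The identity at the vertex reached after \<open>k\<close> arrows, split by the
      induction hypothesis, is inserted. Naturality moves the first part into the image of
      \<open>h\<close>; in the second the path grows by one arrow.\<close>
    have "mp P ?i * W' = mp P ?i * (h ?i * Y + path_mat N P s k * W) * W'"
      unfolding 1 using i by (simp add: d mat_algebra)
    also have "\<dots> = (mp P ?i * h ?i) * (Y * W') + path_mat N P s (Suc k) * (W * W')"
      using i s by (simp add: d mat_algebra)
    also have "\<dots> = h (nxt N ?i) * (mp X ?i * (Y * W')) + path_mat N P s (Suc k) * (W * W')"
      unfolding rep_homD(3)[OF h i, symmetric] using i by (simp add: d mat_algebra)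
    finally have 3: "mp P ?i * W' = h (nxt N ?i) * (mp X ?i * (Y * W')) + path_mat N P s (Suc k) * (W * W')" .
    have "h (nxt N ?i) * (Y' + mp X ?i * (Y * W')) + path_mat N P s (Suc k) * (W * W') =
        h (nxt N ?i) * Y' + mp P ?i * W'"
      unfolding 3 using i s by (simp add: d mat_algebra assoc_add_mat[OF carrier_matI[OF refl refl]
        carrier_matI carrier_matI] del: path_mat.simps)
    then have 4: "h (nxt N ?i) * (Y' + mp X ?i * (Y * W')) + path_mat N P s (Suc k) * (W * W') = 1\<^sub>m (dm P (nxt N ?i))"
      unfolding 2 .
    have "Y' + mp X ?i * (Y * W') \<in> carrier_mat (dm X (nxt N ?i)) (dm P (nxt N ?i))"
      by (rule carrier_matI) (use i in \<open>simp_all add: d\<close>)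
    moreover have "W * W' \<in> carrier_mat (dm P s) (dm P (nxt N ?i))"
      by (rule carrier_matI) (use i in \<open>simp_all add: d\<close>)
    ultimately show ?case using 4 unfolding funpow.simps comp_apply by blast
  qed
  \<comment> \<open>Every path of this length acts as 0, so starting \<open>k\<close> arrows before
    \<open>t\<close> removes the defect.\<close>
  define k where "k = Max (kup ` {1..N})"
  obtain s where s: "s \<in> {1..N}" "(nxt N ^^ k) s = t" using ends_at[OF t] by blast
  have "kup s \<le> k" unfolding k_def using s by (intro Max_ge) auto
  then have zero: "path_mat N P s k = 0\<^sub>m (dm P t) (dm P s)" using path_zero[OF P s(1)] s(2) by simp
  obtain Y W where Y: "Y \<in> carrier_mat (dm X t) (dm P t)" and W: "W \<in> carrier_mat (dm P s) (dm P t)"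
    and 1: "h t * Y + path_mat N P s k * W = 1\<^sub>m (dm P t)" using iter[OF s(1), of k] unfolding s(2) by blast
  have "dim_row Y = dm X t" "dim_col Y = dm P t" "dim_row W = dm P s" "dim_col W = dm P t" using Y W by auto
  then have "h t * Y = 1\<^sub>m (dm P t)"
    using 1 rep_homD(1,2)[OF h t] by (simp add: zero mat_algebra)
  then show "\<exists>R\<in>carrier_mat (dm X t) (dm P t). h t * R = 1\<^sub>m (dm P t)" using Y by blast
qed

lemma split_syzygy_is_syzygy:
  assumes "split_syzygy N REL M K"
  shows "is_syzygy N REL M K"
proof -
  obtain P p j S T Z where D: "syzygy_data N REL M K P p j S T Z"
    using assms(1) unfolding split_syzygy_def by blast
  note mods = syzygy_dataD[OF D] and eqs = syzygy_data_eqs[OF D] and d = syzygy_data_dims[OF D]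
  have epi: "rep_epi N P M p"
    by (rule rep_epiI[OF mods(4)]) (use eqs(2) d(12) in blast)
  have mono: "rep_mono N K P j"
    by (rule rep_monoI[OF mods(5)]) (use eqs(1) d(11) in blast)
  have ex: "exact_seq N K P M j p"
    unfolding exact_seq_def
  proof (intro conjI ballI mods(4,5) equalityI subsetI)
    fix i v assume i: "i \<in> {1..N}" and "v \<in> im_at K j i"
    then obtain w where w: "w \<in> carrier_vec (dm K i)" "v = j i *\<^sub>v w" by (auto simp: im_at_def)
    have "p i *\<^sub>v v = (p i * j i) *\<^sub>v w" unfolding w(2)
      by (rule mult_vec_assoc_dim[symmetric]) (use i w in \<open>simp_all add: d\<close>)
    then show "v \<in> ker_at P M p i"
      using w i mult_vec_carrier_dim[of "j i" "dm P i" w] by (simp add: ker_at_def eqs zero_mult_vec d)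
  next
    fix i v assume i: "i \<in> {1..N}" and "v \<in> ker_at P M p i"
    then have v: "v \<in> carrier_vec (dm P i)" "p i *\<^sub>v v = 0\<^sub>v (dm M i)" by (auto simp: ker_at_def)
    have "v = (j i * S i + T i * p i) *\<^sub>v v" using eqs(4)[OF i] v by simp
    also have "\<dots> = (j i * S i) *\<^sub>v v + (T i * p i) *\<^sub>v v"
      by (rule add_mult_distrib_mat_vec[OF _ _ v(1), of _ "dm P i"]) (rule carrier_matI; use i in \<open>simp add: d\<close>)+
    also have "(T i * p i) *\<^sub>v v = T i *\<^sub>v (p i *\<^sub>v v)"
      by (rule mult_vec_assoc_dim) (use i v in \<open>simp_all add: d\<close>)
    also have "\<dots> = 0\<^sub>v (dm P i)" unfolding v(2) by (rule mult_zero_vec) (use i in \<open>simp_all add: d\<close>)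
    also have "(j i * S i) *\<^sub>v v = j i *\<^sub>v (S i *\<^sub>v v)"
      by (rule mult_vec_assoc_dim) (use i v in \<open>simp_all add: d\<close>)
    finally have "v = j i *\<^sub>v (S i *\<^sub>v v)"
      using mult_vec_carrier_dim[of "j i" "dm P i" "S i *\<^sub>v v"] i by (simp add: d)
    then show "v \<in> im_at K j i"
      using mult_vec_carrier_dim[of "S i" "dm K i" v] i unfolding im_at_def by (auto simp: d)
  qed
  have "projective_cover N REL P M p"
    unfolding projective_cover_def
  proof (intro conjI ballI impI mods(3) epi)
    fix X h assume X: "X \<in> modules N REL" and h: "h \<in> rep_hom N X P" and ph: "rep_epi N X M (comp_mor p h)"
    note dh = rep_homD(1,2)[OF h]
    show "rep_epi N X P h"
    proof (rule epi_modulo_radical[OF mods(6) X h])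
      fix i0 assume i0: "i0 \<in> {1..N}"
      define i where "i = nxt N i0"
      have i: "i \<in> {1..N}" using i0 by (simp add: i_def)
      obtain R where R: "R \<in> carrier_mat (dm X i) (dm M i)" "p i * h i * R = 1\<^sub>m (dm M i)"
        using epi_right_inverse[OF ph i] by (auto simp: comp_mor_def)
      have dR: "dim_row R = dm X i" "dim_col R = dm M i" using R(1) by auto
      \<comment> \<open>\<open>Q\<close> measures the failure of \<open>h\<close> to be onto. It is
        killed by \<open>p\<close>, hence factors through \<open>j\<close>, whose image lies in the
        radical by \<open>Z\<close>; so \<open>h\<close> is onto modulo the radical.\<close>
      define Q where "Q = 1\<^sub>m (dm P i) - h i * (R * p i)"
      have dQ: "dim_row Q = dm P i" "dim_col Q = dm P i" using i by (simp_all add: Q_def dh d)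
      have "p i * Q = p i - p i * h i * R * p i" unfolding Q_def using i by (simp add: d dh dR mat_algebra)
      then have pQ: "p i * Q = 0\<^sub>m (dm M i) (dm P i)" unfolding R(2) using i by (simp add: d mat_algebra)
      have "Q = (j i * S i + T i * p i) * Q" using i dQ by (simp add: eqs mat_algebra)
      also have "\<dots> = j i * (S i * Q) + T i * (p i * Q)" using i by (simp add: d dQ mat_algebra)
      also have "\<dots> = mp P i0 * Z i0 * (S i * Q)" unfolding pQ eqs(5)[OF i0] i_def[symmetric] using i by (simp add: d dQ mat_algebra)
      finally have Q: "Q = mp P i0 * (Z i0 * (S i * Q))"
        using i i0 is_repD[OF modules_is_rep[OF mods(6)]] by (simp add: d dQ mat_algebra i_def)
      have "h i * (R * p i) + Q = 1\<^sub>m (dm P i)"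
        unfolding Q_def by (rule eq_matI) (use i in \<open>simp_all add: d dh dR\<close>)
      then have "h i * (R * p i) + mp P i0 * (Z i0 * (S i * Q)) = 1\<^sub>m (dm P i)" unfolding Q[symmetric] .
      moreover have "R * p i \<in> carrier_mat (dm X i) (dm P i)"
        by (rule carrier_matI) (use i in \<open>simp_all add: d dR\<close>)
      moreover have "Z i0 * (S i * Q) \<in> carrier_mat (dm P i0) (dm P i)"
        by (rule carrier_matI) (use i i0 in \<open>simp_all add: d dQ\<close>)
      ultimately show "\<exists>Y\<in>carrier_mat (dm X (nxt N i0)) (dm P (nxt N i0)).
          \<exists>W\<in>carrier_mat (dm P i0) (dm P (nxt N i0)). h (nxt N i0) * Y + mp P i0 * W = 1\<^sub>m (dm P (nxt N i0))"
        unfolding i_def[symmetric] by blast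
    qed
  qed
  then show ?thesis using mono ex mods(2) unfolding is_syzygy_def by blast
qed

definition All0 :: "(nat \<times> nat) set" where
  "All0 = {(s, l). s \<in> {1..N} \<and> l \<le> kup s}"

lemma All_subset: "All \<subseteq> All0" and Bas_subset: "Bas \<subseteq> All"
  by (auto simp: All_def All0_def Bas_def)

lemma omega_All0: "x \<in> All0 \<Longrightarrow> omega x \<in> All0"
  using kup_funpow by (cases x) (auto simp: All0_def le_diff_conv add.commute)

lemma un_modules0: "x \<in> All0 \<Longrightarrow> un x \<in> modules N REL"
  by (auto simp: All0_def intro: uni_modules)

lemma uni_zero: "zero_rep N (uni N s 0)"
  by (simp add: zero_rep_def bas_def)

lemma split_syzygy_un:
  assumes "x \<in> All0"
  shows "split_syzygy N REL (un x :: 'k::field rep) (un (omega x))"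
proof -
  obtain s l where x: "x = (s, l)" by (cases x)
  have s: "s \<in> {1..N}" and l: "l \<le> kup s" using assms by (auto simp: All0_def x)
  show ?thesis
  proof (cases "l = 0")
    case True
    then show ?thesis using s
      by (intro split_syzygy_zero) (auto simp: x uni_zero intro: uni_modules)
  next
    case False
    define c where "c = kup s"
    let ?t = "(nxt N ^^ l) s"
    let ?M = "uni N s l :: 'k rep" and ?P = "uni N s c :: 'k rep" and ?K = "uni N ?t (c - l) :: 'k rep"
    let ?bM = "bas N s l" and ?bP = "bas N s c" and ?bK = "bas N ?t (c - l)"
    have lc: "l \<le> c" using l by (simp add: c_def)
    have om: "omega x = (?t, c - l)" using False by (simp add: x c_def)
    have K: "?K \<in> modules N REL" using un_modules0[OF omega_All0[OF assms]] by (simp add: om)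
    define p :: "'k morphism" where "p i = rel_mat id (?bM i) (?bP i)" for i
    define j :: "'k morphism" where "j i = rel_mat (\<lambda>q. q + l) (?bP i) (?bK i)" for i
    \<comment> \<open>Among the positions of \<open>?P\<close>, those below \<open>l\<close> form
      \<open>?M\<close> and the others, shifted by \<open>l\<close>, form \<open>?K\<close>. The
      value \<open>c\<close> lies outside all lists of positions and so encodes 0.\<close>
    define S :: "'k morphism" where "S i = rel_mat (\<lambda>q. if q < l then c else q - l) (?bK i) (?bP i)" for i
    define T :: "'k morphism" where "T i = rel_mat id (?bP i) (?bM i)" for i
    \<comment> \<open>The vector at position \<open>q + l\<close> of \<open>?P\<close> is the image
      of its predecessor \<open>q + (l - 1)\<close>, which exists as \<open>l > 0\<close>; so the
      image of \<open>?K\<close> lies in the radical.\<close>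
    define Z :: "'k morphism" where "Z i = rel_mat (\<lambda>q. q + (l - 1)) (?bP i) (?bK (nxt N i))" for i
    have p: "p \<in> rep_hom N ?P ?M"
    proof (rule rep_homI)
      fix i
      have "p (nxt N i) * mp ?P i = rel_mat Suc (?bM (nxt N i)) (?bP i)"
        unfolding p_def uni_simps by (rule rel_mat_mult) (use lc in auto)
      also have "\<dots> = mp ?M i * p i"
        unfolding p_def uni_simps by (rule rel_mat_mult[symmetric]) auto
      finally show "p (nxt N i) * mp ?P i = mp ?M i * p i" .
    qed (simp_all add: p_def)
    have shift: "(nxt N ^^ (q + l)) s = (nxt N ^^ q) ?t" for q
      by (simp add: add.commute[of q] funpow_nxt_add)
    have j: "j \<in> rep_hom N ?K ?P"
    proof (rule rep_homI)
      fix i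
      have "j (nxt N i) * mp ?K i = rel_mat (\<lambda>q. Suc q + l) (?bP (nxt N i)) (?bK i)"
        unfolding j_def uni_simps by (rule rel_mat_mult) (auto simp: shift)
      also have "\<dots> = mp ?P i * j i"
        unfolding j_def uni_simps by (rule rel_mat_mult[symmetric]) (auto simp: shift)
      finally show "j (nxt N i) * mp ?K i = mp ?P i * j i" .
    qed (simp_all add: j_def)
    have Sj: "S i * j i = 1\<^sub>m (dm ?K i)" for i
    proof -
      have "S i * j i = rel_mat id (?bK i) (?bK i)"
        unfolding S_def j_def by (rule rel_mat_mult) (auto simp: shift)
      then show ?thesis by (simp add: rel_mat_id)
    qed
    have pT: "p i * T i = 1\<^sub>m (dm ?M i)" for i
    proof -
      have "p i * T i = rel_mat id (?bM i) (?bM i)"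
        unfolding p_def T_def by (rule rel_mat_mult) (use lc in auto)
      then show ?thesis by (simp add: rel_mat_id)
    qed
    have pj: "p i * j i = 0\<^sub>m (dm ?M i) (dm ?K i)" for i
    proof -
      have "p i * j i = rel_mat (\<lambda>q. q + l) (?bM i) (?bK i)"
        unfolding p_def j_def by (rule rel_mat_mult) auto
      also have "\<dots> = 0\<^sub>m (length (?bM i)) (length (?bK i))" by (rule rel_mat_zero) auto
      finally show ?thesis by simp
    qed
    have jS: "j i * S i + T i * p i = 1\<^sub>m (dm ?P i)" for i
    proof -
      have 1: "j i * S i = rel_mat (\<lambda>q. if q < l then c + l else q) (?bP i) (?bP i)"
        unfolding j_def S_def by (rule rel_mat_mult) (auto simp: shift[symmetric])
      have 2: "T i * p i = rel_mat (\<lambda>q. if q < l then q else c) (?bP i) (?bP i)"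
      proof -
        have "T i * rel_mat (\<lambda>q. if q < l then q else c) (?bM i) (?bP i) = rel_mat (\<lambda>q. if q < l then q else c) (?bP i) (?bP i)"
          unfolding T_def by (rule rel_mat_mult) auto
        \<comment> \<open>The map \<open>id\<close> is replaced by one that sends the positions from
          \<open>l\<close> on to \<open>c\<close>: when \<open>T\<close> is applied afterwards, a
          vector already dropped must not reappear in \<open>?bP\<close>.\<close>
        moreover have "p i = rel_mat (\<lambda>q. if q < l then q else c) (?bM i) (?bP i)"
          unfolding p_def
        proof (rule eq_matI)
          fix r q assume "r < dim_row (rel_mat (\<lambda>q. if q < l then q else c) (?bM i) (?bP i) :: 'k mat)"
            "q < dim_col (rel_mat (\<lambda>q. if q < l then q else c) (?bM i) (?bP i) :: 'k mat)"
          then have rq: "r < length (?bM i)" "q < length (?bP i)" by auto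
          have "?bM i ! r < l" using nth_mem[OF rq(1)] by simp
          then show "(rel_mat id (?bM i) (?bP i) :: 'k mat) $$ (r, q) = rel_mat (\<lambda>q. if q < l then q else c) (?bM i) (?bP i) $$ (r, q)"
            using rq lc by (auto simp: rel_mat_def)
        qed auto
        ultimately show ?thesis by simp
      qed
      show ?thesis unfolding 1 2
      proof (rule eq_matI)
        fix r q assume "r < dim_row (1\<^sub>m (dm ?P i) :: 'k mat)" "q < dim_col (1\<^sub>m (dm ?P i) :: 'k mat)"
        then have rq: "r < length (?bP i)" "q < length (?bP i)" by auto
        have "?bP i ! r < c" using nth_mem[OF rq(1)] by simp
        then show "(rel_mat (\<lambda>q. if q < l then c + l else q) (?bP i) (?bP i) +
            rel_mat (\<lambda>q. if q < l then q else c) (?bP i) (?bP i)) $$ (r, q) = (1\<^sub>m (dm ?P i) :: 'k mat) $$ (r, q)"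
          using rq nth_eq_iff_index_eq[OF distinct_bas rq] by (auto simp: rel_mat_def)
      qed auto
    qed
    have PZ: "mp ?P i * Z i = j (nxt N i)" if i: "i \<in> {1..N}" for i
    proof -
      have "(nxt N ^^ (q + (l - 1))) s = i" if q: "(nxt N ^^ q) ?t = nxt N i" for q
      proof -
        have "nxt N ((nxt N ^^ (q + (l - 1))) s) = (nxt N ^^ (q + l)) s"
          using False by (cases l) auto
        also have "\<dots> = nxt N i" using q by (simp add: shift)
        finally show ?thesis using nxt_inj[OF _ i] s by simp
      qed
      then show ?thesis unfolding Z_def j_def uni_simps
        by (intro rel_mat_mult) (use False in auto)
    qed
    have "split_syzygy N REL ?M ?K"
      by (rule split_syzygyI[OF _ K _ p j _ _ _ Sj pT pj jS PZ])
        (use s l uni_projective[OF s] in \<open>auto simp: c_def S_def T_def Z_def intro!: uni_modules carrier_matI\<close>)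
    then show ?thesis by (simp add: om) (simp add: x)
  qed
qed

lemma split_syzygy_projective:
  assumes P: "projective N REL P"
  shows "split_syzygy N REL P null_rep"
proof -
  have P': "P \<in> modules N REL" using P by (simp add: projective_def)
  note r = modules_is_rep[OF P']
  show ?thesis
    by (rule split_syzygyI[OF P' null_rep_modules P rep_hom_id[OF r] zero_hom[OF is_rep_null r],
          where S = "\<lambda>i. 0\<^sub>m 0 (dm P i)" and T = "\<lambda>i. 1\<^sub>m (dm P i)" and Z = "\<lambda>i. 0\<^sub>m (dm P i) 0"])
      (use r in \<open>auto simp: is_repD mat_algebra intro!: mat_eq_empty\<close>)
qed

text \<open>A projective has the zero module as a syzygy, whereas \<open>omega x\<close> gives one
  of positive length; uniqueness of syzygies excludes this.\<close>

lemma uni_not_projective: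
  assumes "x \<in> Bas"
  shows "\<not> projective N REL (un x :: 'k::field rep)"
proof
  assume P: "projective N REL (un x :: 'k rep)"
  have x: "x \<in> All0" using assms Bas_subset All_subset by blast
  have "rep_iso N (null_rep :: 'k rep) (un (omega x))"
    by (rule syzygy_unique[OF split_syzygy_is_syzygy[OF split_syzygy_projective[OF P]]
          split_syzygy_is_syzygy[OF split_syzygy_un[OF x]] un_modules0[OF x]])
  then have "length (bas N (fst (omega x)) (snd (omega x)) (fst (omega x))) = 0"
    using rep_iso_dm[of N "null_rep :: 'k rep" "un (omega x)" "fst (omega x)"] omega_All0[OF x]
    by (auto simp: All0_def)
  moreover have "0 < snd (omega x)" using assms by (cases x) (auto simp: Bas_def)
  ultimately show False using bas_0[of "snd (omega x)" N "fst (omega x)"] by simp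
qed

lemma un_projective_iff:
  assumes x: "x \<in> All"
  shows "projective N REL (un x :: 'k::field rep) \<longleftrightarrow> x \<notin> Bas"
proof (cases "x \<in> Bas")
  case True
  then show ?thesis using uni_not_projective by blast
next
  case False
  then have 1: "un x = (uni N (fst x) (kup (fst x)) :: 'k rep)"
    using x by (cases x) (auto simp: All_def Bas_def)
  have "fst x \<in> {1..N}" using x by (auto simp: All_def)
  then show ?thesis using False uni_projective unfolding 1 by blast
qed

lemma projective_dsl: "set xs \<subseteq> All \<Longrightarrow> projective N REL (dsl xs :: 'k::field rep) \<Longrightarrow> set xs \<inter> Bas = {}"
proof (induction xs)
  case (Cons x xs)
  then have x: "x \<in> All" and xs: "set xs \<subseteq> All" and P: "projective N REL (dsum (un x) (dsl xs) :: 'k rep)" by auto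
  note PD = projective_dsumD[OF P un_modules[OF x] dsl_modules[OF xs]]
  then show ?case using Cons.IH[OF xs] un_projective_iff[OF x] by auto
qed simp

text \<open>This lets the multiplicity at a nonprojective uniserial descend to \<open>K0\<close>,
  where projectives are zero.\<close>

lemma mult_projective:
  assumes "projective N REL P" "x \<in> Bas"
  shows "mult N P x = 0"
proof -
  have P: "P \<in> modules N REL" using assms by (simp add: projective_def)
  obtain xs where xs: "set xs \<subseteq> All" "rep_iso N P (dsl xs)" using decomposition[OF P] by blast
  have x: "x \<in> All" using assms(2) by (auto simp: Bas_def All_def)
  have "projective N REL (dsl xs :: 'a rep)"
    using projective_iso[OF assms(1) rep_iso_sym[OF xs(2)] dsl_modules[OF xs(1)]] .
  then have "x \<notin> set xs" using projective_dsl[OF xs(1)] assms(2) by blast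
  then show ?thesis
    using mult_iso[OF xs(2) modules_is_rep[OF P] is_rep_dsl, of x] x mult_dsl[OF xs(1) x]
    by (auto simp: All_def count_list_0_iff)
qed

lemma dsl_modules0: "set xs \<subseteq> All0 \<Longrightarrow> dsl xs \<in> modules N REL"
  by (induction xs) (auto simp: null_rep_modules dsum_modules un_modules0)

lemma split_syzygy_dsl:
  "set xs \<subseteq> All0 \<Longrightarrow> split_syzygy N REL (dsl xs :: 'k::field rep) (dsl (map omega xs))"
proof (induction xs)
  case Nil
  then show ?case by (simp add: split_syzygy_zero null_rep_modules zero_rep_def)
next
  case (Cons x xs)
  then have x: "x \<in> All0" and IH: "split_syzygy N REL (dsl xs :: 'k rep) (dsl (map omega xs))" by auto
  from split_syzygy_dsum[OF split_syzygy_un[OF x] IH REL_start] show ?case by simp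
qed

subsection \<open>Finite projective resolutions\<close>

lemma resolution_projective:
  assumes M: "projective N REL (M :: 'k::field rep)"
  shows "\<exists>P d. proj_resolution N REL M 0 P d"
proof -
  have M': "M \<in> modules N REL" using M by (simp add: projective_def)
  note r = modules_is_rep[OF M']
  define P where "P n = (if n = 0 then M else null_rep)" for n :: nat
  define d :: "nat \<Rightarrow> 'k morphism" where
    "d n = (\<lambda>i. if n = 0 then 1\<^sub>m (dm M i) else if n = 1 then 0\<^sub>m (dm M i) 0 else 0\<^sub>m 0 0)" for n
  have d0: "d 0 \<in> rep_hom N M M" unfolding d_def using rep_hom_id[OF r] by simp
  have d1: "d (Suc 0) \<in> rep_hom N null_rep M"
    unfolding d_def by (rule rep_homI) (use r in \<open>auto simp: One_nat_def is_repD mat_algebra\<close>)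
  have d2: "d (Suc (Suc n)) \<in> rep_hom N null_rep null_rep" for n
    unfolding d_def by (rule rep_homI) (auto simp: One_nat_def mat_algebra)
  have nullproj: "projective N REL (null_rep :: 'k rep)"
    by (rule zero_rep_projective[OF null_rep_modules]) (simp add: zero_rep_def)
  have cv0: "carrier_vec 0 = {0\<^sub>v 0 :: 'k vec}" by auto
  have "proj_resolution N REL M 0 P d"
    unfolding proj_resolution_def
  proof (intro conjI allI impI)
    show "projective N REL (P j)" for j using M nullproj by (simp add: P_def)
    show "zero_rep N (P j)" if "0 < j" for j using that by (simp add: P_def zero_rep_def)
    show "rep_epi N (P 0) M (d 0)"
      using d0 by (intro rep_epiI) (auto simp: P_def d_def intro!: bexI[of _ "1\<^sub>m (dm M _)"])
    show "exact_seq N (P 1) (P 0) M (d 1) (d 0)"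
      unfolding exact_seq_def
    proof (intro conjI ballI)
      show "d 1 \<in> rep_hom N (P 1) (P 0)" using d1 by (simp add: P_def One_nat_def)
      show "d 0 \<in> rep_hom N (P 0) M" using d0 by (simp add: P_def)
      fix i
      show "im_at (P 1) (d 1) i = ker_at (P 0) M (d 0) i"
        by (auto simp: im_at_def ker_at_def P_def d_def cv0 zero_mult_vec mult_zero_vec One_nat_def)
    qed
    show "exact_seq N (P (j + 2)) (P (j + 1)) (P j) (d (j + 2)) (d (j + 1))" for j
      unfolding exact_seq_def
    proof (intro conjI ballI)
      show "d (j + 2) \<in> rep_hom N (P (j + 2)) (P (j + 1))" using d2 by (simp add: P_def)
      show "d (j + 1) \<in> rep_hom N (P (j + 1)) (P j)" using d1 d2[of "j - 1"] by (cases j) (auto simp: P_def One_nat_def)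
      fix i
      show "im_at (P (j + 2)) (d (j + 2)) i = ker_at (P (j + 1)) (P j) (d (j + 1)) i"
        by (auto simp: im_at_def ker_at_def P_def d_def cv0 zero_mult_vec mult_zero_vec One_nat_def)
    qed
  qed
  then show ?thesis by blast
qed

text \<open>The resolution of \<open>K\<close> is spliced to the cover. As \<open>j\<close> is
  injective, composing with it keeps the kernel of \<open>d 0\<close>; as \<open>d 0\<close> is
  onto, the composite has the image of \<open>j\<close>, which is the kernel of
  \<open>p\<close>.\<close>

lemma resolution_step:
  assumes "is_syzygy N REL M K" and M: "M \<in> modules N REL" and "proj_resolution N REL K n Q d"
  shows "\<exists>P d'. proj_resolution N REL M (Suc n) P d'"
proof -
  obtain P0 p j where cov: "projective_cover N REL P0 M p" and mono: "rep_mono N K P0 j" and ex: "exact_seq N K P0 M j p"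
    and K: "K \<in> modules N REL" using assms(1) unfolding is_syzygy_def by blast
  have P0: "projective N REL P0" "P0 \<in> modules N REL" and epi: "rep_epi N P0 M p"
    using cov by (auto simp: projective_cover_def projective_def)
  have j: "j \<in> rep_hom N K P0" using mono by (simp add: rep_mono_def)
  have Q: "\<And>j. projective N REL (Q j)" "\<And>j. j > n \<Longrightarrow> zero_rep N (Q j)" and eQ: "rep_epi N (Q 0) K (d 0)"
    and ex0: "exact_seq N (Q 1) (Q 0) K (d 1) (d 0)"
    and exj: "\<And>j. exact_seq N (Q (j + 2)) (Q (j + 1)) (Q j) (d (j + 2)) (d (j + 1))"
    using assms(3) unfolding proj_resolution_def by blast+
  have Qm: "Q k \<in> modules N REL" for k using Q(1)[of k] by (simp add: projective_def)
  have d0: "d 0 \<in> rep_hom N (Q 0) K" using eQ by (simp add: rep_epi_def)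
  define P where "P k = (case k of 0 \<Rightarrow> P0 | Suc m \<Rightarrow> Q m)" for k
  define e where "e k = (case k of 0 \<Rightarrow> p | Suc 0 \<Rightarrow> (\<lambda>i. j i * d 0 i) | Suc (Suc m) \<Rightarrow> d (Suc m))" for k
  have simps: "P 0 = P0" "P (Suc k) = Q k" "e 0 = p" "e (Suc 0) = (\<lambda>i. j i * d 0 i)" "e (Suc (Suc k)) = d (Suc k)" for k
    by (simp_all add: P_def e_def)
  have e1: "(\<lambda>i. j i * d 0 i) \<in> rep_hom N (Q 0) P0"
    by (rule rep_hom_comp[OF modules_is_rep[OF Qm] modules_is_rep[OF K] modules_is_rep[OF P0(2)] d0 j])
  have app: "(j i * d 0 i) *\<^sub>v v = j i *\<^sub>v (d 0 i *\<^sub>v v)" "d 0 i *\<^sub>v v \<in> carrier_vec (dm K i)"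
    if "i \<in> {1..N}" "v \<in> carrier_vec (dm (Q 0) i)" for i v
    using that rep_homD[OF j that(1)] rep_homD[OF d0 that(1)] by (auto intro: mult_vec_assoc_dim mult_vec_carrier_dim)
  have first: "exact_seq N (Q 0) P0 M (\<lambda>i. j i * d 0 i) p"
    unfolding exact_seq_def
  proof (intro conjI ballI e1)
    show "p \<in> rep_hom N P0 M" using ex by (simp add: exact_seq_def)
    fix i assume i: "i \<in> {1..N}"
    have "im_at (Q 0) (\<lambda>i. j i * d 0 i) i = {j i *\<^sub>v w | w. w \<in> im_at (Q 0) (d 0) i}"
      unfolding im_at_def using app[OF i] by auto metis
    also have "\<dots> = im_at K j i" using eQ i by (auto simp: rep_epi_def im_at_def)
    also have "\<dots> = ker_at P0 M p i" using ex i by (simp add: exact_seq_def)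
    finally show "im_at (Q 0) (\<lambda>i. j i * d 0 i) i = ker_at P0 M p i" .
  qed
  have second: "exact_seq N (Q 1) (Q 0) P0 (d 1) (\<lambda>i. j i * d 0 i)"
    unfolding exact_seq_def
  proof (intro conjI ballI e1)
    show "d 1 \<in> rep_hom N (Q 1) (Q 0)" using ex0 by (simp add: exact_seq_def)
    fix i assume i: "i \<in> {1..N}"
    have "j i *\<^sub>v w = 0\<^sub>v (dm P0 i) \<longleftrightarrow> w = 0\<^sub>v (dm K i)" if "w \<in> carrier_vec (dm K i)" for w
      using mono i that unfolding rep_mono_def ker_at_def by blast
    then have "ker_at (Q 0) P0 (\<lambda>i. j i * d 0 i) i = ker_at (Q 0) K (d 0) i"
      unfolding ker_at_def using app[OF i] by auto
    then show "im_at (Q 1) (d 1) i = ker_at (Q 0) P0 (\<lambda>i. j i * d 0 i) i"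
      using ex0 i by (simp add: exact_seq_def)
  qed
  have "proj_resolution N REL M (Suc n) P e"
    unfolding proj_resolution_def
  proof (intro conjI allI impI)
    show "projective N REL (P k)" for k using Q(1) P0(1) by (cases k) (simp_all add: simps)
    show "zero_rep N (P k)" if "Suc n < k" for k using that Q(2) by (cases k) (simp_all add: simps)
    show "rep_epi N (P 0) M (e 0)" using epi by (simp add: simps)
    show "exact_seq N (P 1) (P 0) M (e 1) (e 0)" using first by (simp add: simps One_nat_def)
    show "exact_seq N (P (k + 2)) (P (k + 1)) (P k) (e (k + 2)) (e (k + 1))" for k
      using second exj[of "k - 1"] by (cases k) (auto simp: simps One_nat_def)
  qed
  then show ?thesis by blast
qed

text \<open>The last assumption says that the \<open>n\<close>-th syzygy is zero. The resulting
  length is not always minimal, but only a uniform finite bound is wanted.\<close>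

lemma resolution_dsl:
  assumes "M \<in> modules N REL" "rep_iso N M (dsl xs)" "set xs \<subseteq> All0" "\<And>x. x \<in> set xs \<Longrightarrow> snd ((omega ^^ n) x) = 0"
  shows "\<exists>P d. proj_resolution N REL M n P d"
  using assms
proof (induction n arbitrary: M xs)
  case 0
  have "zero_rep N (dsl xs :: 'a rep)" using "0.prems"(4)
    by (induction xs) (auto simp: zero_rep_def bas_def)
  then have "zero_rep N M" using rep_iso_dm[OF "0.prems"(2)] by (simp add: zero_rep_def)
  then show ?case using resolution_projective zero_rep_projective "0.prems"(1) by blast
next
  case (Suc n)
  let ?K = "dsl (map omega xs) :: 'a rep"
  have xs: "set (map omega xs) \<subseteq> All0" using Suc.prems(3) omega_All0 by auto
  have "split_syzygy N REL M ?K"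
    by (rule split_syzygy_iso[OF split_syzygy_dsl[OF Suc.prems(3)] Suc.prems(1) rep_iso_sym[OF Suc.prems(2)]])
  then have syz: "is_syzygy N REL M ?K" by (rule split_syzygy_is_syzygy)
  have "snd ((omega ^^ n) y) = 0" if "y \<in> set (map omega xs)" for y
    using that Suc.prems(4) by (auto simp: funpow_swap1)
  then obtain Q d where "proj_resolution N REL ?K n Q d"
    using Suc.IH[OF dsl_modules0[OF xs] rep_iso_refl[OF is_rep_dsl] xs] by blast
  then show ?case by (rule resolution_step[OF syz Suc.prems(1)])
qed

text \<open>Otherwise each orbit leaves \<open>Bas\<close>, at a projective or at zero, and one step
  later has length 0. As there are finitely many uniserials, a common number of steps suffices for
  all, and by decomposition it bounds every projective dimension.\<close>

theorem infinite_orbit: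
  assumes "global_dim TYPE('k::field) N REL = \<infinity>"
  shows "\<exists>x\<in>Bas. \<forall>n. (omega ^^ n) x \<in> Bas"
proof (rule ccontr)
  assume no: "\<not> ?thesis"
  have stay: "(omega ^^ n) x \<in> All0" if "x \<in> All0" for x n
    using that omega_All0 by (induction n) auto
  have dead: "snd ((omega ^^ (n + m)) x) = 0" if "snd ((omega ^^ n) x) = 0" for n m x
  proof (induction m)
    case (Suc m)
    then show ?case by (cases "(omega ^^ (n + m)) x") auto
  qed (use that in simp)
  have "\<exists>n. snd ((omega ^^ n) x) = 0" if x: "x \<in> All0" for x
  proof -
    have "\<exists>n. (omega ^^ n) x \<notin> Bas"
    proof (cases "x \<in> Bas")
      case True then show ?thesis using no by blast
    next
      case False then show ?thesis by (intro exI[of _ 0]) simp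
    qed
    then obtain n where n: "(omega ^^ n) x \<notin> Bas" ..
    obtain s l where sl: "(omega ^^ n) x = (s, l)" by (cases "(omega ^^ n) x")
    then have "l = 0 \<or> l = kup s" using n stay[OF x, of n] by (auto simp: Bas_def All0_def)
    then have "snd ((omega ^^ Suc n) x) = 0" using sl by auto
    then show ?thesis by blast
  qed
  then obtain n where n: "\<And>x. x \<in> All0 \<Longrightarrow> snd ((omega ^^ n x) x) = 0" by metis
  define m where "m = Max (n ` All)"
  have m: "snd ((omega ^^ m) x) = 0" if x: "x \<in> All" for x
  proof -
    have "n x \<le> m" unfolding m_def using x finite_All by (intro Max_ge) auto
    then show ?thesis using dead[OF n[of x], of "m - n x"] x All_subset by auto
  qed
  have "proj_dim N REL M \<le> enat m" if M: "M \<in> modules N REL" for M :: "'k rep"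
  proof -
    obtain xs where xs: "set xs \<subseteq> All" "rep_iso N M (dsl xs)" using decomposition[OF M] by blast
    then have "\<exists>P d. proj_resolution N REL M m P d"
      using m All_subset by (intro resolution_dsl[OF M xs(2)]) auto
    then show ?thesis unfolding proj_dim_def by (intro Inf_lower) auto
  qed
  then have "global_dim TYPE('k) N REL \<le> enat m" unfolding global_dim_def by (intro SUP_least)
  then show False using assms by simp
qed

end

section \<open>Ranks in a finitely generated free abelian group\<close>

text \<open>Fraction-free Gaussian elimination: with a pivot \<open>a b0 t\<close>, the other rows
  are combined with that of \<open>b0\<close> so that column \<open>t\<close> disappears.\<close>

lemma integer_relation:
  fixes a :: "'b \<Rightarrow> 't \<Rightarrow> int"
  assumes "finite T" "finite B" "card T < card B"
  shows "\<exists>c :: 'b \<Rightarrow> int. (\<exists>b\<in>B. c b \<noteq> 0) \<and> (\<forall>t\<in>T. (\<Sum>b\<in>B. c b * a b t) = 0)"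
  using assms
proof (induction T arbitrary: B a rule: finite_induct)
  case empty
  then have "B \<noteq> {}" by auto
  then show ?case by (intro exI[of _ "\<lambda>_. 1"]) auto
next
  case (insert t T)
  show ?case
  proof (cases "\<forall>b\<in>B. a b t = 0")
    case True
    obtain c where "\<exists>b\<in>B. c b \<noteq> 0" "\<forall>t\<in>T. (\<Sum>b\<in>B. c b * a b t) = 0"
      using insert.IH[of B a] insert.prems insert.hyps by auto
    then show ?thesis using True by (intro exI[of _ c]) auto
  next
    case False
    then obtain b0 where b0: "b0 \<in> B" "a b0 t \<noteq> 0" by blast
    define B' where "B' = B - {b0}"
    have B': "finite B'" "b0 \<notin> B'" "B = insert b0 B'" using insert.prems b0 by (auto simp: B'_def)
    have "card T < card B'" using insert.prems insert.hyps b0 by (simp add: B'_def)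
    then obtain c where c: "\<exists>b\<in>B'. c b \<noteq> 0"
      "\<And>u. u \<in> T \<Longrightarrow> (\<Sum>b\<in>B'. c b * (a b0 t * a b u - a b t * a b0 u)) = 0"
      using insert.IH[of B' "\<lambda>b u. a b0 t * a b u - a b t * a b0 u"] B' by blast
    \<comment> \<open>Multiplying the coefficients by the nonzero pivot avoids division, and the
      coefficient of \<open>b0\<close> is chosen to cancel column \<open>t\<close>.\<close>
    define d where "d b = (if b = b0 then - (\<Sum>b\<in>B'. c b * a b t) else a b0 t * c b)" for b
    have sum: "(\<Sum>b\<in>B. d b * a b u) = - (\<Sum>b\<in>B'. c b * a b t) * a b0 u + (\<Sum>b\<in>B'. a b0 t * c b * a b u)" for u
    proof -
      have "(\<Sum>b\<in>B'. d b * a b u) = (\<Sum>b\<in>B'. a b0 t * c b * a b u)"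
        by (rule sum.cong) (use B' in \<open>auto simp: d_def\<close>)
      then show ?thesis using B' by (simp add: d_def)
    qed
    have "(\<Sum>b\<in>B. d b * a b u) = 0" if "u \<in> insert t T" for u
    proof -
      have "(\<Sum>b\<in>B. d b * a b u) = (\<Sum>b\<in>B'. c b * (a b0 t * a b u - a b t * a b0 u))"
        unfolding sum by (simp add: right_diff_distrib sum_subtractf sum_distrib_left sum_distrib_right mult_ac)
      then show ?thesis using that c(2) by (auto simp: mult_ac)
    qed
    moreover have "\<exists>b\<in>B. d b \<noteq> 0" using c(1) b0 B' by (auto simp: d_def)
    ultimately show ?thesis by blast
  qed
qed

lemma (in group) generate_insert_one:
  assumes "S \<subseteq> S'" "S' \<subseteq> insert \<one> S"
  shows "generate G S' = generate G S"
proof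
  show "generate G S \<subseteq> generate G S'" by (rule mono_generate[OF assms(1)])
  show "generate G S' \<subseteq> generate G S"
  proof
    fix x assume "x \<in> generate G S'"
    then show "x \<in> generate G S"
    proof induction
      case (incl h)
      then show ?case using assms(2) by (auto intro: generate.intros)
    next
      case (inv h)
      then have "h = \<one> \<or> h \<in> S" using assms(2) by blast
      then show ?case using generate.one generate.inv by (metis inv_one)
    qed (auto intro: generate.intros)
  qed
qed

text \<open>The assumptions amount to \<open>G\<close> being free abelian with basis
  \<open>b\<close>. They are stated through the dual coordinates because these are what modules
  provide, as multiplicities.\<close>

locale coordinates = comm_group G for G (structure) +
  fixes I :: "'x set" and b :: "'x \<Rightarrow> 'a" and coord :: "'x \<Rightarrow> 'a \<Rightarrow> int"
  assumes fin: "finite I"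
    and b_closed: "x \<in> I \<Longrightarrow> b x \<in> carrier G"
    and coord_hom: "x \<in> I \<Longrightarrow> coord x \<in> hom G integer_group"
    and coord_b: "x \<in> I \<Longrightarrow> y \<in> I \<Longrightarrow> coord x (b y) = of_bool (x = y)"
    and coord_inj: "g \<in> carrier G \<Longrightarrow> (\<And>x. x \<in> I \<Longrightarrow> coord x g = 0) \<Longrightarrow> g = \<one>"
begin

lemma coord_simps:
  assumes x: "x \<in> I"
  shows "coord x \<one> = 0"
    "g \<in> carrier G \<Longrightarrow> h \<in> carrier G \<Longrightarrow> coord x (g \<otimes> h) = coord x g + coord x h"
    "g \<in> carrier G \<Longrightarrow> coord x (inv g) = - coord x g"
    "g \<in> carrier G \<Longrightarrow> coord x (g [^] (k::int)) = k * coord x g"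
proof -
  interpret group_hom G integer_group "coord x"
    by (intro group_hom.intro group_hom_axioms.intro is_group group_integer_group coord_hom[OF x])
  show "coord x \<one> = 0" using hom_one by simp
  show "coord x (g \<otimes> h) = coord x g + coord x h" if "g \<in> carrier G" "h \<in> carrier G"
    using hom_mult[OF that] by simp
  show "coord x (inv g) = - coord x g" if "g \<in> carrier G"
    using hom_inv[OF that] by simp
  show "coord x (g [^] k) = k * coord x g" if "g \<in> carrier G"
    using hom_int_pow[OF that, of k] by simp
qed

lemma coord_finprod:
  assumes "finite A" "\<And>a. a \<in> A \<Longrightarrow> f a \<in> carrier G" "x \<in> I"
  shows "coord x (finprod G f A) = (\<Sum>a\<in>A. coord x (f a))"
  using assms by (induction A rule: finite_induct) (auto simp: coord_simps finprod_insert Pi_iff)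

lemma b_inj: "inj_on b I"
proof (rule inj_onI)
  fix x y assume "x \<in> I" "y \<in> I" "b x = b y"
  then show "x = y" using coord_b[of x x] coord_b[of x y] by (auto split: if_splits)
qed

lemma coord_generate:
  assumes "T \<subseteq> I" "g \<in> generate G (b ` T)" "x \<in> I" "x \<notin> T"
  shows "coord x g = 0"
proof -
  have bT: "b ` T \<subseteq> carrier G" using assms(1) b_closed by blast
  have "b y \<in> carrier G \<and> coord x (b y) = 0" if "y \<in> T" for y
    using that assms b_closed coord_b[of x y] by auto
  note bc = this
  show ?thesis using assms(2)
  proof induction
    case one
    show ?case by (rule coord_simps(1)[OF assms(3)])
  next
    case (incl h)
    then show ?case using bc by blast
  next
    case (inv h)
    then show ?case using bc coord_simps(3)[OF assms(3), of h] by auto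
  next
    case (eng g h)
    then show ?case
      using coord_simps(2)[OF assms(3), of g h] generate_in_carrier[OF bT] by simp
  qed
qed

text \<open>More than \<open>card T\<close> elements satisfy an integer relation in the
  \<open>T\<close>-coordinates. The other coordinates are zero on the subgroup, so
  \<open>coord_inj\<close> makes it a relation in \<open>G\<close>. Applying the coordinates shows
  that the generators themselves are independent.\<close>

lemma z_rank_generate:
  assumes T: "T \<subseteq> I"
  shows "z_rank G (generate G (b ` T)) = enat (card T)"
proof -
  have finT: "finite T" using T fin finite_subset by blast
  have bT: "b ` T \<subseteq> carrier G" using T b_closed by blast
  have injT: "inj_on b T" using b_inj T inj_on_subset by blast
  have upper: "card B \<le> card T" if B: "B \<subseteq> generate G (b ` T)" "z_independent G B" for B
  proof (rule ccontr)
    assume "\<not> card B \<le> card T"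
    then have lt: "card T < card B" by simp
    have finB: "finite B" and BG: "B \<subseteq> carrier G" using B(2) by (auto simp: z_independent_def)
    obtain c where c: "\<exists>g\<in>B. c g \<noteq> 0" "\<And>t. t \<in> T \<Longrightarrow> (\<Sum>g\<in>B. c g * coord t g) = 0"
      using integer_relation[OF finT finB lt, of "\<lambda>g t. coord t g"] by blast
    have cl: "g [^] c g \<in> carrier G" if "g \<in> B" for g using that BG by auto
    have "finprod G (\<lambda>g. g [^] c g) B = \<one>"
    proof (rule coord_inj)
      show "finprod G (\<lambda>g. g [^] c g) B \<in> carrier G" using cl by (intro finprod_closed) auto
      fix x assume x: "x \<in> I"
      have "coord x (finprod G (\<lambda>g. g [^] c g) B) = (\<Sum>g\<in>B. coord x (g [^] c g))"
        by (rule coord_finprod[OF finB cl x])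
      also have "\<dots> = (\<Sum>g\<in>B. c g * coord x g)"
        by (rule sum.cong) (use BG coord_simps[OF x] in auto)
      also have "\<dots> = 0"
      proof (cases "x \<in> T")
        case True then show ?thesis by (rule c(2))
      next
        case False
        then show ?thesis using coord_generate[OF T _ x] B(1) by (intro sum.neutral) auto
      qed
      finally show "coord x (finprod G (\<lambda>g. g [^] c g) B) = 0" .
    qed
    then show False using B(2) c(1) unfolding z_independent_def by blast
  qed
  have indep: "z_independent G (b ` T)"
    unfolding z_independent_def
  proof (intro conjI allI impI ballI bT)
    show "finite (b ` T)" using finT by simp
    fix c :: "'a \<Rightarrow> int" and g assume one: "finprod G (\<lambda>b. b [^] c b) (b ` T) = \<one>" and g: "g \<in> b ` T"
    then obtain t where t: "t \<in> T" "g = b t" by blast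
    have tI: "t \<in> I" using t T by blast
    have "0 = coord t (finprod G (\<lambda>b. b [^] c b) (b ` T))" unfolding one by (simp add: coord_simps(1)[OF tI])
    also have "\<dots> = (\<Sum>g\<in>b ` T. coord t (g [^] c g))"
      using finT bT by (intro coord_finprod[OF _ _ tI]) auto
    also have "\<dots> = (\<Sum>x\<in>T. coord t (b x [^] c (b x)))" using injT by (simp add: sum.reindex)
    also have "\<dots> = (\<Sum>x\<in>T. if x = t then c (b x) else 0)"
    proof (rule sum.cong)
      fix x assume "x \<in> T"
      then have "x \<in> I" using T by blast
      then show "coord t (b x [^] c (b x)) = (if x = t then c (b x) else 0)"
        using coord_simps(4)[OF tI b_closed] coord_b[OF tI] by auto
    qed simp
    also have "\<dots> = c g" using t finT by simp
    finally show "c g = 0" by simp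
  qed
  have "b ` T \<subseteq> generate G (b ` T)" by (auto intro: generate.incl)
  moreover have "enat (card T) = enat (card (b ` T))" by (simp add: card_image[OF injT])
  ultimately have lower: "enat (card T) \<in> {enat (card B) |B. B \<subseteq> generate G (b ` T) \<and> z_independent G B}"
    using indep by blast
  show ?thesis unfolding z_rank_def
  proof (rule antisym)
    show "Sup {enat (card B) |B. B \<subseteq> generate G (b ` T) \<and> z_independent G B} \<le> enat (card T)"
    proof (rule Sup_least)
      fix e assume "e \<in> {enat (card B) |B. B \<subseteq> generate G (b ` T) \<and> z_independent G B}"
      then obtain B where "e = enat (card B)" "B \<subseteq> generate G (b ` T)" "z_independent G B" by blast
      then show "e \<le> enat (card T)" using upper[of B] by simp
    qed
  qed (rule Sup_upper[OF lower])
qed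

end

section \<open>The group of a cyclic Nakayama algebra\<close>

lemma diag_null: "diag A (0\<^sub>m 0 0) = (A :: 'a::zero mat)"
  by (rule eq_matI) (auto simp: diag_def)

lemma rep_iso_dsum_null:
  assumes "is_rep N M" shows "rep_iso N M (dsum M null_rep)"
proof -
  have "(\<lambda>i. 1\<^sub>m (dm M i)) \<in> rep_hom N M (dsum M null_rep)" "(\<lambda>i. 1\<^sub>m (dm M i)) \<in> rep_hom N (dsum M null_rep) M"
    by (rule rep_homI; use assms in \<open>simp add: diag_null mat_algebra is_repD\<close>)+
  then show ?thesis unfolding rep_iso_def by (intro bexI[of _ "\<lambda>i. 1\<^sub>m (dm M i)"]) auto
qed

section \<open>The universal property of \<open>K0\<close> and the classes of modules\<close>

context nakayama begin

lemma relators_closed: "K0_relators N REL \<subseteq> carrier (free_Abelian_group (modules N REL :: 'k::field rep set))"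
proof
  fix f :: "'k rep \<Rightarrow>\<^sub>0 int" assume "f \<in> K0_relators N REL"
  then consider A B C where "f = frag_of C - frag_of A - frag_of B" "A \<in> modules N REL" "B \<in> modules N REL" "C \<in> modules N REL"
    | P where "f = frag_of P" "projective N REL P"
    unfolding K0_relators_def by blast
  then show "f \<in> carrier (free_Abelian_group (modules N REL))"
  proof cases
    case 1
    then have "Poly_Mapping.keys f \<subseteq> {A, B, C}"
      using keys_diff[of "frag_of C - frag_of A" "frag_of B"] keys_diff[of "frag_of C" "frag_of A"] by auto
    then show ?thesis using 1 by auto
  next
    case 2
    then show ?thesis by (auto simp: projective_def)
  qed
qed

lemma kernel_subgroup: "subgroup (K0_kernel N REL) (free_Abelian_group (modules N REL :: 'k::field rep set))"
  unfolding K0_kernel_def by (rule group.generate_is_subgroup[OF group_free_Abelian_group relators_closed])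

lemma kernel_normal: "K0_kernel N REL \<lhd> free_Abelian_group (modules N REL :: 'k::field rep set)"
  using kernel_subgroup comm_group.normal_iff_subgroup[OF abelian_free_Abelian_group] by blast

lemma K0_comm_group: "comm_group (K0 N REL :: ('k::field rep \<Rightarrow>\<^sub>0 int) set monoid)"
  unfolding K0_def by (rule comm_group.abelian_FactGroup[OF abelian_free_Abelian_group kernel_subgroup])

lemma K0_group: "group (K0 N REL :: ('k::field rep \<Rightarrow>\<^sub>0 int) set monoid)"
  using K0_comm_group comm_group_def by blast

abbreviation cls :: "'k::field rep \<Rightarrow> ('k rep \<Rightarrow>\<^sub>0 int) set" where
  "cls M \<equiv> K0_class N REL M"

lemma cls_closed: "M \<in> modules N REL \<Longrightarrow> cls M \<in> carrier (K0 N REL)"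
  unfolding K0_class_def K0_def carrier_FactGroup by (rule imageI) simp

text \<open>The induced map on the free group kills the relators and hence the subgroup they
  generate. Both \<open>L_op\<close> and the coordinates are obtained from here.\<close>

lemma K0_universal:
  fixes H :: "('h, 'm) monoid_scheme" and u :: "'k::field rep \<Rightarrow> 'h"
  assumes H: "comm_group H" and u: "\<And>M. M \<in> modules N REL \<Longrightarrow> u M \<in> carrier H"
    and add: "\<And>A B C. A \<in> modules N REL \<Longrightarrow> B \<in> modules N REL \<Longrightarrow> C \<in> modules N REL \<Longrightarrow>
       rep_iso N C (dsum A B) \<Longrightarrow> u C = u A \<otimes>\<^bsub>H\<^esub> u B"
    and proj: "\<And>P. projective N REL P \<Longrightarrow> u P = \<one>\<^bsub>H\<^esub>"
  shows "\<exists>g\<in>hom (K0 N REL) H. \<forall>M\<in>modules N REL. g (cls M) = u M"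
proof -
  let ?F = "free_Abelian_group (modules N REL :: 'k rep set)"
  interpret H: comm_group H by (rule H)
  have "u ` modules N REL \<subseteq> carrier H" using u by blast
  then obtain h where h: "h \<in> hom ?F H" and hu: "\<And>M. M \<in> modules N REL \<Longrightarrow> h (frag_of M) = u M"
    using H.free_Abelian_group_universal by blast
  interpret h: group_hom ?F H h
    by (intro group_hom.intro group_hom_axioms.intro h H.is_group group_free_Abelian_group)
  have hdiff: "h (x - y) = h x \<otimes>\<^bsub>H\<^esub> inv\<^bsub>H\<^esub> h y" if "x \<in> carrier ?F" "y \<in> carrier ?F" for x y
  proof -
    have neg: "- y \<in> carrier ?F" using that by simp
    have "h (x + - y) = h x \<otimes>\<^bsub>H\<^esub> h (- y)"
      using h.hom_mult[OF that(1) neg] unfolding mult_free_Abelian_group .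
    moreover have "h (- y) = inv\<^bsub>H\<^esub> h y" using h.hom_inv[OF that(2)] that by simp
    ultimately show ?thesis by simp
  qed
  have rel: "h f = \<one>\<^bsub>H\<^esub>" if f: "f \<in> K0_relators N REL" for f
  proof -
    from f consider A B C where "f = frag_of C - frag_of A - frag_of B" "A \<in> modules N REL" "B \<in> modules N REL"
        "C \<in> modules N REL" "rep_iso N C (dsum A B)"
      | P where "f = frag_of P" "projective N REL P"
      unfolding K0_relators_def by blast
    then show ?thesis
    proof cases
      case 1
      have "frag_of C - frag_of A \<in> carrier ?F"
        using keys_diff[of "frag_of C" "frag_of A"] 1 by auto
      then have "h f = u C \<otimes>\<^bsub>H\<^esub> inv\<^bsub>H\<^esub> u A \<otimes>\<^bsub>H\<^esub> inv\<^bsub>H\<^esub> u B"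
        using 1 by (simp add: hdiff hu)
      also have "\<dots> = \<one>\<^bsub>H\<^esub>"
        using add[OF 1(2-5)] u[OF 1(2)] u[OF 1(3)]
        by (simp add: H.m_assoc H.m_comm[of "u A"] flip: H.inv_mult)
      finally show ?thesis .
    next
      case 2
      then show ?thesis using hu proj by (simp add: projective_def)
    qed
  qed
  have ker: "h f = \<one>\<^bsub>H\<^esub>" if "f \<in> K0_kernel N REL" for f
    using that unfolding K0_kernel_def
  proof induction
    case one
    then show ?case using h.hom_one by simp
  next
    case (incl f)
    then show ?case by (rule rel)
  next
    case (inv f)
    then show ?case using h.hom_inv[of f] relators_closed rel by (metis H.inv_one subsetD)
  next
    case (eng f g)
    then have "f \<in> carrier ?F" "g \<in> carrier ?F"
      using group.generate_in_carrier[OF group_free_Abelian_group relators_closed] by blast+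
    then show ?case using h.hom_mult[of f g] eng by simp
  qed
  show ?thesis
  proof (rule FactGroup_universal[OF h kernel_normal])
    fix x y assume xy: "x \<in> carrier ?F" "y \<in> carrier ?F"
      "K0_kernel N REL #>\<^bsub>?F\<^esub> x = K0_kernel N REL #>\<^bsub>?F\<^esub> y"
    have "x \<in> K0_kernel N REL #>\<^bsub>?F\<^esub> y"
      using xy(3) group.rcos_self[OF group_free_Abelian_group xy(1) kernel_subgroup] by simp
    then obtain k where k: "k \<in> K0_kernel N REL" "x = k \<otimes>\<^bsub>?F\<^esub> y" unfolding r_coset_def by blast
    have "k \<in> carrier ?F" using k(1) subgroup.subset[OF kernel_subgroup] by blast
    then show "h x = h y" using k xy h.hom_mult[of k y] ker[OF k(1)] h.hom_closed[OF xy(2)] by simp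
  next
    fix g assume g: "g \<in> hom (free_Abelian_group (modules N REL) Mod K0_kernel N REL) H"
      "\<And>x. x \<in> carrier ?F \<Longrightarrow> g (K0_kernel N REL #>\<^bsub>?F\<^esub> x) = h x"
    then have "g (cls M) = u M" if "M \<in> modules N REL" for M
      using that hu by (simp add: K0_class_def)
    then show ?thesis using g(1) unfolding K0_def by blast
  qed
qed

text \<open>Module classes generate the group. This gives the uniqueness of \<open>L_op\<close> and
  reduces identities between homomorphisms to modules.\<close>

lemma K0_hom_eq:
  fixes H :: "('h, 'm) monoid_scheme"
  assumes H: "group H" and g: "g \<in> hom (K0 N REL) H" and g': "g' \<in> hom (K0 N REL) H"
    and eq: "\<And>M :: 'k::field rep. M \<in> modules N REL \<Longrightarrow> g (cls M) = g' (cls M)"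
    and x: "x \<in> carrier (K0 N REL)"
  shows "g x = g' x"
proof -
  let ?F = "free_Abelian_group (modules N REL :: 'k rep set)"
  let ?c = "\<lambda>f. K0_kernel N REL #>\<^bsub>?F\<^esub> f"
  interpret n: normal "K0_kernel N REL" ?F by (rule kernel_normal)
  have c: "?c \<in> hom ?F (K0 N REL)" unfolding K0_def by (rule n.r_coset_hom_Mod)
  have hom: "(\<lambda>f. h (?c f)) \<in> hom ?F H" if "h \<in> hom (K0 N REL) H" for h
    using hom_compose[OF c that] by (simp add: comp_def)
  have diff: "h (?c (u - v)) = h (?c u) \<otimes>\<^bsub>H\<^esub> inv\<^bsub>H\<^esub> h (?c v)"
    if "h \<in> hom (K0 N REL) H" "u \<in> carrier ?F" "v \<in> carrier ?F" for h u v
  proof -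
    interpret h: group_hom ?F H "\<lambda>f. h (?c f)"
      by (intro group_hom.intro group_hom_axioms.intro hom that H group_free_Abelian_group)
    have neg: "- v \<in> carrier ?F" using that by simp
    have "h (?c (u + - v)) = h (?c u) \<otimes>\<^bsub>H\<^esub> h (?c (- v))"
      using h.hom_mult[OF that(2) neg] unfolding mult_free_Abelian_group .
    moreover have "h (?c (- v)) = inv\<^bsub>H\<^esub> h (?c v)" using h.hom_inv[OF that(3)] that by simp
    ultimately show ?thesis by simp
  qed
  have one: "h (?c 0) = \<one>\<^bsub>H\<^esub>" if "h \<in> hom (K0 N REL) H" for h
    using hom_one[OF hom[OF that] group_free_Abelian_group H] by simp
  obtain f where f: "Poly_Mapping.keys f \<subseteq> modules N REL" "x = ?c f"
    using x unfolding K0_def carrier_FactGroup by auto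
  have "g (?c f) = g' (?c f)"
  proof (rule free_Abelian_group_induct[OF f(1)])
    show "g (?c 0) = g' (?c 0)" using one[OF g] one[OF g'] by simp
    show "g (?c (u - v)) = g' (?c (u - v))"
      if "Poly_Mapping.keys u \<subseteq> modules N REL" "Poly_Mapping.keys v \<subseteq> modules N REL"
        "g (?c u) = g' (?c u)" "g (?c v) = g' (?c v)" for u v
      using that diff[OF g, of u v] diff[OF g', of u v] by simp
    show "g (?c (frag_of M)) = g' (?c (frag_of M))" if "M \<in> modules N REL" for M
      using eq[OF that] by (simp add: K0_class_def)
  qed
  then show ?thesis using f by simp
qed

lemma cls_dsum:
  fixes A B C :: "'k::field rep"
  assumes "A \<in> modules N REL" "B \<in> modules N REL" "C \<in> modules N REL" "rep_iso N C (dsum A B)"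
  shows "cls C = cls A \<otimes>\<^bsub>K0 N REL\<^esub> cls B"
proof -
  let ?F = "free_Abelian_group (modules N REL :: 'k rep set)"
  interpret n: normal "K0_kernel N REL" ?F by (rule kernel_normal)
  have "frag_of C - frag_of A - frag_of B \<in> K0_kernel N REL"
    unfolding K0_kernel_def using assms by (intro generate.incl) (auto simp: K0_relators_def)
  moreover have "frag_of A + frag_of B \<in> carrier ?F"
    using keys_add[of "frag_of A" "frag_of B"] assms by auto
  moreover have "frag_of C = (frag_of C - frag_of A - frag_of B) + (frag_of A + frag_of B)" by simp
  ultimately have "frag_of C \<in> K0_kernel N REL #>\<^bsub>?F\<^esub> (frag_of A + frag_of B)"
    unfolding r_coset_def by (metis (no_types, lifting) UN_iff insertI1 mult_free_Abelian_group)
  then have "K0_kernel N REL #>\<^bsub>?F\<^esub> (frag_of A + frag_of B) = K0_kernel N REL #>\<^bsub>?F\<^esub> frag_of C"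
    using \<open>frag_of A + frag_of B \<in> carrier ?F\<close>
    by (intro group.repr_independence[OF group_free_Abelian_group _ _ kernel_subgroup]) auto
  moreover have "cls A \<otimes>\<^bsub>K0 N REL\<^esub> cls B = K0_kernel N REL #>\<^bsub>?F\<^esub> (frag_of A + frag_of B)"
    unfolding K0_class_def K0_def using n.rcos_sum[of "frag_of A" "frag_of B"] assms by simp
  ultimately show ?thesis by (simp add: K0_class_def)
qed

lemma cls_projective:
  assumes "projective N REL P" shows "cls P = \<one>\<^bsub>K0 N REL\<^esub>"
proof -
  let ?F = "free_Abelian_group (modules N REL)"
  have "frag_of P \<in> K0_kernel N REL"
    unfolding K0_kernel_def using assms by (intro generate.incl) (auto simp: K0_relators_def)
  then show ?thesis
    unfolding K0_class_def K0_def one_FactGroup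
    using subgroup.rcos_const[OF kernel_subgroup group_free_Abelian_group] by blast
qed

lemma cls_zero: "M \<in> modules N REL \<Longrightarrow> zero_rep N M \<Longrightarrow> cls M = \<one>\<^bsub>K0 N REL\<^esub>"
  by (rule cls_projective[OF zero_rep_projective])

text \<open>The relators do not identify isomorphic modules directly; the identification goes
  through the direct sum of \<open>M'\<close> with \<open>null_rep\<close>, whose class is the
  identity.\<close>

lemma cls_iso:
  fixes M M' :: "'k::field rep"
  assumes "M \<in> modules N REL" "M' \<in> modules N REL" "rep_iso N M M'"
  shows "cls M = cls M'"
proof -
  interpret K: group "K0 N REL :: ('k rep \<Rightarrow>\<^sub>0 int) set monoid" by (rule K0_group)
  have r: "is_rep N M" "is_rep N M'" using assms modules_is_rep by blast+
  have "rep_iso N M (dsum M' null_rep)"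
    using rep_iso_trans[OF r is_rep_dsum[OF r(2) is_rep_null] assms(3) rep_iso_dsum_null[OF r(2)]] .
  from cls_dsum[OF assms(2) null_rep_modules assms(1) this]
  have "cls M = cls M' \<otimes>\<^bsub>K0 N REL\<^esub> cls null_rep" .
  moreover have "cls (null_rep :: 'k rep) = \<one>\<^bsub>K0 N REL\<^esub>"
    by (rule cls_zero[OF null_rep_modules]) (simp add: zero_rep_def)
  ultimately show ?thesis using cls_closed[OF assms(2)] by simp
qed

text \<open>The operator \<open>L\<close> exists since \<open>M \<mapsto> [\<Omega> M]\<close> satisfies the relations of \<open>K\<^sub>0\<close>.\<close>

definition syz :: "'k::field rep \<Rightarrow> 'k rep" where
  "syz M = (SOME K. split_syzygy N REL M K)"

lemma split_syzygy_exists: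
  assumes "M \<in> modules N REL" shows "\<exists>K. split_syzygy N REL M K"
proof -
  obtain xs where xs: "set xs \<subseteq> All" "rep_iso N M (dsl xs)" using decomposition[OF assms] by blast
  then have "set xs \<subseteq> All0" using All_subset by blast
  from split_syzygy_iso[OF split_syzygy_dsl[OF this] assms rep_iso_sym[OF xs(2)]] show ?thesis by blast
qed

lemma syz: "M \<in> modules N REL \<Longrightarrow> split_syzygy N REL M (syz M)"
  unfolding syz_def using split_syzygy_exists by (rule someI_ex)

lemma split_syzygy_modules: "split_syzygy N REL M K \<Longrightarrow> K \<in> modules N REL"
  unfolding split_syzygy_def using syzygy_dataD by blast

lemma syz_modules: "M \<in> modules N REL \<Longrightarrow> syz M \<in> modules N REL"
  using syz split_syzygy_modules by blast

lemma cls_syz: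
  assumes "M \<in> modules N REL" "is_syzygy N REL M K"
  shows "cls (syz M) = cls K"
proof (rule cls_iso)
  show "syz M \<in> modules N REL" by (rule syz_modules[OF assms(1)])
  show "K \<in> modules N REL" using assms(2) by (simp add: is_syzygy_def)
  show "rep_iso N (syz M) K"
    by (rule syzygy_unique[OF split_syzygy_is_syzygy[OF syz[OF assms(1)]] assms(2,1)])
qed

lemma syz_projective:
  fixes P :: "'k::field rep"
  assumes P: "projective N REL P"
  shows "cls (syz P) = \<one>\<^bsub>K0 N REL\<^esub>"
proof -
  have "cls (syz P) = cls null_rep"
    using P by (intro cls_syz split_syzygy_is_syzygy[OF split_syzygy_projective[OF P]]) (simp add: projective_def)
  also have "\<dots> = \<one>\<^bsub>K0 N REL\<^esub>" by (rule cls_zero[OF null_rep_modules]) (simp add: zero_rep_def)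
  finally show ?thesis .
qed

lemma syz_dsum:
  assumes A: "A \<in> modules N REL" and B: "B \<in> modules N REL" and C: "C \<in> modules N REL"
    and iso: "rep_iso N C (dsum A B)"
  shows "cls (syz C) = cls (syz A) \<otimes>\<^bsub>K0 N REL\<^esub> cls (syz B)"
proof -
  have "split_syzygy N REL C (dsum (syz A) (syz B))"
    by (rule split_syzygy_iso[OF split_syzygy_dsum[OF syz[OF A] syz[OF B] REL_start] C rep_iso_sym[OF iso]])
  then have "cls (syz C) = cls (dsum (syz A) (syz B))" by (intro cls_syz C split_syzygy_is_syzygy)
  also have "\<dots> = cls (syz A) \<otimes>\<^bsub>K0 N REL\<^esub> cls (syz B)"
    using syz_modules[OF A] syz_modules[OF B] dsum_modules
    by (intro cls_dsum rep_iso_refl modules_is_rep) auto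
  finally show ?thesis .
qed

lemma L_op:
  "L_op N REL \<in> hom (K0 N REL) (K0 N REL :: ('k::field rep \<Rightarrow>\<^sub>0 int) set monoid)"
  "\<And>(M :: 'k rep) K. M \<in> modules N REL \<Longrightarrow> is_syzygy N REL M K \<Longrightarrow> L_op N REL (cls M) = cls K"
proof -
  let ?K = "K0 N REL :: ('k rep \<Rightarrow>\<^sub>0 int) set monoid"
  let ?Q = "\<lambda>L. L \<in> hom ?K ?K \<and> L \<in> extensional (carrier ?K) \<and>
     (\<forall>M\<in>modules N REL. \<forall>K. is_syzygy N REL M K \<longrightarrow> L (cls M) = cls K)"
  have "\<exists>g\<in>hom ?K ?K. \<forall>M\<in>modules N REL. g (cls M) = cls (syz M)"
    by (rule K0_universal[OF K0_comm_group]) (rule cls_closed[OF syz_modules] syz_dsum syz_projective; assumption)+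
  then obtain g where g: "g \<in> hom ?K ?K" and gM: "\<And>M. M \<in> modules N REL \<Longrightarrow> g (cls M) = cls (syz M)"
    by blast
  interpret K: group ?K by (rule K0_group)
  have "?Q (restrict g (carrier ?K))"
  proof (intro conjI ballI allI impI)
    show "restrict g (carrier ?K) \<in> hom ?K ?K"
      using hom_in_carrier[OF g] hom_mult[OF g] by (intro homI) simp_all
    show "restrict g (carrier ?K) (cls M) = cls K" if "M \<in> modules N REL" "is_syzygy N REL M K" for M K
      using gM[OF that(1)] cls_closed[OF that(1)] cls_syz[OF that] by simp
  qed simp
  \<comment> \<open>Every module has a syzygy, so the values on all classes are prescribed.\<close>
  moreover have "L = L'" if L: "?Q L" and L': "?Q L'" for L L'
  proof (rule extensionalityI)
    show "L \<in> extensional (carrier ?K)" "L' \<in> extensional (carrier ?K)" using L L' by blast+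
    fix x assume x: "x \<in> carrier ?K"
    show "L x = L' x"
    proof (rule K0_hom_eq[OF K0_group _ _ _ x])
      show "L \<in> hom ?K ?K" "L' \<in> hom ?K ?K" using L L' by blast+
      fix M :: "'k rep" assume M: "M \<in> modules N REL"
      show "L (cls M) = L' (cls M)" using L L' M split_syzygy_is_syzygy[OF syz[OF M]] by metis
    qed
  qed
  ultimately have "\<exists>!L. ?Q L" by blast
  from theI'[OF this] have "?Q (L_op N REL)" unfolding L_op_def .
  then show "L_op N REL \<in> hom ?K ?K"
    "\<And>(M :: 'k rep) K. M \<in> modules N REL \<Longrightarrow> is_syzygy N REL M K \<Longrightarrow> L_op N REL (cls M) = cls K"
    by blast+
qed

lemma cls_not_Bas: "x \<in> All0 \<Longrightarrow> x \<notin> Bas \<Longrightarrow> cls (un x :: 'k::field rep) = \<one>\<^bsub>K0 N REL\<^esub>"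
proof (cases "snd x = 0")
  case True
  assume "x \<in> All0"
  then show ?thesis using True uni_zero[of "fst x"] by (intro cls_zero un_modules0) simp_all
next
  case False
  assume x: "x \<in> All0" "x \<notin> Bas"
  then have "x \<in> All" using False by (auto simp: All0_def All_def)
  then show ?thesis using x un_projective_iff cls_projective by blast
qed

lemma L_op_un:
  assumes "x \<in> Bas"
  shows "L_op N REL (cls (un x :: 'k::field rep)) = (if omega x \<in> Bas then cls (un (omega x)) else \<one>\<^bsub>K0 N REL\<^esub>)"
proof -
  have x: "x \<in> All0" using assms Bas_subset All_subset by blast
  have "L_op N REL (cls (un x :: 'k rep)) = cls (un (omega x))"
    by (rule L_op(2)[OF un_modules0[OF x] split_syzygy_is_syzygy[OF split_syzygy_un[OF x]]])
  moreover have "omega x \<notin> Bas \<Longrightarrow> cls (un (omega x) :: 'k rep) = \<one>\<^bsub>K0 N REL\<^esub>"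
    by (rule cls_not_Bas[OF omega_All0[OF x]])
  ultimately show ?thesis by simp
qed

text \<open>The coordinates are the multiplicities.  Reassembling an element from its coordinates is an endomorphism of
  \<open>K\<^sub>0\<close> that fixes the classes of all modules, hence it is the identity.\<close>

lemma K0_coordinates:
  "\<exists>coord. coordinates (K0 N REL) Bas (\<lambda>x. cls (un x :: 'k::field rep)) coord"
proof -
  let ?K = "K0 N REL :: ('k rep \<Rightarrow>\<^sub>0 int) set monoid"
  interpret K: comm_group ?K by (rule K0_comm_group)
  have Bas_vertex: "fst x \<in> {1..N}" if "x \<in> Bas" for x using that by (auto simp: Bas_def)
  have "\<exists>g\<in>hom ?K integer_group. \<forall>M\<in>modules N REL. g (cls M) = mult N M x" if x: "x \<in> Bas" for x
  proof (rule K0_universal[OF abelian_integer_group])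
    fix A B C :: "'k rep" assume ABC: "A \<in> modules N REL" "B \<in> modules N REL" "C \<in> modules N REL" "rep_iso N C (dsum A B)"
    have r: "is_rep N A" "is_rep N B" "is_rep N C" using ABC modules_is_rep by blast+
    show "mult N C x = mult N A x \<otimes>\<^bsub>integer_group\<^esub> mult N B x"
      using mult_iso[OF ABC(4) r(3) is_rep_dsum[OF r(1,2)] Bas_vertex[OF x]] mult_dsum[OF r(1,2) Bas_vertex[OF x]] by simp
  qed (use mult_projective[OF _ x] in auto)
  then obtain coord where hom: "\<And>x. x \<in> Bas \<Longrightarrow> coord x \<in> hom ?K integer_group"
    and cm: "\<And>x M. x \<in> Bas \<Longrightarrow> M \<in> modules N REL \<Longrightarrow> coord x (cls M) = mult N M x" by metis
  have unm: "un x \<in> modules N REL" if "x \<in> Bas" for x using that Bas_subset un_modules by blast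
  define rebuild where "rebuild g = finprod ?K (\<lambda>x. cls (un x :: 'k rep) [^]\<^bsub>?K\<^esub> coord x g) Bas" for g
  have bcl: "cls (un x :: 'k rep) \<in> carrier ?K" if "x \<in> Bas" for x using cls_closed unm that by blast
  have rhom: "rebuild \<in> hom ?K ?K"
  proof (rule homI)
    show "rebuild g \<in> carrier ?K" for g unfolding rebuild_def using bcl by (intro K.finprod_closed) auto
    fix g h assume gh: "g \<in> carrier ?K" "h \<in> carrier ?K"
    have "rebuild (g \<otimes>\<^bsub>?K\<^esub> h) = finprod ?K (\<lambda>x. cls (un x) [^]\<^bsub>?K\<^esub> coord x g \<otimes>\<^bsub>?K\<^esub> cls (un x) [^]\<^bsub>?K\<^esub> coord x h) Bas"
      unfolding rebuild_def
    proof (rule K.finprod_cong')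
      fix x assume x: "x \<in> Bas"
      have "coord x (g \<otimes>\<^bsub>?K\<^esub> h) = coord x g + coord x h" using hom_mult[OF hom[OF x] gh] by simp
      then show "cls (un x :: 'k rep) [^]\<^bsub>?K\<^esub> coord x (g \<otimes>\<^bsub>?K\<^esub> h) =
          cls (un x) [^]\<^bsub>?K\<^esub> coord x g \<otimes>\<^bsub>?K\<^esub> cls (un x) [^]\<^bsub>?K\<^esub> coord x h"
        using K.int_pow_mult[OF bcl[OF x]] by simp
    qed (use bcl in auto)
    also have "\<dots> = rebuild g \<otimes>\<^bsub>?K\<^esub> rebuild h"
      unfolding rebuild_def using bcl by (intro K.finprod_multf) auto
    finally show "rebuild (g \<otimes>\<^bsub>?K\<^esub> h) = rebuild g \<otimes>\<^bsub>?K\<^esub> rebuild h" .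
  qed
  \<comment> \<open>For projective \<open>y\<close> both sides are the identity; otherwise the
    coordinates single out one factor.\<close>
  have run: "rebuild (cls (un y)) = cls (un y)" if y: "y \<in> All" for y
  proof -
    have "rebuild (cls (un y)) = finprod ?K (\<lambda>x. if x = y then cls (un x) else \<one>\<^bsub>?K\<^esub>) Bas"
      unfolding rebuild_def
    proof (rule K.finprod_cong')
      fix x assume x: "x \<in> Bas"
      then have "x \<in> All" using Bas_subset by blast
      then have "mult N (un y :: 'k rep) x = of_bool (x = y)" using y by (rule mult_un)
      then have "coord x (cls (un y)) = of_bool (x = y)" using cm[OF x un_modules[OF y]] by simp
      then show "cls (un x) [^]\<^bsub>?K\<^esub> coord x (cls (un y)) = (if x = y then cls (un x) else \<one>\<^bsub>?K\<^esub>)"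
        using bcl[OF x] by (cases "x = y") simp_all
    qed (use bcl in auto)
    also have "\<dots> = cls (un y)"
    proof (cases "y \<in> Bas")
      case True
      show ?thesis
        using K.finprod_singleton_swap[OF True finite_Bas, of "\<lambda>x. cls (un x)"] bcl by auto
    next
      case False
      have "finprod ?K (\<lambda>x. if x = y then cls (un x) else \<one>\<^bsub>?K\<^esub>) Bas = \<one>\<^bsub>?K\<^esub>"
        using False by (intro K.finprod_one_eqI) auto
      then show ?thesis using False y All_subset cls_not_Bas[of y] by auto
    qed
    finally show ?thesis .
  qed
  have rdsl: "rebuild (cls (dsl ys)) = cls (dsl ys)" if "set ys \<subseteq> All" for ys
    using that
  proof (induction ys)
    case Nil
    have "cls (null_rep :: 'k rep) = \<one>\<^bsub>?K\<^esub>" by (rule cls_zero[OF null_rep_modules]) (simp add: zero_rep_def)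
    then show ?case using hom_one[OF rhom K.is_group K.is_group] by simp
  next
    case (Cons y ys)
    then have y: "y \<in> All" and ys: "set ys \<subseteq> All" by auto
    have "cls (dsl (y # ys)) = cls (un y) \<otimes>\<^bsub>?K\<^esub> cls (dsl ys)"
      using un_modules[OF y] dsl_modules[OF ys] dsum_modules
      by (intro cls_dsum) (auto intro: rep_iso_refl modules_is_rep)
    then show ?case using Cons.IH[OF ys] run[OF y]
        hom_mult[OF rhom cls_closed[OF un_modules[OF y]] cls_closed[OF dsl_modules[OF ys]]] by simp
  qed
  have id: "rebuild g = g" if g: "g \<in> carrier ?K" for g
  proof -
    have "rebuild g = (\<lambda>x. x) g"
    proof (rule K0_hom_eq[OF K.is_group rhom _ _ g])
      show "(\<lambda>x. x) \<in> hom ?K ?K" by (rule homI) auto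
      fix M :: "'k rep" assume M: "M \<in> modules N REL"
      obtain xs where xs: "set xs \<subseteq> All" "rep_iso N M (dsl xs)" using decomposition[OF M] by blast
      then have "cls M = cls (dsl xs)" by (intro cls_iso M dsl_modules)
      then show "rebuild (cls M) = cls M" using rdsl[OF xs(1)] by simp
    qed
    then show ?thesis .
  qed
  have "coordinates ?K Bas (\<lambda>x. cls (un x :: 'k rep)) coord"
  proof (intro coordinates.intro coordinates_axioms.intro K.comm_group_axioms finite_Bas bcl hom)
    show "coord x (cls (un y)) = of_bool (x = y)" if "x \<in> Bas" "y \<in> Bas" for x y
    proof -
      have "mult N (un y :: 'k rep) x = of_bool (x = y)" using that Bas_subset by (intro mult_un) auto
      then show ?thesis using cm[OF that(1) unm[OF that(2)]] by simp
    qed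
    fix g assume g: "g \<in> carrier ?K" and zero: "\<And>x. x \<in> Bas \<Longrightarrow> coord x g = 0"
    have "rebuild g = \<one>\<^bsub>?K\<^esub>" unfolding rebuild_def using zero by (intro K.finprod_one_eqI) auto
    then show "g = \<one>\<^bsub>?K\<^esub>" using id[OF g] by simp
  qed
  then show ?thesis by blast
qed

end

section \<open>Computation of the \<phi>-dimension\<close>

context nakayama begin

lemma L_op_generate:
  assumes T: "T \<subseteq> Bas"
  shows "L_op N REL ` generate (K0 N REL) ((\<lambda>x. cls (un x :: 'k::field rep)) ` T) =
    generate (K0 N REL) ((\<lambda>x. cls (un x)) ` (omega ` T \<inter> Bas))"
proof -
  let ?K = "K0 N REL :: ('k rep \<Rightarrow>\<^sub>0 int) set monoid"
  let ?b = "\<lambda>x. cls (un x :: 'k rep)"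
  interpret L: group_hom ?K ?K "L_op N REL"
    by (intro group_hom.intro group_hom_axioms.intro K0_group L_op(1))
  have bT: "?b ` T \<subseteq> carrier ?K"
    using T Bas_subset un_modules cls_closed by blast
  have Lb: "L_op N REL (?b x) = (if omega x \<in> Bas then ?b (omega x) else \<one>\<^bsub>?K\<^esub>)" if "x \<in> T" for x
    using that T by (intro L_op_un) auto
  have "L_op N REL ` generate ?K (?b ` T) = generate ?K (L_op N REL ` ?b ` T)"
    by (rule L.generate_img[OF bT, symmetric])
  also have "\<dots> = generate ?K (?b ` (omega ` T \<inter> Bas))"
  proof (rule L.G.generate_insert_one)
    show "?b ` (omega ` T \<inter> Bas) \<subseteq> L_op N REL ` ?b ` T"
    proof
      fix g assume "g \<in> ?b ` (omega ` T \<inter> Bas)"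
      then obtain x where "x \<in> T" "omega x \<in> Bas" "g = ?b (omega x)" by blast
      then show "g \<in> L_op N REL ` ?b ` T" using Lb[of x] by (metis (no_types, lifting) imageI)
    qed
    show "L_op N REL ` ?b ` T \<subseteq> insert \<one>\<^bsub>?K\<^esub> (?b ` (omega ` T \<inter> Bas))"
    proof
      fix g assume "g \<in> L_op N REL ` ?b ` T"
      then obtain x where x: "x \<in> T" "g = L_op N REL (?b x)" by blast
      then show "g \<in> insert \<one>\<^bsub>?K\<^esub> (?b ` (omega ` T \<inter> Bas))"
        using Lb[OF x(1)] by (cases "omega x \<in> Bas") auto
    qed
  qed
  finally show ?thesis .
qed

lemma L_op_iterate:
  assumes T: "T \<subseteq> Bas"
  shows "(L_op N REL ^^ t) ` generate (K0 N REL) ((\<lambda>x. cls (un x :: 'k::field rep)) ` T) =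
    generate (K0 N REL) ((\<lambda>x. cls (un x)) ` stage T t)"
proof (induction t)
  case (Suc t)
  have "(L_op N REL ^^ Suc t) ` generate (K0 N REL) ((\<lambda>x. cls (un x :: 'k rep)) ` T) =
      L_op N REL ` (L_op N REL ^^ t) ` generate (K0 N REL) ((\<lambda>x. cls (un x :: 'k rep)) ` T)"
    by (simp add: image_comp)
  then show ?case using L_op_generate[OF stage_subset[OF T], of t] Suc by simp
qed simp

lemma z_rank_iterate:
  assumes T: "T \<subseteq> Bas" and H: "add_subgroup N REL (M :: 'k::field rep) = generate (K0 N REL) ((\<lambda>x. cls (un x :: 'k rep)) ` T)"
  shows "z_rank (K0 N REL) ((L_op N REL ^^ t) ` add_subgroup N REL M) = enat (card (stage T t))"
proof -
  obtain coord where "coordinates (K0 N REL) Bas (\<lambda>x. cls (un x :: 'k rep)) coord"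
    using K0_coordinates by blast
  from coordinates.z_rank_generate[OF this stage_subset[OF T]] show ?thesis
    unfolding H L_op_iterate[OF T] .
qed

lemma phi_fun_eq:
  assumes T: "T \<subseteq> Bas" and H: "add_subgroup N REL (M :: 'k::field rep) = generate (K0 N REL) ((\<lambda>x. cls (un x :: 'k rep)) ` T)"
  shows "phi_fun N REL M = (LEAST t. \<forall>j\<ge>1. card (stage T t) = card (stage T (t + j)))"
  unfolding phi_fun_def z_rank_iterate[OF T H] enat.inject ..

text \<open>By indecomposability, the summands after the first one add up to zero. Equality of
  classes, rather than an isomorphism, is what \<open>add_subgroup\<close> depends on.\<close>

lemma indecomposable_cls:
  fixes X :: "'k::field rep"
  assumes "indecomposable N REL X"
  shows "\<exists>x\<in>All. cls X = cls (un x :: 'k rep)"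
proof -
  have X: "X \<in> modules N REL" and nz: "\<not> zero_rep N X"
    and ind: "\<And>A B. A \<in> modules N REL \<Longrightarrow> B \<in> modules N REL \<Longrightarrow> rep_iso N X (dsum A B) \<Longrightarrow> zero_rep N A \<or> zero_rep N B"
    using assms unfolding indecomposable_def by blast+
  obtain xs where xs: "set xs \<subseteq> All" "rep_iso N X (dsl xs)" using decomposition[OF X] by blast
  show ?thesis
  proof (cases xs)
    case Nil
    then have "zero_rep N X" using rep_iso_dm[OF xs(2)] by (simp add: zero_rep_def)
    then show ?thesis using nz by blast
  next
    case (Cons x ys)
    have x: "x \<in> All" and ys: "set ys \<subseteq> All" using xs Cons by auto
    have iso: "rep_iso N X (dsum (un x) (dsl ys))" using xs(2) Cons by simp
    have "\<not> zero_rep N (un x :: 'k rep)"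
      using uni_indecomposable[OF x] unfolding indecomposable_def by blast
    then have zero: "zero_rep N (dsl ys :: 'k rep)" using ind[OF un_modules[OF x] dsl_modules[OF ys] iso] by blast
    interpret K: group "K0 N REL :: ('k rep \<Rightarrow>\<^sub>0 int) set monoid" by (rule K0_group)
    have "cls X = cls (un x) \<otimes>\<^bsub>K0 N REL\<^esub> cls (dsl ys)"
      by (rule cls_dsum[OF un_modules[OF x] dsl_modules[OF ys] X iso])
    moreover have "cls (un x :: 'k rep) \<in> carrier (K0 N REL)" by (rule cls_closed[OF un_modules[OF x]])
    ultimately have "cls X = cls (un x)" using cls_zero[OF dsl_modules[OF ys] zero] by simp
    then show ?thesis using x by blast
  qed
qed

text \<open>Basis elements are selected by their classes rather than as summands of
  \<open>M\<close>, which avoids identifying indecomposables up to isomorphism. Projective summands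
  contribute only the identity.\<close>

lemma add_subgroup_eq:
  fixes M :: "'k::field rep"
  defines "S \<equiv> {cls X | X. indecomposable N REL X \<and> summand N REL X M}"
  shows "add_subgroup N REL M = generate (K0 N REL) ((\<lambda>x. cls (un x)) ` {x \<in> Bas. cls (un x :: 'k rep) \<in> S})"
  unfolding add_subgroup_def S_def[symmetric]
proof (rule group.generate_insert_one[OF K0_group])
  show "(\<lambda>x. cls (un x)) ` {x \<in> Bas. cls (un x :: 'k rep) \<in> S} \<subseteq> S" by blast
  show "S \<subseteq> insert \<one>\<^bsub>K0 N REL\<^esub> ((\<lambda>x. cls (un x)) ` {x \<in> Bas. cls (un x :: 'k rep) \<in> S})"
  proof
    fix g assume g: "g \<in> S"
    then obtain X :: "'k rep" where X: "g = cls X" "indecomposable N REL X" by (auto simp: S_def)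
    then obtain x where x: "x \<in> All" "g = cls (un x :: 'k rep)" using indecomposable_cls by blast
    show "g \<in> insert \<one>\<^bsub>K0 N REL\<^esub> ((\<lambda>x. cls (un x)) ` {x \<in> Bas. cls (un x :: 'k rep) \<in> S})"
    proof (cases "x \<in> Bas")
      case True
      then show ?thesis using g x(2) by blast
    next
      case False
      have "cls (un x :: 'k rep) = \<one>\<^bsub>K0 N REL\<^esub>" by (rule cls_not_Bas) (use x All_subset False in auto)
      then show ?thesis using x(2) by simp
    qed
  qed
qed

lemma dsl_retract:
  assumes "x \<in> set xs"
  shows "\<exists>f\<in>rep_hom N (un x :: 'k::field rep) (dsl xs). \<exists>g\<in>rep_hom N (dsl xs) (un x).
    \<forall>i\<in>{1..N}. g i * f i = 1\<^sub>m (dm (un x :: 'k rep) i)"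
  using assms
proof (induction xs)
  case (Cons y xs)
  let ?U = "un y :: 'k rep" and ?W = "dsl xs :: 'k rep"
  note h = dsum_hom[OF is_rep_uni is_rep_dsl, of "fst y" "snd y" xs]
  show ?case
  proof (cases "x = y")
    case True
    then show ?thesis using h(1,3)
      by (intro bexI[of _ "\<lambda>i. inl (dm ?U i) (dm ?W i)"] bexI[of _ "\<lambda>i. prl (dm ?U i) (dm ?W i)"])
        (auto simp: biproduct)
  next
    case False
    then obtain f g where f: "f \<in> rep_hom N (un x) ?W" and g: "g \<in> rep_hom N ?W (un x)"
      and gf: "\<And>i. i \<in> {1..N} \<Longrightarrow> g i * f i = 1\<^sub>m (dm (un x :: 'k rep) i)"
      using Cons by auto
    note r = is_rep_uni is_rep_dsl is_rep_dsum[OF is_rep_uni is_rep_dsl]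
    note d = rep_homD(1,2)[OF f] rep_homD(1,2)[OF g]
    have "g i * prr (dm ?U i) (dm ?W i) * (inr (dm ?U i) (dm ?W i) * f i) = 1\<^sub>m (dm (un x :: 'k rep) i)"
      if i: "i \<in> {1..N}" for i
    proof -
      have "g i * prr (dm ?U i) (dm ?W i) * (inr (dm ?U i) (dm ?W i) * f i) =
          g i * (prr (dm ?U i) (dm ?W i) * inr (dm ?U i) (dm ?W i)) * f i"
        using i by (simp add: d mat_algebra del: uni_simps)
      then show ?thesis using i gf[OF i] by (simp add: biproduct d mat_algebra del: uni_simps)
    qed
    then show ?thesis
      unfolding dsl.simps
      by (intro bexI[OF _ rep_hom_comp[OF r f h(2)]] bexI[OF _ rep_hom_comp[OF r(3,2,1) h(4) g]] ballI)
        (simp del: uni_simps)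
  qed
qed simp

text \<open>The direct sum of all nonprojective uniserials has every basis class among its summands,
  so a single module attains the supremum.\<close>

lemma add_subgroup_full:
  "\<exists>M\<in>modules N REL. add_subgroup N REL (M :: 'k::field rep) = generate (K0 N REL) ((\<lambda>x. cls (un x :: 'k rep)) ` Bas)"
proof -
  obtain xs where xs: "set xs = Bas" using finite_list[OF finite_Bas] by blast
  have sub: "set xs \<subseteq> All" using xs Bas_subset by simp
  let ?M = "dsl xs :: 'k rep"
  let ?S = "{cls X | X. indecomposable N REL X \<and> summand N REL X ?M}"
  have "cls (un x :: 'k rep) \<in> ?S" if x: "x \<in> Bas" for x
  proof -
    have xA: "x \<in> All" using x Bas_subset by blast
    obtain f g where f: "f \<in> rep_hom N (un x) ?M" and g: "g \<in> rep_hom N ?M (un x)"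
      and gf: "\<And>i. i \<in> {1..N} \<Longrightarrow> g i * f i = 1\<^sub>m (dm (un x :: 'k rep) i)"
      using dsl_retract[of x xs] x xs by blast
    have "\<exists>W\<in>modules N REL. rep_iso N ?M (dsum (un x) W)"
      by (rule split_off_summand[OF dsl_modules[OF sub] is_rep_uni f g gf REL_start])
    then have "summand N REL (un x) ?M" unfolding summand_def using un_modules[OF xA] by blast
    then show ?thesis using uni_indecomposable[OF xA] by blast
  qed
  then have "{x \<in> Bas. cls (un x :: 'k rep) \<in> ?S} = Bas" by blast
  then have "add_subgroup N REL ?M = generate (K0 N REL) ((\<lambda>x. cls (un x :: 'k rep)) ` Bas)"
    using add_subgroup_eq[of ?M] by simp
  then show ?thesis using dsl_modules[OF sub] by blast
qed

text \<open>The upper bound is the stability of cardinalities for every subset of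
  \<open>Bas\<close>. The lower bound uses that the full chain is decreasing, so that equal
  cardinalities mean equal sets.\<close>

theorem phi_dim_eq: "phi_dim TYPE('k::field) N REL = enat depth"
  unfolding phi_dim_def
proof (rule antisym)
  show "(SUP M\<in>(modules N REL :: 'k rep set). enat (phi_fun N REL M)) \<le> enat depth"
  proof (rule SUP_least)
    fix M :: "'k rep"
    define T where "T = {x \<in> Bas. cls (un x :: 'k rep) \<in> {cls X | X. indecomposable N REL X \<and> summand N REL X M}}"
    have T: "T \<subseteq> Bas" by (auto simp: T_def)
    have "phi_fun N REL M \<le> depth"
      unfolding phi_fun_eq[OF T add_subgroup_eq[of M, folded T_def]]
      by (rule Least_le) (simp add: card_stage_stable[OF T])
    then show "enat (phi_fun N REL M) \<le> enat depth" by simp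
  qed
  obtain M :: "'k rep" where M: "M \<in> modules N REL"
    and H: "add_subgroup N REL M = generate (K0 N REL) ((\<lambda>x. cls (un x :: 'k rep)) ` Bas)"
    using add_subgroup_full by blast
  have "\<exists>t. \<forall>j\<ge>1. card (stage Bas t) = card (stage Bas (t + j))"
    by (rule exI[of _ depth]) (simp add: card_stage_stable)
  from LeastI_ex[OF this] have "card (stage Bas (phi_fun N REL M)) = card (stage Bas (phi_fun N REL M + 1))"
    unfolding phi_fun_eq[OF subset_refl H] by blast
  then have "depth \<le> phi_fun N REL M" by (intro depth_le) (simp add: One_nat_def del: stage.simps)
  then have "enat depth \<le> enat (phi_fun N REL M)" by simp
  also have "\<dots> \<le> (SUP M\<in>(modules N REL :: 'k rep set). enat (phi_fun N REL M))" by (rule SUP_upper[OF M])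
  finally show "enat depth \<le> (SUP M\<in>(modules N REL :: 'k rep set). enat (phi_fun N REL M))" .
qed

end

theorem mainTheorem1:
  fixes N :: nat and REL :: "path list"
  assumes "cyclic_nakayama N REL"
    and "global_dim TYPE('k::field) N REL = \<infinity>"
  shows "\<exists>m. phi_dim TYPE('k) N REL = enat m \<and> even m"
proof -
  interpret nakayama N REL by unfold_locales (rule assms(1))
  obtain x where "x \<in> Bas" "\<And>n. (omega ^^ n) x \<in> Bas" using infinite_orbit[OF assms(2)] by blast
  then have "even depth" by (rule even_depth)
  then show ?thesis using phi_dim_eq by blast
qed

end
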